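(* Let $\ell>1$, $\hat p:=\max\{p,2\}$, $a^*\in L^p(\Omega)$, and consider for $\alpha>0$ and $u^\delta\in Y$ the Tikhonov problem $$\min_{a\in D(S)}\left(\frac1\ell\|S(a)-u^\delta\|_Y^\ell+\frac{\alpha}{\hat p}\|a-a^*\|_{L^p(\Omega)}^{\hat p}\right).\tag{T}$$ The following assertions hold true: (i) For each $\alpha>0$ and $u^\delta\in Y$, problem (T) admits a solution $a^\delta_\alpha\in D(S)$. (ii) Let $\{\delta_k\}_{k=1}^\infty\subset(0,+\infty)$ be a null sequence and let $\{u^{\delta_k}\}_{k=1}^\infty\subset Y$ satisfy $\|u^{\delta_k}-u^\dagger\|_Y\le\delta_k$ for all $k\in\mathbb{N}$. Moreover, let $\{\alpha_k\}_{k=1}^\infty\subset(0,+\infty)$ fulfill $\alpha_k\to0$ and $\frac{\delta_k^\ell}{\alpha_k}\to0$. If, for every $k$, $a_k$ is a minimizer of (T) with $u^\delta$ and $\alpha$ replaced by $u^{\delta_k}$ and $\alpha_k$, respectively, then $a_k$ converges strongly to $a^\dagger$ in $L^p(\Omega)$.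
   Context: Setting. $\Omega\subset\mathbb{R}^n$ ($n\ge2$) is a bounded $C^{1,1}$ domain with boundary $\Gamma$; $\kappa\in L^\infty(\Omega)$ is real-valued with $0<\lambda_0\le\kappa(x)\le\Lambda$ for a.e. $x\in\Omega$, with constants $\lambda_0<\Lambda$; $\mu_{\overline\Omega}=\mu_\Omega+\mu_\Gamma\in C(\overline\Omega)^*$ is a fixed regular signed Borel measure on $\overline\Omega$. Fixed numbers: $p>\frac n2$, $\mathfrak p\ge p$, $\underline a>0$, $M>0$. The admissible set is $$D(S):=\{a\in L^{\mathfrak p}(\Omega) : \|a\|_{L^{\mathfrak p}(\Omega)}\le M\ \text{and}\ \underline a\le a(x)\ \text{for a.e. }x\in\Omega\}.$$ Sobolev spaces. $H^1_\tau(\Omega)$ is the real first-order Sobolev space with integrability exponent $\tau$ on $\Omega$ (restrictions to $\Omega$ of functions in $H^1_\tau(\mathbb{R}^n)$, with the quotient norm). Weak solution. The elliptic problem for a coefficient $a$ is the equation $-\nabla\cdot(\kappa\nabla u)+au=\mu_\Omega$ in $\Omega$ with boundary condition $\kappa\,\partial u/\partial\nu=\mu_\Gamma$ on $\Gamma$. A function $u\in H^1_1(\Omega)$ is a weak solution if $au\in L^1(\Omega)$ and $\int_\Omega\kappa\nabla u\cdot\nabla\varphi+au\varphi\,dx=\int_{\overline\Omega}\varphi\,d\mu_{\overline\Omega}$ for all $\varphi\in C^\infty(\overline\Omega)$. Recalled well-posedness (taken as known, due to Alibert and Raymond). For every $a\in D(S)$ there is a unique weak solution $u$ that belongs to $H^1_\tau(\Omega)$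 for all $1\le\tau<\frac n{n-1}$, and for each such $\tau$, $\|u\|_{H^1_\tau(\Omega)}\le C\|\mu_{\overline\Omega}\|_{M(\overline\Omega)}$ with $C$ independent of $a\in D(S)$, $\mu_{\overline\Omega}$ and $u$, where $\|\cdot\|_{M(\overline\Omega)}$ denotes the total variation norm. Solution operator. $Y$ is a real Banach space such that $H^1_\tau(\Omega)$ embeds continuously into $Y$ for some $1\le\tau<\frac n{n-1}$. The operator $S:D(S)\subset L^p(\Omega)\to Y$ maps $a\in D(S)$ to the unique weak solution $S(a)$. The exact datum $u^\dagger$ is the unique weak solution associated with a coefficient in $D(S)$, and the true solution $a^\dagger$ is the (unique) solution of $\min\{\|a-a^*\|_{L^p(\Omega)} : a\in D(S),\ S(a)=u^\dagger\}$. *)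

theory Defs
  imports "HOL-Analysis.Analysis"
begin

text \<open>
  Elements of function spaces over a set \<open>\<Omega>\<close> are represented by total functions on
  \<open>real^'n\<close>; only their values on \<open>\<Omega>\<close> matter, and two functions represent the same element
  iff they agree almost everywhere on \<open>\<Omega>\<close>.
\<close>

section \<open>Smooth functions and domains\<close>

definition grad :: "((real^'n) \<Rightarrow> real) \<Rightarrow> (real^'n) \<Rightarrow> (real^'n)" where
  "grad f x = (THE D. GDERIV f x :> D)"

primrec C_k :: "nat \<Rightarrow> ((real^'n) \<Rightarrow> real) \<Rightarrow> bool" where
  "C_k 0 f \<longleftrightarrow> continuous_on UNIV f"
| "C_k (Suc k) f \<longleftrightarrow> (\<forall>x. \<exists>D. GDERIV f x :> D) \<and> (\<forall>i. C_k k (\<lambda>x. grad f x $ i))"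

definition smooth :: "((real^'n) \<Rightarrow> real) \<Rightarrow> bool" where
  "smooth f \<longleftrightarrow> (\<forall>k. C_k k f)"

definition test_function :: "(real^'n) set \<Rightarrow> ((real^'n) \<Rightarrow> real) \<Rightarrow> bool" where
  "test_function \<Omega> \<phi> \<longleftrightarrow>
     smooth \<phi> \<and> compact (closure {x. \<phi> x \<noteq> 0}) \<and> closure {x. \<phi> x \<noteq> 0} \<subseteq> \<Omega>"

definition C11_function :: "((real^'n) \<Rightarrow> real) \<Rightarrow> bool" where
  "C11_function \<gamma> \<longleftrightarrow>
     (\<forall>x. \<exists>D. GDERIV \<gamma> x :> D) \<and> (\<exists>L. L-lipschitz_on UNIV (grad \<gamma>))"

text \<open>
  Near each boundary point, \<open>\<Omega>\<close> lies strictly on one side of a \<open>C\<^sup>1\<^sup>,\<^sup>1\<close> graph over the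
  hyperplane orthogonal to some unit vector \<open>e\<close>.  The function on the hyperplane is encoded as a
  function \<open>\<gamma>\<close> on the whole space that is constant in direction \<open>e\<close>, which avoids choosing a
  rotated coordinate system.
\<close>
definition bounded_C11_domain :: "(real^'n) set \<Rightarrow> bool" where
  "bounded_C11_domain \<Omega> \<longleftrightarrow>
     open \<Omega> \<and> connected \<Omega> \<and> \<Omega> \<noteq> {} \<and> bounded \<Omega> \<and>
     (\<forall>x0\<in>frontier \<Omega>. \<exists>r>0. \<exists>e \<gamma>.
        norm e = 1 \<and> C11_function \<gamma> \<and> (\<forall>x t. \<gamma> (x + t *\<^sub>R e) = \<gamma> x) \<and>
        \<Omega> \<inter> ball x0 r = {x \<in> ball x0 r. \<gamma> x < x \<bullet> e})"

section \<open>Lebesgue and Sobolev spaces\<close>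

definition Lp :: "real \<Rightarrow> (real^'n) set \<Rightarrow> ((real^'n) \<Rightarrow> 'b::euclidean_space) set" where
  "Lp \<tau> \<Omega> = {f \<in> borel_measurable (lebesgue_on \<Omega>).
     integrable (lebesgue_on \<Omega>) (\<lambda>x. norm (f x) powr \<tau>)}"

definition Lp_norm :: "real \<Rightarrow> (real^'n) set \<Rightarrow> ((real^'n) \<Rightarrow> 'b::euclidean_space) \<Rightarrow> real" where
  "Lp_norm \<tau> \<Omega> f = (LINT x|lebesgue_on \<Omega>. norm (f x) powr \<tau>) powr (1 / \<tau>)"

definition weak_gradient ::
  "(real^'n) set \<Rightarrow> ((real^'n) \<Rightarrow> real) \<Rightarrow> ((real^'n) \<Rightarrow> (real^'n)) \<Rightarrow> bool" where
  "weak_gradient \<Omega> u g \<longleftrightarrow>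
     (\<forall>K. compact K \<and> K \<subseteq> \<Omega> \<longrightarrow> integrable (lebesgue_on K) u \<and> integrable (lebesgue_on K) g) \<and>
     (\<forall>\<phi>. test_function \<Omega> \<phi> \<longrightarrow>
        (LINT x|lebesgue_on \<Omega>. u x *\<^sub>R grad \<phi> x) = - (LINT x|lebesgue_on \<Omega>. \<phi> x *\<^sub>R g x))"

text \<open>A weak gradient on an open set is unique almost everywhere, so any choice will do.\<close>
definition wgrad :: "(real^'n) set \<Rightarrow> ((real^'n) \<Rightarrow> real) \<Rightarrow> (real^'n) \<Rightarrow> (real^'n)" where
  "wgrad \<Omega> u = (SOME g. weak_gradient \<Omega> u g)"

definition H1_whole :: "real \<Rightarrow> ((real^'n) \<Rightarrow> real) set" where
  "H1_whole \<tau> = {U \<in> Lp \<tau> UNIV. \<exists>g \<in> Lp \<tau> UNIV. weak_gradient UNIV U g}"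

definition H1_whole_norm :: "real \<Rightarrow> ((real^'n) \<Rightarrow> real) \<Rightarrow> real" where
  "H1_whole_norm \<tau> U =
     (Lp_norm \<tau> UNIV U powr \<tau> + Lp_norm \<tau> UNIV (wgrad UNIV U) powr \<tau>) powr (1 / \<tau>)"

definition H1_extensions ::
  "real \<Rightarrow> (real^'n) set \<Rightarrow> ((real^'n) \<Rightarrow> real) \<Rightarrow> ((real^'n) \<Rightarrow> real) set" where
  "H1_extensions \<tau> \<Omega> u = {U \<in> H1_whole \<tau>. AE x in lebesgue_on \<Omega>. U x = u x}"

definition H1 :: "real \<Rightarrow> (real^'n) set \<Rightarrow> ((real^'n) \<Rightarrow> real) set" where
  "H1 \<tau> \<Omega> = {u. H1_extensions \<tau> \<Omega> u \<noteq> {}}"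

definition H1_norm :: "real \<Rightarrow> (real^'n) set \<Rightarrow> ((real^'n) \<Rightarrow> real) \<Rightarrow> real" where
  "H1_norm \<tau> \<Omega> u = (INF U\<in>H1_extensions \<tau> \<Omega> u. H1_whole_norm \<tau> U)"

text \<open>
  A continuous embedding of \<open>H1 \<tau> \<Omega>\<close> into a Banach space.  The last two conjuncts also give that
  \<open>\<iota> u\<close> depends only on the almost-everywhere class of \<open>u\<close>, and does so injectively.
\<close>
definition H1_embedding ::
  "real \<Rightarrow> (real^'n) set \<Rightarrow> (((real^'n) \<Rightarrow> real) \<Rightarrow> 'y::banach) \<Rightarrow> bool" where
  "H1_embedding \<tau> \<Omega> \<iota> \<longleftrightarrow>
     (\<forall>u\<in>H1 \<tau> \<Omega>. \<forall>v\<in>H1 \<tau> \<Omega>. \<iota> (\<lambda>x. u x + v x) = \<iota> u + \<iota> v) \<and>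
     (\<forall>u\<in>H1 \<tau> \<Omega>. \<forall>c. \<iota> (\<lambda>x. c * u x) = c *\<^sub>R \<iota> u) \<and>
     (\<forall>u\<in>H1 \<tau> \<Omega>. \<forall>v\<in>H1 \<tau> \<Omega>. \<iota> u = \<iota> v \<longrightarrow> (AE x in lebesgue_on \<Omega>. u x = v x)) \<and>
     (\<exists>C. \<forall>u\<in>H1 \<tau> \<Omega>. norm (\<iota> u) \<le> C * H1_norm \<tau> \<Omega> u)"

section \<open>Signed Borel measures on a closed set\<close>

text \<open>
  Real-valued countably additive set functions on the Borel subsets of \<open>K\<close>.  Regularity is
  automatic for finite Borel measures on closed subsets of Euclidean space.
\<close>
definition signed_borel_measure :: "(real^'n) set \<Rightarrow> ((real^'n) set \<Rightarrow> real) \<Rightarrow> bool" where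
  "signed_borel_measure K \<mu> \<longleftrightarrow> \<mu> {} = 0 \<and>
     (\<forall>A::nat \<Rightarrow> (real^'n) set. range A \<subseteq> sets (restrict_space borel K) \<and> disjoint_family A \<longrightarrow>
        (\<lambda>i. \<mu> (A i)) sums \<mu> (\<Union>i. A i))"

text \<open>
  The positive variation \<open>\<mu>\<^sup>+\<close> of the Jordan decomposition; the negative variation is the positive
  variation of \<open>-\<mu>\<close>.  (\<^const>\<open>ennreal\<close> maps negative reals to \<open>0\<close>.)
\<close>
definition pos_variation ::
  "(real^'n) set \<Rightarrow> ((real^'n) set \<Rightarrow> real) \<Rightarrow> (real^'n) measure" where
  "pos_variation K \<mu> = measure_of K (sets (restrict_space borel K))
     (\<lambda>A. SUP B\<in>{B \<in> sets (restrict_space borel K). B \<subseteq> A}. ennreal (\<mu> B))"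

definition signed_integral ::
  "(real^'n) set \<Rightarrow> ((real^'n) set \<Rightarrow> real) \<Rightarrow> ((real^'n) \<Rightarrow> real) \<Rightarrow> real" where
  "signed_integral K \<mu> \<phi> =
     (LINT x|pos_variation K \<mu>. \<phi> x) - (LINT x|pos_variation K (\<lambda>A. - \<mu> A). \<phi> x)"

definition total_variation_norm :: "(real^'n) set \<Rightarrow> ((real^'n) set \<Rightarrow> real) \<Rightarrow> real" where
  "total_variation_norm K \<mu> =
     measure (pos_variation K \<mu>) K + measure (pos_variation K (\<lambda>A. - \<mu> A)) K"

section \<open>The elliptic problem and its solution operator\<close>

definition admissible_set ::
  "(real^'n) set \<Rightarrow> real \<Rightarrow> real \<Rightarrow> real \<Rightarrow> ((real^'n) \<Rightarrow> real) set" where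
  "admissible_set \<Omega> q a_low M =
     {a \<in> Lp q \<Omega>. Lp_norm q \<Omega> a \<le> M \<and> (AE x in lebesgue_on \<Omega>. a_low \<le> a x)}"

text \<open>
  The test functions in \<open>C\<^sup>\<infinity>\<close> of the closure of \<open>\<Omega>\<close> are the restrictions of smooth functions on
  the whole space.  The measure \<open>\<mu>\<close> lives on the closure of \<open>\<Omega>\<close> and carries both the source
  (its part in \<open>\<Omega>\<close>) and the Neumann datum (its part on the boundary).
\<close>
definition weak_solution ::
  "(real^'n) set \<Rightarrow> ((real^'n) \<Rightarrow> real) \<Rightarrow> ((real^'n) set \<Rightarrow> real) \<Rightarrow>
   ((real^'n) \<Rightarrow> real) \<Rightarrow> ((real^'n) \<Rightarrow> real) \<Rightarrow> bool" where
  "weak_solution \<Omega> \<kappa> \<mu> a u \<longleftrightarrow>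
     u \<in> H1 1 \<Omega> \<and> (\<lambda>x. a x * u x) \<in> Lp 1 \<Omega> \<and>
     (\<forall>\<phi>. smooth \<phi> \<longrightarrow>
        (LINT x|lebesgue_on \<Omega>. \<kappa> x * (wgrad \<Omega> u x \<bullet> grad \<phi> x) + a x * u x * \<phi> x)
          = signed_integral (closure \<Omega>) \<mu> \<phi>)"

abbreviation crit_exp :: "'n::finite itself \<Rightarrow> real" where
  "crit_exp TYPE('n) \<equiv> real CARD('n) / (real CARD('n) - 1)"

text \<open>The weak solutions belonging to all the spaces \<open>H1 \<tau> \<Omega>\<close> with \<open>1 \<le> \<tau> < n / (n - 1)\<close>.\<close>
definition regular_weak_solution ::
  "(real^'n) set \<Rightarrow> ((real^'n) \<Rightarrow> real) \<Rightarrow> ((real^'n) set \<Rightarrow> real) \<Rightarrow>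
   ((real^'n) \<Rightarrow> real) \<Rightarrow> ((real^'n) \<Rightarrow> real) \<Rightarrow> bool" where
  "regular_weak_solution \<Omega> \<kappa> \<mu> a u \<longleftrightarrow>
     weak_solution \<Omega> \<kappa> \<mu> a u \<and> (\<forall>\<tau>. 1 \<le> \<tau> \<and> \<tau> < crit_exp TYPE('n) \<longrightarrow> u \<in> H1 \<tau> \<Omega>)"

text \<open>
  The well-posedness theorem of Alibert and Raymond for coefficients in \<open>D\<close>: existence, uniqueness
  (almost everywhere) and a bound uniform in the coefficient and the measure.
\<close>
definition well_posed ::
  "(real^'n) set \<Rightarrow> ((real^'n) \<Rightarrow> real) \<Rightarrow> ((real^'n) \<Rightarrow> real) set \<Rightarrow> bool" where
  "well_posed \<Omega> \<kappa> D \<longleftrightarrow>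
     (\<forall>\<mu>. signed_borel_measure (closure \<Omega>) \<mu> \<longrightarrow> (\<forall>a\<in>D.
        (\<exists>u. regular_weak_solution \<Omega> \<kappa> \<mu> a u) \<and>
        (\<forall>u v. regular_weak_solution \<Omega> \<kappa> \<mu> a u \<and> regular_weak_solution \<Omega> \<kappa> \<mu> a v \<longrightarrow>
           (AE x in lebesgue_on \<Omega>. u x = v x)))) \<and>
     (\<forall>\<tau>. 1 \<le> \<tau> \<and> \<tau> < crit_exp TYPE('n) \<longrightarrow>
        (\<exists>C. \<forall>\<mu> a u. signed_borel_measure (closure \<Omega>) \<mu> \<and> a \<in> D \<and>
           regular_weak_solution \<Omega> \<kappa> \<mu> a u \<longrightarrow>
           H1_norm \<tau> \<Omega> u \<le> C * total_variation_norm (closure \<Omega>) \<mu>))"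

text \<open>The solution as an element of the Banach space \<open>'y\<close> containing the Sobolev space via \<open>\<iota>\<close>.\<close>
definition solution_operator ::
  "(real^'n) set \<Rightarrow> ((real^'n) \<Rightarrow> real) \<Rightarrow> ((real^'n) set \<Rightarrow> real) \<Rightarrow>
   (((real^'n) \<Rightarrow> real) \<Rightarrow> 'y) \<Rightarrow> ((real^'n) \<Rightarrow> real) \<Rightarrow> 'y" where
  "solution_operator \<Omega> \<kappa> \<mu> \<iota> a = \<iota> (SOME u. regular_weak_solution \<Omega> \<kappa> \<mu> a u)"

definition tikhonov ::
  "(((real^'n) \<Rightarrow> real) \<Rightarrow> 'y::banach) \<Rightarrow> (real^'n) set \<Rightarrow> real \<Rightarrow> real \<Rightarrow>
   ((real^'n) \<Rightarrow> real) \<Rightarrow> real \<Rightarrow> 'y \<Rightarrow> ((real^'n) \<Rightarrow> real) \<Rightarrow> real" where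
  "tikhonov S \<Omega> p l a_star \<alpha> y a =
     1 / l * norm (S a - y) powr l
     + \<alpha> / max p 2 * Lp_norm p \<Omega> (\<lambda>x. a x - a_star x) powr (max p 2)"

end

theory Submission
  imports Defs "HOL-Complex_Analysis.Great_Picard" "HOL-Computational_Algebra.Polynomial"
begin

text \<open>
  For coefficients \<open>a k\<close> in \<open>D\<close> with states \<open>u k\<close>, the bound in \<open>H1 \<sigma> \<Omega>\<close> gives, by a Rellich theorem,
  a subsequence with \<open>u k\<close> convergent to some \<open>u\<close> in \<open>L\<^sup>s\<close>, where \<open>s\<close> is conjugate to \<open>p\<close>; this needs
  \<open>p > n/2\<close>. Weak limits of the \<open>a k\<close> are replaced by points of nested convex hulls of the tails that
  nearly minimise the distance to \<open>a_star\<close>: by uniform convexity they converge strongly, to some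
  \<open>a0\<close> in \<open>D\<close>. The same convex combinations \<open>w\<close> of the states solve the equation with a zeroth-order term
  \<open>f\<close> close to \<open>a0 u\<close>, and \<open>w - S a0\<close> solves the problem for \<open>a0\<close> with datum the \<open>L\<^sup>1\<close> function \<open>a0 w - f\<close>.
  The uniform bound of the well-posedness theorem therefore forces \<open>w\<close> towards \<open>S a0\<close>, which yields lower
  semicontinuity of the misfit. Existence of minimisers follows; strong convergence of the
  regularised solutions follows from the Radon--Riesz property of \<open>L\<^sup>p\<close>, and uniqueness of the limit from
  the convexity of the set of coefficients in \<open>D\<close> with a given state.
\<close>

section \<open>Elementary inequalities for powers\<close>

text \<open>The obstacle is the product \<open>a u\<close>: the coefficients converge only weakly,
  so the states must converge strongly in the dual exponent s. The deviation of u from its ball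
  averages is dominated by the convolution of |grad u| with a kernel of size |y|^(1-n), which is
  locally in \<open>L^\<sigma>\<close> exactly for \<sigma> < n/(n-1), the range that well-posedness
  offers. Young's convolution inequality with both exponents equal to \<sigma> then gives
  \<open>L^s\<close> with 1/s = 2/\<sigma> - 1, and for s conjugate to p the condition on \<sigma>
  reads p > n/2. For n = 2 this allows every p > 1, so uniform convexity is required for all p > 1;
  it is obtained by compactness, without an explicit modulus. Norms enter through their p-th powers,
  and the triangle inequality becomes one with a factor 1 + \<epsilon>, which limits can absorb.
  Since the Sobolev spaces consist of restrictions, near-optimal extensions reduce compactness to
  functions on the whole space.\<close>

lemma powr_gt_tangent:
  fixes w z p :: real
  assumes p: "p > 1" and z: "z > 0" and w: "w \<ge> 0" and wz: "w \<noteq> z"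
  shows "w powr p > z powr p + p * z powr (p - 1) * (w - z)"
proof (cases "w = 0")
  \<comment> \<open>The derivative rule requires a positive base, so \<open>w = 0\<close> is
    computed directly.\<close>
  case True
  have "z powr p = z powr (p - 1) * z"
    using z powr_mult_base[of z "p - 1"] by (simp add: mult.commute)
  then have "z powr p + p * z powr (p - 1) * (w - z) = (1 - p) * z powr p"
    using True by (simp add: algebra_simps)
  also have "\<dots> < 0"
    using p z by (simp add: mult_less_0_iff)
  finally show ?thesis using True by simp
next
  case False
  then have w0: "w > 0" using w by simp
  have D: "((\<lambda>x. x powr p) has_real_derivative p * x powr (p - 1)) (at x)" if "x > 0" for x :: real
    using has_real_derivative_powr[OF that] .
  show ?thesis
  proof (cases "w < z")
    case True
    obtain x where x: "x > w" "x < z" "z powr p - w powr p = (z - w) * (p * x powr (p - 1))"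
      using MVT2[OF True, of "\<lambda>x. x powr p" "\<lambda>x. p * x powr (p - 1)"] D w0
      by (metis order_less_le_trans)
    have "x powr (p - 1) < z powr (p - 1)"
      using x p w0 by (intro powr_less_mono2) auto
    then have "(z - w) * (p * x powr (p - 1)) < (z - w) * (p * z powr (p - 1))"
      using True p by (intro mult_strict_left_mono) auto
    then show ?thesis using x(3) by (simp add: algebra_simps)
  next
    case False
    then have zw: "z < w" using wz by simp
    obtain x where x: "x > z" "x < w" "w powr p - z powr p = (w - z) * (p * x powr (p - 1))"
      using MVT2[OF zw, of "\<lambda>x. x powr p" "\<lambda>x. p * x powr (p - 1)"] D z
      by (metis order_less_le_trans)
    have "z powr (p - 1) < x powr (p - 1)"
      using x p z by (intro powr_less_mono2) auto
    then have "(w - z) * (p * z powr (p - 1)) < (w - z) * (p * x powr (p - 1))"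
      using zw p by (intro mult_strict_left_mono) auto
    then show ?thesis using x(3) by (simp add: algebra_simps)
  qed
qed

text \<open>Either the moduli differ or only the signs do. Equal moduli with x \<noteq> y force x =
  -y and the midpoint 0; otherwise the tangent at the mean of the moduli lies strictly below both
  values, and its linear parts cancel in the sum.\<close>

lemma abs_powr_midpoint_less:
  fixes x y p :: real
  assumes p: "p > 1" and xy: "x \<noteq> y"
  shows "\<bar>(x + y) / 2\<bar> powr p < (\<bar>x\<bar> powr p + \<bar>y\<bar> powr p) / 2"
proof (cases "\<bar>x\<bar> = \<bar>y\<bar>")
  case True
  then have "x = - y" using xy by linarith
  moreover have "y \<noteq> 0" using xy calculation by auto
  ultimately show ?thesis by simp
next
  case False
  define z where "z = (\<bar>x\<bar> + \<bar>y\<bar>) / 2"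
  have z: "z > 0" "\<bar>x\<bar> \<noteq> z" "\<bar>y\<bar> \<noteq> z" using False unfolding z_def by auto
  have "\<bar>(x + y) / 2\<bar> powr p \<le> z powr p"
    using p unfolding z_def by (intro powr_mono2) auto
  moreover have "\<bar>x\<bar> powr p > z powr p + p * z powr (p - 1) * (\<bar>x\<bar> - z)"
    using powr_gt_tangent[OF p z(1) _ z(2)] by simp
  moreover have "\<bar>y\<bar> powr p > z powr p + p * z powr (p - 1) * (\<bar>y\<bar> - z)"
    using powr_gt_tangent[OF p z(1) _ z(3)] by simp
  moreover have "p * z powr (p - 1) * (\<bar>x\<bar> - z) + p * z powr (p - 1) * (\<bar>y\<bar> - z) = 0"
    unfolding z_def by (simp add: algebra_simps)
  ultimately show ?thesis by argo
qed

lemma abs_powr_midpoint_le: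
  fixes x y p :: real
  assumes p: "p > 1"
  shows "\<bar>(x + y) / 2\<bar> powr p \<le> (\<bar>x\<bar> powr p + \<bar>y\<bar> powr p) / 2"
  using abs_powr_midpoint_less[OF p, of x y] by (cases "x = y") auto

text \<open>By homogeneity the claim need only be checked on the compact set
  \<open>\<bar>x\<bar> powr p + \<bar>y\<bar> powr p = 1\<close>, where \<open>F\<close> is bounded away from \<open>0\<close> wherever \<open>E \<ge> \<epsilon>\<close>.\<close>

lemma homogeneous_domination:
  fixes E F :: "real \<Rightarrow> real \<Rightarrow> real"
  assumes p: "p > 0" and \<epsilon>: "\<epsilon> > 0"
    and contE: "continuous_on UNIV (\<lambda>z. E (fst z) (snd z))"
    and contF: "continuous_on UNIV (\<lambda>z. F (fst z) (snd z))"
    and homE: "\<And>c x y. c > 0 \<Longrightarrow> E (c * x) (c * y) = c powr p * E x y"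
    and homF: "\<And>c x y. c > 0 \<Longrightarrow> F (c * x) (c * y) = c powr p * F x y"
    and zero: "E 0 0 \<le> 0"
    and F0: "\<And>x y. F x y \<ge> 0" and EF: "\<And>x y. F x y = 0 \<Longrightarrow> E x y \<le> 0"
  obtains C where "C \<ge> 0" "\<And>x y. E x y \<le> \<epsilon> * (\<bar>x\<bar> powr p + \<bar>y\<bar> powr p) + C * F x y"
proof -
  define N where "N = (\<lambda>z::real\<times>real. \<bar>fst z\<bar> powr p + \<bar>snd z\<bar> powr p)"
  have contN: "continuous_on UNIV N"
    unfolding N_def using p by (intro continuous_intros continuous_on_powr') auto
  \<comment> \<open>The part of the unit sphere of \<open>N\<close> on which the \<epsilon>-term
    alone does not give the bound. By \<open>EF\<close> the function \<open>F\<close> has no zero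
    there, so compactness keeps it away from 0.\<close>
  define K where "K = {z. N z = 1 \<and> E (fst z) (snd z) \<ge> \<epsilon>}"
  have "closed K"
    unfolding K_def using contN contE
    by (intro closed_Collect_conj closed_Collect_eq closed_Collect_le) (auto intro!: continuous_intros)
  moreover have "K \<subseteq> {-1..1} \<times> {-1..1}"
  proof
    fix z assume "z \<in> K"
    then have z: "\<bar>fst z\<bar> powr p + \<bar>snd z\<bar> powr p = 1" by (simp add: K_def N_def)
    have "\<bar>t\<bar> \<le> 1" if "\<bar>t\<bar> powr p \<le> 1" for t :: real
    proof (rule ccontr)
      assume "\<not> \<bar>t\<bar> \<le> 1"
      then have "\<bar>t\<bar> powr p > 1" using gr_one_powr[of "\<bar>t\<bar>" p] p by simp
      then show False using that by simp
    qed
    moreover have "\<bar>fst z\<bar> powr p \<le> 1" "\<bar>snd z\<bar> powr p \<le> 1"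
      using z powr_ge_zero[of "\<bar>snd z\<bar>" p] powr_ge_zero[of "\<bar>fst z\<bar>" p] by linarith+
    ultimately show "z \<in> {-1..1} \<times> {-1..1}" by (cases z) (auto simp: abs_le_iff)
  qed
  ultimately have compK: "compact K"
    by (metis compact_Icc compact_Int_closed compact_Times inf.absorb_iff2)
  have "\<exists>C\<ge>0. \<forall>z\<in>K. E (fst z) (snd z) \<le> C * F (fst z) (snd z)"
  proof (cases "K = {}")
    case True
    then show ?thesis by auto
  next
    case False
    obtain z0 where z0: "z0 \<in> K" "\<And>z. z \<in> K \<Longrightarrow> F (fst z0) (snd z0) \<le> F (fst z) (snd z)"
      using continuous_attains_inf[OF compK False, of "\<lambda>z. F (fst z) (snd z)"] contF
      by (metis continuous_on_subset subset_UNIV)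
    obtain z1 where z1: "z1 \<in> K" "\<And>z. z \<in> K \<Longrightarrow> E (fst z1) (snd z1) \<ge> E (fst z) (snd z)"
      using continuous_attains_sup[OF compK False, of "\<lambda>z. E (fst z) (snd z)"] contE
      by (metis continuous_on_subset subset_UNIV)
    define m where "m = F (fst z0) (snd z0)"
    define e where "e = E (fst z1) (snd z1)"
    have "E (fst z0) (snd z0) > 0" using z0(1) \<epsilon> by (simp add: K_def)
    then have m: "m > 0" using EF[of "fst z0" "snd z0"] F0[of "fst z0" "snd z0"] unfolding m_def by fastforce
    have e: "e > 0" using z1(1) \<epsilon> by (simp add: K_def e_def)
    \<comment> \<open>The constant is the maximum of \<open>E\<close> over the minimum of
      \<open>F\<close> on \<open>K\<close>.\<close>
    have "E (fst z) (snd z) \<le> e / m * F (fst z) (snd z)" if "z \<in> K" for z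
    proof -
      have "E (fst z) (snd z) \<le> e" using z1(2)[OF that] by (simp add: e_def)
      also have "\<dots> = e / m * m" using m by simp
      also have "\<dots> \<le> e / m * F (fst z) (snd z)"
        using z0(2)[OF that] m e by (intro mult_left_mono) (auto simp: m_def)
      finally show ?thesis .
    qed
    then show ?thesis using m e by (intro exI[of _ "e / m"]) auto
  qed
  then obtain C where C: "C \<ge> 0" "\<And>z. z \<in> K \<Longrightarrow> E (fst z) (snd z) \<le> C * F (fst z) (snd z)" by blast
  have "E x y \<le> \<epsilon> * (\<bar>x\<bar> powr p + \<bar>y\<bar> powr p) + C * F x y" for x y
  proof (cases "x = 0 \<and> y = 0")
    case True
    then show ?thesis using zero C(1) F0[of 0 0] by (simp add: order_trans)
  next
    case False
    define n where "n = \<bar>x\<bar> powr p + \<bar>y\<bar> powr p"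
    have n: "n > 0"
    proof -
      have "\<bar>x\<bar> powr p \<ge> 0" "\<bar>y\<bar> powr p \<ge> 0" by auto
      moreover have "\<bar>x\<bar> powr p > 0 \<or> \<bar>y\<bar> powr p > 0" using False by auto
      ultimately show ?thesis unfolding n_def by linarith
    qed
    \<comment> \<open>Scaling by \<open>c\<close> moves \<open>(x, y)\<close> onto the sphere
      \<open>N = 1\<close>; homogeneity then multiplies the inequality back by
      \<open>n\<close>.\<close>
    define c where "c = n powr (- 1 / p)"
    have c: "c > 0" "c powr p = 1 / n"
      using n p unfolding c_def by (auto simp: powr_powr)
    have N1: "N (c * x, c * y) = 1"
      using c n by (simp add: N_def abs_mult powr_mult n_def flip: add_divide_distrib)
    have "E (c * x) (c * y) \<le> \<epsilon> + C * F (c * x) (c * y)"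
    proof (cases "E (c * x) (c * y) \<ge> \<epsilon>")
      case True
      then have "(c * x, c * y) \<in> K" using N1 by (simp add: K_def)
      then show ?thesis using C(2)[of "(c * x, c * y)"] \<epsilon> by simp
    next
      case False
      have "C * F (c * x) (c * y) \<ge> 0" using C(1) F0 by simp
      then show ?thesis using False by linarith
    qed
    then have "E x y / n \<le> (\<epsilon> * n + C * F x y) / n"
      using homE[OF c(1)] homF[OF c(1)] c(2) n by (simp add: field_simps)
    then have "E x y \<le> \<epsilon> * n + C * F x y" using n by (simp add: divide_le_cancel)
    then show ?thesis by (simp add: n_def)
  qed
  then show ?thesis using that C(1) by blast
qed

lemma abs_powr_homogeneous: "c > 0 \<Longrightarrow> \<bar>c * x\<bar> powr p = c powr p * \<bar>x\<bar> powr p" for c x p :: real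
  by (simp add: abs_mult powr_mult)

text \<open>By strict midpoint convexity the bracket after \<open>C\<close> vanishes only for x = y,
  where the left side vanishes as well, so domination by homogeneity applies. This is the pointwise
  source of uniform convexity, valid also for 1 < p < 2.\<close>

lemma abs_powr_uniformly_convex:
  fixes p \<epsilon> :: real
  assumes p: "p > 1" and \<epsilon>: "\<epsilon> > 0"
  obtains C where "C \<ge> 0" "\<And>x y. \<bar>x - y\<bar> powr p \<le> \<epsilon> * (\<bar>x\<bar> powr p + \<bar>y\<bar> powr p)
    + C * ((\<bar>x\<bar> powr p + \<bar>y\<bar> powr p) / 2 - \<bar>(x + y) / 2\<bar> powr p)"
proof -
  have h1: "\<bar>c * x - c * y\<bar> powr p = c powr p * \<bar>x - y\<bar> powr p" if "c > 0" for c x y :: real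
    using abs_powr_homogeneous[OF that, of "x - y"] by (simp add: right_diff_distrib)
  have h2: "\<bar>(c * x + c * y) / 2\<bar> powr p = c powr p * \<bar>(x + y) / 2\<bar> powr p" if "c > 0" for c x y :: real
    using abs_powr_homogeneous[OF that, of "(x + y) / 2"] by (simp add: distrib_left)
  have "\<exists>C\<ge>0. \<forall>x y. \<bar>x - y\<bar> powr p \<le> \<epsilon> * (\<bar>x\<bar> powr p + \<bar>y\<bar> powr p)
    + C * ((\<bar>x\<bar> powr p + \<bar>y\<bar> powr p) / 2 - \<bar>(x + y) / 2\<bar> powr p)"
  proof (rule homogeneous_domination[where p = p and \<epsilon> = \<epsilon> and E = "\<lambda>x y. \<bar>x - y\<bar> powr p"
      and F = "\<lambda>x y. (\<bar>x\<bar> powr p + \<bar>y\<bar> powr p) / 2 - \<bar>(x + y) / 2\<bar> powr p"])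
    show "continuous_on UNIV (\<lambda>z::real\<times>real. \<bar>fst z - snd z\<bar> powr p)"
      "continuous_on UNIV (\<lambda>z::real\<times>real. (\<bar>fst z\<bar> powr p + \<bar>snd z\<bar> powr p) / 2
         - \<bar>(fst z + snd z) / 2\<bar> powr p)"
      using p by (auto intro!: continuous_intros continuous_on_powr')
    show "(\<bar>c * x\<bar> powr p + \<bar>c * y\<bar> powr p) / 2 - \<bar>(c * x + c * y) / 2\<bar> powr p
      = c powr p * ((\<bar>x\<bar> powr p + \<bar>y\<bar> powr p) / 2 - \<bar>(x + y) / 2\<bar> powr p)" if "c > 0" for c x y :: real
      unfolding h2[OF that] abs_powr_homogeneous[OF that] by (simp add: algebra_simps)
    show "\<bar>x - y\<bar> powr p \<le> 0"
      if "(\<bar>x\<bar> powr p + \<bar>y\<bar> powr p) / 2 - \<bar>(x + y) / 2\<bar> powr p = 0" for x y :: real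
      using abs_powr_midpoint_less[OF p, of x y] that by (cases "x = y") auto
  qed (use p \<epsilon> h1 abs_powr_midpoint_le[OF p] in auto)
  then show ?thesis using that by blast
qed

text \<open>Replaces Minkowski's inequality for p-th powers. The factor 1 + \<epsilon>, instead of
  2^(p-1), lets an upper bound survive a vanishing perturbation without loss. Domination is applied
  to the excess |x + y|^p - |x|^p, which is 0 when y = 0.\<close>

lemma abs_powr_add_le:
  fixes p \<epsilon> :: real
  assumes p: "p > 0" and \<epsilon>: "\<epsilon> > 0"
  obtains C where "C \<ge> 0"
    "\<And>x y. \<bar>x + y\<bar> powr p \<le> (1 + \<epsilon>) * \<bar>x\<bar> powr p + C * \<bar>y\<bar> powr p"
proof -
  have h1: "\<bar>c * x + c * y\<bar> powr p = c powr p * \<bar>x + y\<bar> powr p" if "c > 0" for c x y :: real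
    using abs_powr_homogeneous[OF that, of "x + y"] by (simp add: distrib_left)
  have "\<exists>C\<ge>0. \<forall>x y. \<bar>x + y\<bar> powr p - \<bar>x\<bar> powr p \<le> \<epsilon> * (\<bar>x\<bar> powr p + \<bar>y\<bar> powr p) + C * \<bar>y\<bar> powr p"
  proof (rule homogeneous_domination[where p = p and \<epsilon> = \<epsilon>
      and E = "\<lambda>x y. \<bar>x + y\<bar> powr p - \<bar>x\<bar> powr p" and F = "\<lambda>x y. \<bar>y\<bar> powr p"])
    show "continuous_on UNIV (\<lambda>z::real\<times>real. \<bar>fst z + snd z\<bar> powr p - \<bar>fst z\<bar> powr p)"
      "continuous_on UNIV (\<lambda>z::real\<times>real. \<bar>snd z\<bar> powr p)"
      using p by (auto intro!: continuous_intros continuous_on_powr')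
    show "\<bar>c * x + c * y\<bar> powr p - \<bar>c * x\<bar> powr p = c powr p * (\<bar>x + y\<bar> powr p - \<bar>x\<bar> powr p)"
      if "c > 0" for c x y :: real
      unfolding h1[OF that] abs_powr_homogeneous[OF that] by (simp add: algebra_simps)
  qed (use p \<epsilon> abs_powr_homogeneous in auto)
  then obtain C where C: "C \<ge> 0"
    "\<And>x y. \<bar>x + y\<bar> powr p - \<bar>x\<bar> powr p \<le> \<epsilon> * (\<bar>x\<bar> powr p + \<bar>y\<bar> powr p) + C * \<bar>y\<bar> powr p" by blast
  have "\<bar>x + y\<bar> powr p \<le> (1 + \<epsilon>) * \<bar>x\<bar> powr p + (C + \<epsilon>) * \<bar>y\<bar> powr p" for x y
    using C(2)[of x y] by (simp add: algebra_simps)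
  then show ?thesis using that[of "C + \<epsilon>"] C(1) \<epsilon> by simp
qed

text \<open>Young's inequality for the product of k|x| and |y|/k with k^p = \<eta>; the denominators
  p and s exceed 1 and are dropped.\<close>

lemma abs_mult_le_powr:
  fixes p s \<eta> :: real
  assumes p: "p > 1" and s: "s > 1" and ps: "1 / p + 1 / s = 1" and \<eta>: "\<eta> > 0"
  obtains C where "C \<ge> 0" "\<And>x y :: real. \<bar>x * y\<bar> \<le> \<eta> * \<bar>x\<bar> powr p + C * \<bar>y\<bar> powr s"
proof -
  define k where "k = \<eta> powr (1 / p)"
  have k: "k > 0" "k powr p = \<eta>" using \<eta> p by (auto simp: k_def powr_powr)
  have "\<bar>x * y\<bar> \<le> \<eta> * \<bar>x\<bar> powr p + (1 / k powr s) * \<bar>y\<bar> powr s" for x y :: real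
  proof -
    have "\<bar>x * y\<bar> = (k * \<bar>x\<bar>) * (\<bar>y\<bar> / k)" using k by (simp add: abs_mult)
    also have "\<dots> \<le> (k * \<bar>x\<bar>) powr p / p + (\<bar>y\<bar> / k) powr s / s"
      using k by (intro Youngs_inequality[OF p s ps]) auto
    also have "\<dots> \<le> (k * \<bar>x\<bar>) powr p / 1 + (\<bar>y\<bar> / k) powr s / 1"
      using p s by (intro add_mono divide_left_mono) auto
    also have "\<dots> = \<eta> * \<bar>x\<bar> powr p + (1 / k powr s) * \<bar>y\<bar> powr s"
      using k by (simp add: powr_mult powr_divide)
    finally show ?thesis .
  qed
  then show ?thesis using that[of "1 / k powr s"] by simp
qed

section \<open>Spaces of real functions with integrable powers\<close>

definition in_L :: "'a measure \<Rightarrow> real \<Rightarrow> ('a \<Rightarrow> real) \<Rightarrow> bool" where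
  "in_L M p f \<longleftrightarrow> f \<in> borel_measurable M \<and> integrable M (\<lambda>x. \<bar>f x\<bar> powr p)"

text \<open>The p-th power of the norm: without the root, pointwise inequalities stay additive under
  the integral.\<close>

definition Lpow :: "'a measure \<Rightarrow> real \<Rightarrow> ('a \<Rightarrow> real) \<Rightarrow> real" where
  "Lpow M p f = (LINT x|M. \<bar>f x\<bar> powr p)"

lemma in_L_measurable: "in_L M p f \<Longrightarrow> f \<in> borel_measurable M"
  and in_L_integrable: "in_L M p f \<Longrightarrow> integrable M (\<lambda>x. \<bar>f x\<bar> powr p)"
  by (auto simp: in_L_def)

lemma Lpow_nonneg [simp]: "0 \<le> Lpow M p f"
  by (simp add: Lpow_def)

lemma in_L_bound:
  assumes "f \<in> borel_measurable M" "integrable M g" "AE x in M. \<bar>f x\<bar> powr p \<le> g x"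
  shows "in_L M p f" "Lpow M p f \<le> (LINT x|M. g x)"
proof -
  have "integrable M (\<lambda>x. \<bar>f x\<bar> powr p)"
    using assms(3) by (intro Bochner_Integration.integrable_bound[OF assms(2)]) (use assms(1) in auto)
  then show "in_L M p f" "Lpow M p f \<le> (LINT x|M. g x)"
    using assms by (auto simp: in_L_def Lpow_def intro: integral_mono_AE)
qed

lemma in_L_cmult:
  assumes "in_L M p f"
  shows "in_L M p (\<lambda>x. c * f x)" "Lpow M p (\<lambda>x. c * f x) = \<bar>c\<bar> powr p * Lpow M p f"
  using assms by (auto simp: in_L_def Lpow_def abs_mult powr_mult)

lemma Lpow_minus_commute: "Lpow M p (\<lambda>x. f x - g x) = Lpow M p (\<lambda>x. g x - f x)"
  by (simp add: Lpow_def abs_minus_commute)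

lemma Lpow_cong_AE:
  assumes "AE x in M. f x = g x"
  shows "f \<in> borel_measurable M \<Longrightarrow> g \<in> borel_measurable M \<Longrightarrow> Lpow M p f = Lpow M p g"
  unfolding Lpow_def using assms by (intro integral_cong_AE) auto

lemma in_L_cong_AE:
  assumes "AE x in M. f x = g x" "g \<in> borel_measurable M" "in_L M p f"
  shows "in_L M p g"
proof -
  have "integrable M (\<lambda>x. \<bar>f x\<bar> powr p) \<longleftrightarrow> integrable M (\<lambda>x. \<bar>g x\<bar> powr p)"
    using assms by (intro integrable_cong_AE) (auto simp: in_L_def)
  then show ?thesis using assms by (simp add: in_L_def)
qed

section \<open>The quasi-triangle inequality and uniform convexity in \<open>L^p\<close>\<close>

lemma Lpow_add_le:
  fixes p \<epsilon> :: real
  assumes p: "p > 0" and \<epsilon>: "\<epsilon> > 0"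
  obtains C where "C \<ge> 0"
    "\<And>(M :: 'a measure) f g. in_L M p f \<Longrightarrow> in_L M p g \<Longrightarrow> in_L M p (\<lambda>x. f x + g x) \<and>
      Lpow M p (\<lambda>x. f x + g x) \<le> (1 + \<epsilon>) * Lpow M p f + C * Lpow M p g"
proof -
  \<comment> \<open>\<open>C\<close> comes from the pointwise inequality and is therefore fixed
    before the measure and the functions.\<close>
  obtain C where C: "C \<ge> 0"
    "\<And>x y. \<bar>x + y\<bar> powr p \<le> (1 + \<epsilon>) * \<bar>x\<bar> powr p + C * \<bar>y\<bar> powr p"
    using abs_powr_add_le[OF p \<epsilon>] by blast
  have "in_L M p (\<lambda>x. f x + g x) \<and>
      Lpow M p (\<lambda>x. f x + g x) \<le> (1 + \<epsilon>) * Lpow M p f + C * Lpow M p g"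
    if fg: "in_L M p f" "in_L M p g" for M :: "'a measure" and f g
  proof -
    let ?g = "\<lambda>x. (1 + \<epsilon>) * \<bar>f x\<bar> powr p + C * \<bar>g x\<bar> powr p"
    have i: "integrable M ?g" using fg by (auto simp: in_L_def)
    have "(LINT x|M. ?g x) = (1 + \<epsilon>) * Lpow M p f + C * Lpow M p g"
      unfolding Lpow_def using fg by (subst Bochner_Integration.integral_add) (auto simp: in_L_def)
    moreover have "(\<lambda>x. f x + g x) \<in> borel_measurable M" using fg by (auto simp: in_L_def)
    ultimately show ?thesis
      using in_L_bound[OF _ i, of "\<lambda>x. f x + g x" p] C(2) by auto
  qed
  then show ?thesis using that C(1) by blast
qed

lemma in_L_add: "p > 0 \<Longrightarrow> in_L M p f \<Longrightarrow> in_L M p g \<Longrightarrow> in_L M p (\<lambda>x. f x + g x)"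
  by (metis Lpow_add_le zero_less_one)

lemma in_L_diff: "p > 0 \<Longrightarrow> in_L M p f \<Longrightarrow> in_L M p g \<Longrightarrow> in_L M p (\<lambda>x. f x - g x)"
  using in_L_add[of p M f "\<lambda>x. - 1 * g x"] in_L_cmult(1)[of M p g "- 1"] by simp

lemma Lpow_triangle:
  fixes p \<epsilon> :: real
  assumes p: "p > 0" and \<epsilon>: "\<epsilon> > 0"
  obtains C where "C \<ge> 0"
    "\<And>(M :: 'a measure) f g h. in_L M p f \<Longrightarrow> in_L M p g \<Longrightarrow> in_L M p h \<Longrightarrow>
      Lpow M p (\<lambda>x. f x - h x) \<le> (1 + \<epsilon>) * Lpow M p (\<lambda>x. f x - g x) + C * Lpow M p (\<lambda>x. g x - h x)"
proof -
  obtain C where C: "C \<ge> 0"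
    "\<And>(M :: 'a measure) f g. in_L M p f \<Longrightarrow> in_L M p g \<Longrightarrow> in_L M p (\<lambda>x. f x + g x) \<and>
      Lpow M p (\<lambda>x. f x + g x) \<le> (1 + \<epsilon>) * Lpow M p f + C * Lpow M p g"
    using Lpow_add_le[OF p \<epsilon>, where ?'a = 'a] by metis
  show ?thesis
  proof
    fix M :: "'a measure" and f g h :: "'a \<Rightarrow> real"
    assume "in_L M p f" "in_L M p g" "in_L M p h"
    then show "Lpow M p (\<lambda>x. f x - h x)
      \<le> (1 + \<epsilon>) * Lpow M p (\<lambda>x. f x - g x) + C * Lpow M p (\<lambda>x. g x - h x)"
      using C(2)[OF in_L_diff[OF p, of M f g] in_L_diff[OF p, of M g h]] by simp
  qed (rule C)
qed

lemma Lpow_midpoint_le: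
  assumes p: "p > 1" and f: "in_L M p f" and g: "in_L M p g"
  shows "in_L M p (\<lambda>x. (f x + g x) / 2)" "Lpow M p (\<lambda>x. (f x + g x) / 2) \<le> (Lpow M p f + Lpow M p g) / 2"
proof -
  let ?g = "\<lambda>x. (\<bar>f x\<bar> powr p + \<bar>g x\<bar> powr p) / 2"
  have i: "integrable M ?g" using f g by (auto simp: in_L_def)
  have "(LINT x|M. ?g x) = (Lpow M p f + Lpow M p g) / 2"
    unfolding Lpow_def using f g by (auto simp: in_L_def)
  moreover have "(\<lambda>x. (f x + g x) / 2) \<in> borel_measurable M" using f g by (auto simp: in_L_def)
  ultimately show "in_L M p (\<lambda>x. (f x + g x) / 2)"
    "Lpow M p (\<lambda>x. (f x + g x) / 2) \<le> (Lpow M p f + Lpow M p g) / 2"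
    using in_L_bound[OF _ i, of "\<lambda>x. (f x + g x) / 2" p] abs_powr_midpoint_le[OF p] by auto
qed

lemma Lpow_uniformly_convex:
  fixes p \<epsilon> :: real
  assumes p: "p > 1" and \<epsilon>: "\<epsilon> > 0"
  obtains C where "C \<ge> 0"
    "\<And>(M :: 'a measure) f g. in_L M p f \<Longrightarrow> in_L M p g \<Longrightarrow>
      Lpow M p (\<lambda>x. f x - g x) \<le> \<epsilon> * (Lpow M p f + Lpow M p g)
        + C * ((Lpow M p f + Lpow M p g) / 2 - Lpow M p (\<lambda>x. (f x + g x) / 2))"
proof -
  obtain C where C: "C \<ge> 0" "\<And>x y. \<bar>x - y\<bar> powr p \<le> \<epsilon> * (\<bar>x\<bar> powr p + \<bar>y\<bar> powr p)
    + C * ((\<bar>x\<bar> powr p + \<bar>y\<bar> powr p) / 2 - \<bar>(x + y) / 2\<bar> powr p)"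
    using abs_powr_uniformly_convex[OF p \<epsilon>] by blast
  show ?thesis
  proof
    fix M :: "'a measure" and f g
    assume f: "in_L M p f" and g: "in_L M p g"
    let ?g = "\<lambda>x. \<epsilon> * (\<bar>f x\<bar> powr p + \<bar>g x\<bar> powr p)
      + C * ((\<bar>f x\<bar> powr p + \<bar>g x\<bar> powr p) / 2 - \<bar>(f x + g x) / 2\<bar> powr p)"
    have fi: "integrable M (\<lambda>x. \<bar>f x\<bar> powr p)" "integrable M (\<lambda>x. \<bar>g x\<bar> powr p)"
      "integrable M (\<lambda>x. \<bar>(f x + g x) / 2\<bar> powr p)"
      using f g Lpow_midpoint_le(1)[OF p f g] by (auto simp: in_L_def)
    have m: "(\<lambda>x. f x - g x) \<in> borel_measurable M" using f g by (auto simp: in_L_def)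
    have i: "integrable M ?g"
      by (intro Bochner_Integration.integrable_add integrable_mult_right
          Bochner_Integration.integrable_diff integrable_divide_zero fi)
    have "(LINT x|M. ?g x) = \<epsilon> * (Lpow M p f + Lpow M p g)
        + C * ((Lpow M p f + Lpow M p g) / 2 - Lpow M p (\<lambda>x. (f x + g x) / 2))"
      unfolding Lpow_def using fi
      by (simp add: Bochner_Integration.integral_add Bochner_Integration.integral_diff
          Bochner_Integration.integrable_add Bochner_Integration.integrable_diff
          integrable_divide_zero integrable_mult_right del: abs_divide abs_add_abs)
    then show "Lpow M p (\<lambda>x. f x - g x) \<le> \<epsilon> * (Lpow M p f + Lpow M p g)
        + C * ((Lpow M p f + Lpow M p g) / 2 - Lpow M p (\<lambda>x. (f x + g x) / 2))"
      using in_L_bound(2)[OF m i, of p] C(2) by simp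
  qed (rule C)
qed

section \<open>Fatou, Riesz-Fischer and nearest points of nested convex sets\<close>

lemma Lpow_Fatou:
  assumes f: "\<And>k. in_L M p (f k)" "\<And>k. Lpow M p (f k) \<le> B"
    and g: "g \<in> borel_measurable M" and lim: "AE x in M. (\<lambda>k. f k x) \<longlonglongrightarrow> g x" and p: "p > 0"
  shows "in_L M p g" "Lpow M p g \<le> B"
proof -
  have B: "B \<ge> 0" using f(2)[of 0] Lpow_nonneg order_trans by blast
  have fk: "(\<integral>\<^sup>+x. ennreal (\<bar>f k x\<bar> powr p) \<partial>M) \<le> ennreal B" for k
    using f(1)[of k] f(2)[of k] unfolding in_L_def Lpow_def
    by (subst nn_integral_eq_integral) (auto intro: ennreal_leI)
  have "(\<integral>\<^sup>+x. ennreal (\<bar>g x\<bar> powr p) \<partial>M) = (\<integral>\<^sup>+x. liminf (\<lambda>k. ennreal (\<bar>f k x\<bar> powr p)) \<partial>M)"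
  proof (rule nn_integral_cong_AE)
    show "AE x in M. ennreal (\<bar>g x\<bar> powr p) = liminf (\<lambda>k. ennreal (\<bar>f k x\<bar> powr p))"
      using lim
    proof eventually_elim
      case (elim x)
      then have "(\<lambda>k. \<bar>f k x\<bar> powr p) \<longlonglongrightarrow> \<bar>g x\<bar> powr p"
        using p by (intro tendsto_powr' tendsto_intros) auto
      then have "(\<lambda>k. ennreal (\<bar>f k x\<bar> powr p)) \<longlonglongrightarrow> ennreal (\<bar>g x\<bar> powr p)"
        by (intro tendsto_ennrealI)
      then show ?case using lim_imp_Liminf[OF trivial_limit_sequentially] by metis
    qed
  qed
  also have "\<dots> \<le> liminf (\<lambda>k. \<integral>\<^sup>+x. ennreal (\<bar>f k x\<bar> powr p) \<partial>M)"
    using f(1) by (intro nn_integral_liminf) (auto simp: in_L_def)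
  also have "\<dots> \<le> ennreal B"
    using fk by (intro Liminf_le) auto
  finally have *: "(\<integral>\<^sup>+x. ennreal (\<bar>g x\<bar> powr p) \<partial>M) \<le> ennreal B" .
  then have i: "integrable M (\<lambda>x. \<bar>g x\<bar> powr p)"
    using g by (intro integrableI_bounded) (auto simp: top_unique intro: le_less_trans)
  then show "in_L M p g" using g by (simp add: in_L_def)
  show "Lpow M p g \<le> B"
    using * B i unfolding Lpow_def by (subst (asm) nn_integral_eq_integral) auto
qed

text \<open>Riesz--Fischer, with the almost everywhere convergent subsequence produced by the proof:
  along it \<open>\<bar>f (r (Suc j)) - f (r j)\<bar> \<le> 2 powr - j\<close> for all large \<open>j\<close>.\<close>

lemma Lpow_complete:
  fixes f :: "nat \<Rightarrow> 'a \<Rightarrow> real"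
  assumes f: "\<And>k. in_L M p (f k)" and p: "p > 0"
    and Cauchy: "\<And>e. e > 0 \<Longrightarrow> \<exists>N. \<forall>m\<ge>N. \<forall>n\<ge>N. Lpow M p (\<lambda>x. f m x - f n x) < e"
  obtains g r where "in_L M p g" "(\<lambda>k. Lpow M p (\<lambda>x. f k x - g x)) \<longlonglongrightarrow> 0"
    "strict_mono (r :: nat \<Rightarrow> nat)" "AE x in M. (\<lambda>k. f (r k) x) \<longlonglongrightarrow> g x"
proof -
  \<comment> \<open>Chosen so that \<open>(2 ^ k) powr p * w k = (1/2) ^ k\<close>: the rescaled
    differences \<open>2 ^ k * D k\<close> then have summable p-th power integrals.\<close>
  define w where "w k = (1/2) ^ k * ((1/2) ^ k) powr p" for k :: nat
  have w: "w k > 0" for k by (simp add: w_def)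
  define N where "N k = (SOME n. \<forall>i\<ge>n. \<forall>j\<ge>n. Lpow M p (\<lambda>x. f i x - f j x) < w k)" for k
  have N: "Lpow M p (\<lambda>x. f i x - f j x) < w k" if "i \<ge> N k" "j \<ge> N k" for i j k
    using someI_ex[OF Cauchy[OF w[of k]], folded N_def] that by blast
  define r where "r k = k + (\<Sum>i\<le>k. N i)" for k
  have r: "strict_mono r" unfolding r_def by (intro strict_monoI_Suc) simp
  have rN: "r k \<ge> N k" for k
    unfolding r_def using member_le_sum[of k "{..k}" N] by simp
  define D where "D k = (\<lambda>x. f (r (Suc k)) x - f (r k) x)" for k
  have Dm[measurable]: "D k \<in> borel_measurable M" for k
    unfolding D_def using f by (intro borel_measurable_diff) (auto simp: in_L_def)
  have Dp: "Lpow M p (D k) < w k" for k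
    unfolding D_def using N[of k "r (Suc k)" "r k"] rN[of k] strict_monoD[OF r, of k "Suc k"] by simp
  have Di: "in_L M p (D k)" for k unfolding D_def using f p by (intro in_L_diff)
  have "(\<integral>\<^sup>+x. (\<Sum>k. ennreal (\<bar>2 ^ k * D k x\<bar> powr p)) \<partial>M) = (\<Sum>k. \<integral>\<^sup>+x. ennreal (\<bar>2 ^ k * D k x\<bar> powr p) \<partial>M)"
    by (intro nn_integral_suminf) auto
  also have "\<dots> \<le> (\<Sum>k. ennreal ((1/2) ^ k))"
  proof (intro suminf_le)
    fix k
    have "(\<integral>\<^sup>+x. ennreal (\<bar>2 ^ k * D k x\<bar> powr p) \<partial>M) = ennreal (Lpow M p (\<lambda>x. 2 ^ k * D k x))"
      unfolding Lpow_def using in_L_cmult(1)[OF Di[of k], of "2 ^ k"]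
      by (intro nn_integral_eq_integral) (auto simp: in_L_def)
    also have "\<dots> = ennreal ((2 ^ k) powr p * Lpow M p (D k))"
      using in_L_cmult(2)[OF Di[of k], of "2 ^ k"] by simp
    also have "\<dots> \<le> ennreal ((2 ^ k) powr p * w k)"
      using Dp[of k] by (intro ennreal_leI mult_left_mono) auto
    also have "(2 ^ k) powr p * w k = (1/2) ^ k"
      by (simp add: w_def powr_divide power_one_over)
    finally show "(\<integral>\<^sup>+x. ennreal (\<bar>2 ^ k * D k x\<bar> powr p) \<partial>M) \<le> ennreal ((1/2) ^ k)" .
  qed auto
  also have "\<dots> = ennreal (\<Sum>k. (1/2) ^ k)"
    by (intro suminf_ennreal2) (auto intro!: summable_geometric)
  finally have fin: "(\<integral>\<^sup>+x. (\<Sum>k. ennreal (\<bar>2 ^ k * D k x\<bar> powr p)) \<partial>M) < \<infinity>"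
    by (auto intro: le_less_trans)
  \<comment> \<open>A finite integral of the series makes it finite almost everywhere; its terms
    then tend to 0, so eventually \<open>\<bar>D k x\<bar> \<le> (1/2) ^ k\<close>.\<close>
  have "AE x in M. (\<Sum>k. ennreal (\<bar>2 ^ k * D k x\<bar> powr p)) \<noteq> \<infinity>"
    using fin by (intro nn_integral_PInf_AE) auto
  then have conv: "AE x in M. convergent (\<lambda>k. f (r k) x)"
  proof eventually_elim
    case (elim x)
    then have "summable (\<lambda>k. \<bar>2 ^ k * D k x\<bar> powr p)"
      by (intro summable_suminf_not_top) auto
    then have "(\<lambda>k. \<bar>2 ^ k * D k x\<bar> powr p) \<longlonglongrightarrow> 0" by (rule summable_LIMSEQ_zero)
    then have "eventually (\<lambda>k. \<bar>2 ^ k * D k x\<bar> powr p < 1) sequentially"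
      by (rule order_tendstoD) simp
    then have "eventually (\<lambda>k. norm (D k x) \<le> (1/2) ^ k) sequentially"
    proof eventually_elim
      case (elim k)
      have "\<bar>2 ^ k * D k x\<bar> \<le> 1"
      proof (rule ccontr)
        assume "\<not> ?thesis"
        then have "\<bar>2 ^ k * D k x\<bar> powr p > 1" using gr_one_powr[of "\<bar>2 ^ k * D k x\<bar>" p] p by linarith
        then show False using elim by simp
      qed
      then show ?case by (simp add: abs_mult power_one_over field_simps)
    qed
    then have "summable (\<lambda>k. D k x)"
      by (rule summable_comparison_test_ev) (simp add: summable_geometric)
    then have "convergent (\<lambda>n. \<Sum>k<n. D k x)" by (simp add: summable_iff_convergent)
    moreover have "(\<Sum>k<n. D k x) = f (r n) x - f (r 0) x" for n
      unfolding D_def by (rule sum_lessThan_telescope)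
    ultimately have "convergent (\<lambda>n. (f (r n) x - f (r 0) x) + f (r 0) x)"
      by (intro convergent_add convergent_const) simp
    then show ?case by simp
  qed
  define g where "g x = lim (\<lambda>k. f (r k) x)" for x
  have fm[measurable]: "f k \<in> borel_measurable M" for k using f by (simp add: in_L_def)
  have g[measurable]: "g \<in> borel_measurable M" unfolding g_def by measurable
  have lim: "AE x in M. (\<lambda>k. f (r k) x) \<longlonglongrightarrow> g x"
    using conv unfolding g_def by (auto simp: convergent_LIMSEQ_iff)
  \<comment> \<open>Fatou's lemma along the subsequence transfers the Cauchy estimate from
    \<open>f m - f n\<close> to \<open>f m - g\<close>, now for the whole sequence.\<close>
  have close: "in_L M p (\<lambda>x. f m x - g x) \<and> Lpow M p (\<lambda>x. f m x - g x) \<le> e"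
    if "\<forall>i\<ge>n. \<forall>j\<ge>n. Lpow M p (\<lambda>x. f i x - f j x) < e" "m \<ge> n" for m n e
  proof -
    have "r (k + n) \<ge> n" for k using seq_suble[OF r, of "k + n"] by simp
    then have "Lpow M p (\<lambda>x. f m x - f (r (k + n)) x) \<le> e" for k
      using that less_imp_le by blast
    moreover have "AE x in M. (\<lambda>k. f m x - f (r (k + n)) x) \<longlonglongrightarrow> f m x - g x"
      using lim by eventually_elim (intro tendsto_intros LIMSEQ_ignore_initial_segment)
    ultimately show ?thesis
      using Lpow_Fatou[of M p "\<lambda>k x. f m x - f (r (k + n)) x" e "\<lambda>x. f m x - g x"] p
        in_L_diff[OF p f f] by auto
  qed
  have "(\<lambda>k. Lpow M p (\<lambda>x. f k x - g x)) \<longlonglongrightarrow> 0"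
  proof (rule LIMSEQ_I)
    fix e :: real assume e: "e > 0"
    obtain n where "\<forall>i\<ge>n. \<forall>j\<ge>n. Lpow M p (\<lambda>x. f i x - f j x) < e / 2"
      using Cauchy[of "e / 2"] e by auto
    then show "\<exists>n. \<forall>k\<ge>n. norm (Lpow M p (\<lambda>x. f k x - g x) - 0) < e"
      using close e by (intro exI[of _ n]) fastforce
  qed
  moreover have "in_L M p g"
  proof -
    obtain n where n: "\<forall>i\<ge>n. \<forall>j\<ge>n. Lpow M p (\<lambda>x. f i x - f j x) < 1"
      using Cauchy[of 1] by auto
    have "in_L M p (\<lambda>x. f n x - (f n x - g x))"
      by (rule in_L_diff[OF p f[of n] conjunct1[OF close[OF n order_refl]]])
    then show ?thesis by simp
  qed
  ultimately show ?thesis using that r lim by blast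
qed

text \<open>The limit is the point nearest to \<open>c\<close> of the intersection of the closed sets \<open>H m\<close>
  (the weak cluster point of the sequence, when \<open>H m\<close> is the hull of a tail); the last conclusion is
  the Radon--Riesz property.\<close>

lemma midpoint_closed_limit:
  fixes H :: "nat \<Rightarrow> ('a \<Rightarrow> real) set"
  assumes p: "p > 1"
    and dec: "\<And>m. H (Suc m) \<subseteq> H m" and ne: "\<And>m. H m \<noteq> {}"
    and H: "\<And>m f. f \<in> H m \<Longrightarrow> in_L M p f"
    and mid: "\<And>m f g. f \<in> H m \<Longrightarrow> g \<in> H m \<Longrightarrow> (\<lambda>x. (f x + g x) / 2) \<in> H m"
    and c: "in_L M p c" and bdd: "\<And>f. f \<in> H 0 \<Longrightarrow> Lpow M p (\<lambda>x. f x - c x) \<le> R"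
  obtains a b r where "in_L M p a" "\<And>m. b m \<in> H m"
    "(\<lambda>m. Lpow M p (\<lambda>x. b m x - a x)) \<longlonglongrightarrow> 0"
    "strict_mono (r :: nat \<Rightarrow> nat)" "AE x in M. (\<lambda>k. b (r k) x) \<longlonglongrightarrow> a x"
    "\<And>g C. (\<And>k. g k \<in> H k) \<Longrightarrow> eventually (\<lambda>k. Lpow M p (\<lambda>x. g k x - c x) \<le> C) sequentially
       \<Longrightarrow> Lpow M p (\<lambda>x. a x - c x) \<le> C"
    "\<And>g. (\<And>k. g k \<in> H k) \<Longrightarrow>
       (\<And>e. e > 0 \<Longrightarrow> eventually (\<lambda>k. Lpow M p (\<lambda>x. g k x - c x) \<le> Lpow M p (\<lambda>x. a x - c x) + e) sequentially)
       \<Longrightarrow> (\<lambda>k. Lpow M p (\<lambda>x. g k x - a x)) \<longlonglongrightarrow> 0"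
proof -
  define L where "L f = Lpow M p (\<lambda>x. f x - c x)" for f
  have p0: "p > 0" using p by simp
  have Hmono: "H n \<subseteq> H m" if "m \<le> n" for m n
    using lift_Suc_antimono_le[of H, OF dec that] .
  have LR: "L f \<le> R" if "f \<in> H m" for f m
    using bdd[of f] Hmono[of 0 m] that unfolding L_def by auto
  have L0: "L f \<ge> 0" for f unfolding L_def by simp
  \<comment> \<open>As the \<open>H m\<close> shrink, their distances to \<open>c\<close> increase,
    and \<open>R\<close> bounds them; the limit \<open>d'\<close> replaces a minimum that no
    \<open>H m\<close> need attain.\<close>
  define d where "d m = (INF f\<in>H m. L f)" for m
  have bddb: "bdd_below (L ` H m)" for m using L0 by (intro bdd_belowI[of _ 0]) auto
  have d_le: "d m \<le> L f" if "f \<in> H m" for f m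
    unfolding d_def using that bddb by (intro cINF_lower) auto
  have "incseq d"
    unfolding d_def using ne bddb dec by (intro incseq_SucI cINF_superset_mono) auto
  moreover have "d m \<le> R" for m
    using ne[of m] d_le[of _ m] LR[of _ m] by (meson all_not_in_conv order_trans)
  ultimately obtain d' where d': "d \<longlonglongrightarrow> d'" "\<And>m. d m \<le> d'"
    using incseq_convergent[of d R] by blast
  have d0: "d' \<ge> 0"
  proof -
    have "d 0 \<ge> 0" unfolding d_def using ne L0 by (intro cINF_greatest) auto
    then show ?thesis using d'(2)[of 0] by simp
  qed
  have "\<exists>f\<in>H m. L f < d m + 1 / (real m + 1)" for m
  proof -
    have "(INF f\<in>H m. L f) < d m + 1 / (real m + 1)" by (simp add: d_def)
    then show ?thesis using ne[of m] bddb[of m] by (simp add: cINF_less_iff)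
  qed
  then obtain b where b: "\<And>m. b m \<in> H m" "\<And>m. L (b m) < d m + 1 / (real m + 1)"
    by metis
  have inv: "eventually (\<lambda>m. 1 / (real m + 1) < e) sequentially" if "e > 0" for e
  proof -
    have "(\<lambda>m. 1 / (real m + 1)) \<longlonglongrightarrow> 0"
      using LIMSEQ_inverse_real_of_nat by (simp add: inverse_eq_divide add.commute)
    then show ?thesis using that by (rule order_tendstoD)
  qed
  \<comment> \<open>Two near-minimisers in the same \<open>H m\<close> have their midpoint in
    \<open>H m\<close>, at distance at least \<open>d m\<close>, which is almost \<open>d'\<close>.
    Their convexity defect is thus at most \<open>2 * \<eta>\<close>, and uniform convexity brings
    them together. The near-minimisers are arbitrary, so this yields both the Cauchy property of
    \<open>b\<close> and the Radon-Riesz conclusion.\<close>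
  have close: "\<exists>\<eta>>0. \<exists>N. \<forall>m\<ge>N. \<forall>f\<in>H m. \<forall>g\<in>H m. L f \<le> d' + \<eta> \<longrightarrow> L g \<le> d' + \<eta> \<longrightarrow> Lpow M p (\<lambda>x. f x - g x) < e"
    if e: "e > 0" for e
  proof -
    \<comment> \<open>Since \<open>L f + L g \<le> 2 * (d' + 1)\<close>, this choice makes the first
      term at most \<open>e / 2\<close>. The number \<open>\<eta>\<close> below keeps the second one
      under \<open>e / 2\<close>; its cap at 1 justifies the bound on
      \<open>L f + L g\<close>.\<close>
    define \<epsilon> where "\<epsilon> = e / (4 * (d' + 1))"
    have \<epsilon>: "\<epsilon> > 0" using e d0 by (simp add: \<epsilon>_def)
    obtain C where C: "C \<ge> 0" "\<And>(M :: 'a measure) f g. in_L M p f \<Longrightarrow> in_L M p g \<Longrightarrow>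
      Lpow M p (\<lambda>x. f x - g x) \<le> \<epsilon> * (Lpow M p f + Lpow M p g)
        + C * ((Lpow M p f + Lpow M p g) / 2 - Lpow M p (\<lambda>x. (f x + g x) / 2))"
      by (rule Lpow_uniformly_convex[OF p \<epsilon>, where ?'a = 'a]) blast
    define \<eta> where "\<eta> = min 1 (e / (8 * (C + 1)))"
    have \<eta>: "\<eta> > 0" using e C(1) by (simp add: \<eta>_def)
    obtain N where N: "\<And>m. m \<ge> N \<Longrightarrow> d m > d' - \<eta>"
      using order_tendstoD(1)[OF d'(1), of "d' - \<eta>"] \<eta> by (auto simp: eventually_sequentially)
    have "Lpow M p (\<lambda>x. f x - g x) < e"
      if m: "m \<ge> N" and f: "f \<in> H m" "L f \<le> d' + \<eta>" and g: "g \<in> H m" "L g \<le> d' + \<eta>" for m f g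
    proof -
      have "(\<lambda>x. ((f x - c x) + (g x - c x)) / 2) = (\<lambda>x. (f x + g x) / 2 - c x)"
        by (auto simp: field_simps)
      then have "Lpow M p (\<lambda>x. ((f x - c x) + (g x - c x)) / 2) = L (\<lambda>x. (f x + g x) / 2)"
        by (simp add: L_def)
      also have "\<dots> \<ge> d m" using d_le[OF mid[OF f(1) g(1)]] .
      finally have mid_ge: "Lpow M p (\<lambda>x. ((f x - c x) + (g x - c x)) / 2) \<ge> d' - \<eta>" using N[OF m] by simp
      have "Lpow M p (\<lambda>x. (f x - c x) - (g x - c x)) \<le> \<epsilon> * (L f + L g)
        + C * ((L f + L g) / 2 - Lpow M p (\<lambda>x. ((f x - c x) + (g x - c x)) / 2))"
        using C(2)[OF in_L_diff[OF p0 H[OF f(1)] c] in_L_diff[OF p0 H[OF g(1)] c]] unfolding L_def .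
      also have "\<dots> \<le> \<epsilon> * (2 * (d' + 1)) + C * (2 * \<eta>)"
      proof (intro add_mono mult_left_mono)
        have "\<eta> \<le> 1" by (simp add: \<eta>_def)
        then show "L f + L g \<le> 2 * (d' + 1)" using f(2) g(2) by argo
        show "(L f + L g) / 2 - Lpow M p (\<lambda>x. ((f x - c x) + (g x - c x)) / 2) \<le> 2 * \<eta>"
          using f g mid_ge by argo
      qed (use \<epsilon> C in auto)
      also have "\<epsilon> * (2 * (d' + 1)) = e / 2" using d0 by (simp add: \<epsilon>_def field_simps)
      also have "C * (2 * \<eta>) < e / 2"
      proof -
        have "C * (2 * \<eta>) \<le> C * (2 * (e / (8 * (C + 1))))"
          using C(1) by (intro mult_left_mono) (auto simp: \<eta>_def)
        also have "\<dots> = e / 4 * (C / (C + 1))" using C(1) by (simp add: divide_simps algebra_simps)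
        also have "\<dots> \<le> e / 4 * 1" using C(1) e by (intro mult_left_mono) auto
        finally show ?thesis using e by simp
      qed
      finally show ?thesis by simp
    qed
    then show ?thesis using \<eta> by blast
  qed
  have bN: "eventually (\<lambda>m. L (b m) \<le> d' + e) sequentially" if "e > 0" for e
    using inv[OF that]
  proof eventually_elim
    case (elim m)
    then show ?case using b(2)[of m] d'(2)[of m] by linarith
  qed
  have "\<exists>N. \<forall>m\<ge>N. \<forall>n\<ge>N. Lpow M p (\<lambda>x. b m x - b n x) < e" if e: "e > 0" for e
  proof -
    obtain \<eta> N where \<eta>: "\<eta> > 0" and N: "\<forall>m\<ge>N. \<forall>f\<in>H m. \<forall>g\<in>H m. L f \<le> d' + \<eta> \<longrightarrow> L g \<le> d' + \<eta> \<longrightarrow> Lpow M p (\<lambda>x. f x - g x) < e"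
      using close[OF e] by blast
    obtain N' where N': "\<And>m. m \<ge> N' \<Longrightarrow> L (b m) \<le> d' + \<eta>"
      using bN[OF \<eta>] by (auto simp: eventually_sequentially)
    have "Lpow M p (\<lambda>x. b m x - b n x) < e" if mn: "m \<ge> max N N'" "n \<ge> max N N'" for m n
    proof -
      have "b m \<in> H N" "b n \<in> H N" using b(1) Hmono[of N m] Hmono[of N n] mn by auto
      then show ?thesis using N[rule_format, of N "b m" "b n"] N' mn by auto
    qed
    then show ?thesis by blast
  qed
  then obtain a r where a: "in_L M p a" "(\<lambda>k. Lpow M p (\<lambda>x. b k x - a x)) \<longlonglongrightarrow> 0"
    and r: "strict_mono (r :: nat \<Rightarrow> nat)" "AE x in M. (\<lambda>k. b (r k) x) \<longlonglongrightarrow> a x"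
    by (rule Lpow_complete[where f = b and M = M and p = p, OF H[OF b(1)] p0])
  \<comment> \<open>The inequality carries a factor 1 + \<epsilon>, so \<open>L a \<le> d'\<close>
    is reached by letting \<epsilon> tend to 0 afterwards.\<close>
  have La': "L a \<le> (1 + \<epsilon>) * d'" if \<epsilon>: "\<epsilon> > 0" for \<epsilon>
  proof -
    obtain C where C: "C \<ge> 0" "\<And>(M :: 'a measure) f g. in_L M p f \<Longrightarrow> in_L M p g \<Longrightarrow> in_L M p (\<lambda>x. f x + g x) \<and>
      Lpow M p (\<lambda>x. f x + g x) \<le> (1 + \<epsilon>) * Lpow M p f + C * Lpow M p g"
      by (rule Lpow_add_le[OF p0 \<epsilon>, where ?'a = 'a]) blast
    have "L a \<le> (1 + \<epsilon>) * (d' + 1 / (real m + 1)) + C * Lpow M p (\<lambda>x. b m x - a x)" for m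
    proof -
      have "L a \<le> (1 + \<epsilon>) * L (b m) + C * Lpow M p (\<lambda>x. a x - b m x)"
        using C(2)[OF in_L_diff[OF p0 H[OF b(1)] c] in_L_diff[OF p0 a(1) H[OF b(1)]], of m m]
        unfolding L_def by (simp add: algebra_simps)
      also have "\<dots> \<le> (1 + \<epsilon>) * (d' + 1 / (real m + 1)) + C * Lpow M p (\<lambda>x. a x - b m x)"
        using \<epsilon> C(1) b(2)[of m] d'(2)[of m] by (intro add_mono mult_left_mono) auto
      finally show ?thesis by (simp add: Lpow_minus_commute)
    qed
    moreover have "(\<lambda>m. (1 + \<epsilon>) * (d' + 1 / (real m + 1)) + C * Lpow M p (\<lambda>x. b m x - a x))
      \<longlonglongrightarrow> (1 + \<epsilon>) * (d' + 0) + C * 0"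
      using LIMSEQ_inverse_real_of_nat
      by (intro tendsto_add tendsto_mult tendsto_const a(2)) (simp add: inverse_eq_divide add.commute)
    ultimately show ?thesis by (intro LIMSEQ_le_const) auto
  qed
  have La: "L a \<le> d'"
  proof (rule field_le_epsilon)
    fix e :: real assume "e > 0"
    then have "L a \<le> (1 + e / (d' + 1)) * d'" using La' d0 by simp
    also have "\<dots> = d' + e * (d' / (d' + 1))" by (simp add: algebra_simps)
    also have "\<dots> \<le> d' + e * 1" using d0 \<open>e > 0\<close> by (intro add_left_mono mult_left_mono) auto
    finally show "L a \<le> d' + e" by simp
  qed
  \<comment> \<open>Since \<open>L a \<le> d'\<close>, the hypothesis makes \<open>g\<close>
    eventually a near-minimiser, hence close to \<open>b\<close>, which converges to
    \<open>a\<close>.\<close>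
  have RR: "(\<lambda>k. Lpow M p (\<lambda>x. g k x - a x)) \<longlonglongrightarrow> 0"
    if g: "\<And>k. g k \<in> H k"
      "\<And>e. e > 0 \<Longrightarrow> eventually (\<lambda>k. Lpow M p (\<lambda>x. g k x - c x) \<le> Lpow M p (\<lambda>x. a x - c x) + e) sequentially" for g
  proof -
    have gb: "(\<lambda>k. Lpow M p (\<lambda>x. g k x - b k x)) \<longlonglongrightarrow> 0"
    proof (rule LIMSEQ_I)
      fix e :: real assume e: "e > 0"
      obtain \<eta> N where \<eta>: "\<eta> > 0" and N: "\<forall>m\<ge>N. \<forall>f\<in>H m. \<forall>g\<in>H m. L f \<le> d' + \<eta> \<longrightarrow> L g \<le> d' + \<eta> \<longrightarrow> Lpow M p (\<lambda>x. f x - g x) < e"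
        using close[OF e] by blast
      have "eventually (\<lambda>k. Lpow M p (\<lambda>x. g k x - b k x) < e) sequentially"
        using bN[OF \<eta>] g(2)[OF \<eta>] eventually_ge_at_top[of N]
      proof eventually_elim
        case (elim k)
        then show ?case using N g(1)[of k] b(1)[of k] La unfolding L_def by auto
      qed
      then show "\<exists>n. \<forall>k\<ge>n. norm (Lpow M p (\<lambda>x. g k x - b k x) - 0) < e"
        by (simp add: eventually_sequentially)
    qed
    obtain C where C: "C \<ge> 0" "\<And>(M :: 'a measure) f g h. in_L M p f \<Longrightarrow> in_L M p g \<Longrightarrow> in_L M p h \<Longrightarrow>
      Lpow M p (\<lambda>x. f x - h x) \<le> (1 + 1) * Lpow M p (\<lambda>x. f x - g x) + C * Lpow M p (\<lambda>x. g x - h x)"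
      by (rule Lpow_triangle[OF p0 zero_less_one, where ?'a = 'a]) blast
    have lim: "(\<lambda>k. (1 + 1) * Lpow M p (\<lambda>x. g k x - b k x) + C * Lpow M p (\<lambda>x. b k x - a x)) \<longlonglongrightarrow> (1 + 1) * 0 + C * 0"
      by (intro tendsto_add tendsto_mult tendsto_const gb a(2))
    have le: "Lpow M p (\<lambda>x. g k x - a x)
        \<le> (1 + 1) * Lpow M p (\<lambda>x. g k x - b k x) + C * Lpow M p (\<lambda>x. b k x - a x)" for k
      using C(2)[OF H[OF g(1)] H[OF b(1)] a(1)] .
    show ?thesis
      by (rule real_tendsto_sandwich[OF _ _ tendsto_const]) (use le lim in auto)
  qed
  have lsc: "Lpow M p (\<lambda>x. a x - c x) \<le> C"
    if g: "\<And>k. g k \<in> H k" and le: "eventually (\<lambda>k. Lpow M p (\<lambda>x. g k x - c x) \<le> C) sequentially" for g C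
  proof -
    have "eventually (\<lambda>k. d k \<le> C) sequentially"
      using le by eventually_elim (use d_le[OF g] in \<open>auto simp: L_def intro: order_trans\<close>)
    then have "d' \<le> C" by (rule tendsto_upperbound[OF d'(1)]) simp
    then show ?thesis using La by (simp add: L_def)
  qed
  show ?thesis by (rule that[OF a(1) b(1) a(2) r lsc RR])
qed

section \<open>Smooth functions\<close>

lemma grad_eq: "GDERIV f x :> D \<Longrightarrow> grad f x = D"
  unfolding grad_def
proof (rule the_equality)
  fix D' assume D: "GDERIV f x :> D" and D': "GDERIV f x :> D'"
  have "(\<lambda>h. inner h D') = (\<lambda>h. inner h D)"
    using D D' unfolding gderiv_def by (rule has_derivative_unique[rotated])
  then show "D' = D" by (metis vector_eq_ldot)
qed

lemma C_k_SucI: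
  assumes "\<And>x. GDERIV f x :> D x" "\<And>i. C_k k (\<lambda>x. D x $ i)"
  shows "C_k (Suc k) f"
proof -
  have "grad f x = D x" for x using assms(1) by (rule grad_eq)
  then show ?thesis using assms by auto
qed

lemma C_k_gderiv: "C_k (Suc k) f \<Longrightarrow> GDERIV f x :> grad f x"
  using grad_eq by (metis C_k.simps(2))

lemma C_k_grad: "C_k (Suc k) f \<Longrightarrow> C_k k (\<lambda>x. grad f x $ i)"
  by simp

lemma C_k_Suc_imp: "C_k (Suc k) f \<Longrightarrow> C_k k f"
proof (induction k arbitrary: f)
  case 0
  then have "GDERIV f x :> grad f x" for x by (rule C_k_gderiv)
  then have "isCont f x" for x unfolding gderiv_def by (rule has_derivative_continuous)
  then show ?case by (simp add: continuous_at_imp_continuous_on)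
next
  case (Suc k)
  then show ?case using C_k.simps(2) by blast
qed

lemma C_k_const: "C_k k (\<lambda>x. c)"
proof (induction k arbitrary: c)
  case (Suc k)
  show ?case by (rule C_k_SucI[OF GDERIV_const]) (simp add: Suc)
qed simp

lemma C_k_add: "C_k k f \<Longrightarrow> C_k k g \<Longrightarrow> C_k k (\<lambda>x. f x + g x)"
proof (induction k arbitrary: f g)
  case 0
  then show ?case by (auto intro: continuous_intros)
next
  case (Suc k)
  show ?case
    by (rule C_k_SucI[OF GDERIV_add[OF C_k_gderiv[OF Suc.prems(1)] C_k_gderiv[OF Suc.prems(2)]]])
      (simp only: vector_add_component Suc.IH C_k_grad[OF Suc.prems(1)] C_k_grad[OF Suc.prems(2)])
qed

lemma C_k_mult: "C_k k f \<Longrightarrow> C_k k g \<Longrightarrow> C_k k (\<lambda>x. f x * g x)"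
proof (induction k arbitrary: f g)
  case 0
  then show ?case by (auto intro: continuous_intros)
next
  case (Suc k)
  show ?case
  proof (rule C_k_SucI[OF GDERIV_mult[OF C_k_gderiv[OF Suc.prems(1)] C_k_gderiv[OF Suc.prems(2)]]])
    fix i
    have "C_k k (\<lambda>x. f x * grad g x $ i)" "C_k k (\<lambda>x. g x * grad f x $ i)"
      by (rule Suc.IH[OF C_k_Suc_imp C_k_grad], fact, fact)+
    then show "C_k k (\<lambda>x. (f x *\<^sub>R grad g x + g x *\<^sub>R grad f x) $ i)"
      using C_k_add by simp
  qed
qed

lemma C_k_prod: "finite I \<Longrightarrow> (\<And>i. i \<in> I \<Longrightarrow> C_k k (f i)) \<Longrightarrow> C_k k (\<lambda>x. \<Prod>i\<in>I. f i x)"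
  by (induction I rule: finite_induct) (auto intro: C_k_const C_k_mult)

section \<open>A compactly supported smooth bump built from exp(-1/t)\<close>

definition flat :: "real poly \<Rightarrow> real \<Rightarrow> real" where
  "flat P t = (if t > 0 then poly P (1 / t) * exp (- (1 / t)) else 0)"

lemma flat_tendsto_0: "(flat P \<longlongrightarrow> 0) (at 0)"
proof -
  have "((\<lambda>s. poly P s * exp (- s)) \<longlongrightarrow> (\<Sum>i\<le>degree P. coeff P i * 0)) at_top"
  proof -
    have "(\<lambda>s. poly P s * exp (- s)) = (\<lambda>s. \<Sum>i\<le>degree P. coeff P i * (s ^ i / exp s))"
      by (simp only: poly_altdef sum_distrib_right exp_minus divide_inverse mult.assoc)
    then show ?thesis
      by (simp only:) (intro tendsto_sum tendsto_mult tendsto_const tendsto_power_div_exp_0)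
  qed
  then have l: "((\<lambda>s. poly P s * exp (- s)) \<longlongrightarrow> 0) at_top" by simp
  have "((\<lambda>t. poly P (1 / t) * exp (- (1 / t))) \<longlongrightarrow> 0) (at_right 0)"
    using filterlim_compose[OF l filterlim_inverse_at_top_right] by (simp add: inverse_eq_divide)
  then have r: "(flat P \<longlongrightarrow> 0) (at_right 0)"
    by (rule Lim_transform_eventually) (auto simp: flat_def eventually_at_filter)
  have "(flat P \<longlongrightarrow> 0) (at_left 0)"
    by (rule Lim_transform_eventually[OF tendsto_const]) (auto simp: flat_def eventually_at_filter)
  then show ?thesis using r by (simp add: filterlim_at_split)
qed

text \<open>The functions P(1/t) exp(-1/t), extended by 0, are closed under differentiation: the
  chain rule sends P to X^2 (P - P'). Smoothness thus becomes an induction over all P at once,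
  without formulas for higher derivatives.\<close>

lemma flat_deriv:
  "(flat P has_real_derivative flat ([:0, 0, 1:] * (P - pderiv P)) t) (at t)"
proof (cases t "0 :: real" rule: linorder_cases)
  case less
  have "((\<lambda>_. 0) has_real_derivative 0) (at t)" by simp
  then have "(flat P has_real_derivative 0) (at t)"
    by (rule has_field_derivative_transform_within_open[of _ _ _ "{..<0}"]) (use less in \<open>auto simp: flat_def\<close>)
  then show ?thesis using less by (simp add: flat_def)
next
  case equal
  \<comment> \<open>Dividing by \<open>h\<close> multiplies the polynomial by X, so the difference
    quotient at 0 is again a \<open>flat\<close> function.\<close>
  have "((\<lambda>h. (flat P (0 + h) - flat P 0) / h) \<longlongrightarrow> 0) (at 0)"
  proof (rule Lim_transform_eventually[OF flat_tendsto_0[of "[:0, 1:] * P"]])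
    show "eventually (\<lambda>h. flat ([:0, 1:] * P) h = (flat P (0 + h) - flat P 0) / h) (at 0)"
      by (auto simp: flat_def eventually_at_filter)
  qed
  then show ?thesis using equal by (simp add: DERIV_def flat_def)
next
  case greater
  have "((\<lambda>t. poly P (1 / t) * exp (- (1 / t))) has_real_derivative
     flat ([:0, 0, 1:] * (P - pderiv P)) t) (at t)"
    using greater
    by (auto intro!: derivative_eq_intros DERIV_chain2[OF poly_DERIV] simp: flat_def field_simps power2_eq_square)
  then show ?thesis
    by (rule has_field_derivative_transform_within_open[of _ _ _ "{0<..}"]) (use greater in \<open>auto simp: flat_def\<close>)
qed

lemma C_k_flat: "C_k k (\<lambda>x :: real^'n. flat P (c * x $ i + d))"
proof (induction k arbitrary: P)
  case 0
  have "isCont (flat P) t" for t using flat_deriv by (rule DERIV_isCont)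
  then have "continuous_on UNIV (flat P)" by (simp add: continuous_at_imp_continuous_on)
  then show ?case
    by (auto intro!: continuous_intros continuous_on_compose2[of UNIV "flat P"])
next
  case (Suc k)
  let ?Q = "[:0, 0, 1:] * (P - pderiv P)"
  show ?case
  proof (rule C_k_SucI)
    fix x :: "real^'n"
    have "GDERIV (\<lambda>x. c * x $ i + d) x :> c *\<^sub>R axis i 1"
      unfolding gderiv_def
      by (auto intro!: derivative_eq_intros simp: inner_axis bounded_linear.has_derivative[OF bounded_linear_vec_nth])
    then show "GDERIV (\<lambda>x. flat P (c * x $ i + d)) x :> flat ?Q (c * x $ i + d) *\<^sub>R (c *\<^sub>R axis i 1)"
      by (rule GDERIV_DERIV_compose[OF _ flat_deriv])
  next
    fix j
    show "C_k k (\<lambda>x :: real^'n. (flat ?Q (c * x $ i + d) *\<^sub>R (c *\<^sub>R axis i 1)) $ j)"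
      using C_k_mult[OF Suc.IH[of ?Q] C_k_const[of k "(c *\<^sub>R axis i 1 :: real^'n) $ j"]]
      by (simp only: vector_scaleR_component real_scaleR_def)
  qed
qed

text \<open>The factor \<open>Suc j\<close> steepens the profile: the bumps keep their support and
  stay between 0 and 1, but converge pointwise to the indicator of the open box. Dominated
  convergence then turns integrals against test functions into integrals over boxes.\<close>

definition box_bump :: "nat \<Rightarrow> real^'n \<Rightarrow> real^'n \<Rightarrow> real^'n \<Rightarrow> real" where
  "box_bump j a b x = (\<Prod>i\<in>UNIV. flat 1 (real (Suc j) * (x $ i - a $ i)) * flat 1 (real (Suc j) * (b $ i - x $ i)))"

lemma flat_1_bounds: "0 \<le> flat 1 t" "flat 1 t \<le> 1" "flat 1 t \<noteq> 0 \<longleftrightarrow> t > 0"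
  by (auto simp: flat_def)

lemma smooth_box_bump: "smooth (box_bump j a b)"
proof -
  have "C_k k (box_bump j a b)" for k
  proof -
    have "C_k k (\<lambda>x. flat 1 (real (Suc j) * (x $ i - a $ i)) * flat 1 (real (Suc j) * (b $ i - x $ i)))" for i
      using C_k_mult[OF C_k_flat[of k 1 "real (Suc j)" i "- real (Suc j) * a $ i"]
          C_k_flat[of k 1 "- real (Suc j)" i "real (Suc j) * b $ i"]]
      by (simp add: algebra_simps)
    then show ?thesis unfolding box_bump_def[abs_def] by (intro C_k_prod) auto
  qed
  then show ?thesis by (simp add: smooth_def)
qed

lemma box_bump_bounds: "0 \<le> box_bump j a b x" "box_bump j a b x \<le> 1"
  unfolding box_bump_def
  by (intro prod_nonneg prod_le_1 ballI conjI mult_nonneg_nonneg mult_le_one flat_1_bounds)+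

lemma box_bump_nonzero: "box_bump j a b x \<noteq> 0 \<longleftrightarrow> x \<in> box a b"
  unfolding box_bump_def using flat_1_bounds(3)
  by (simp add: mem_box_cart zero_less_mult_iff)

lemma flat_1_tendsto: "t > 0 \<Longrightarrow> (\<lambda>j. flat 1 (real (Suc j) * t)) \<longlonglongrightarrow> 1"
proof -
  assume t: "t > 0"
  have "(\<lambda>j. exp (- (inverse (real (Suc j)) * (1 / t)))) \<longlonglongrightarrow> exp (- (0 * (1 / t)))"
    by (intro tendsto_intros LIMSEQ_inverse_real_of_nat)
  then show ?thesis using t by (simp add: flat_def inverse_eq_divide)
qed

lemma box_bump_tendsto: "(\<lambda>j. box_bump j a b x) \<longlonglongrightarrow> indicator (box a b) x"
proof (cases "x \<in> box a b")
  case True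
  then have "(\<lambda>j. box_bump j a b x) \<longlonglongrightarrow> (\<Prod>i\<in>(UNIV::'a set). 1 * 1)"
    unfolding box_bump_def
    by (intro tendsto_prod tendsto_mult flat_1_tendsto) (auto simp: mem_box_cart)
  then show ?thesis using True by simp
next
  case False
  then show ?thesis using box_bump_nonzero[of _ a b x] by simp
qed

lemma closure_box_bump: "closure {x. box_bump j a b x \<noteq> 0} \<subseteq> cbox a b"
  unfolding box_bump_nonzero by (simp add: closure_minimal box_subset_cbox closed_cbox)

lemma test_function_box_bump:
  assumes "cbox a b \<subseteq> \<Omega>"
  shows "test_function \<Omega> (box_bump j a b)"
  unfolding test_function_def
  using assms closure_box_bump[of j a b] smooth_box_bump
  by (meson closed_closure compact_cbox compact_Int_closed closed_subset subset_trans bounded_cbox bounded_subset compact_eq_bounded_closed)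

lemma smooth_continuous: "smooth f \<Longrightarrow> continuous_on UNIV f"
  unfolding smooth_def by (metis C_k.simps(1))

lemma smooth_GDERIV: "smooth f \<Longrightarrow> GDERIV f x :> grad f x"
  unfolding smooth_def by (metis C_k_gderiv)

lemma smooth_continuous_grad:
  fixes f :: "real^'n \<Rightarrow> real"
  assumes "smooth f"
  shows "continuous_on UNIV (grad f)"
proof -
  have c: "continuous_on UNIV (\<lambda>x. grad f x $ i)" for i
    using assms unfolding smooth_def by (metis C_k.simps(1) C_k_grad)
  have "continuous_on UNIV (\<lambda>x. \<chi> i. grad f x $ i)"
    by (rule continuous_on_vec_lambda) (rule c)
  then show ?thesis by (simp only: vec_nth_inverse)
qed

lemma grad_eq_0_outside: "x \<notin> closure {x. f x \<noteq> 0} \<Longrightarrow> grad f x = 0"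
proof -
  assume x: "x \<notin> closure {x. f x \<noteq> 0}"
  have "((\<lambda>_. 0) has_derivative (\<lambda>h. inner h 0)) (at x)" by simp
  then have "(f has_derivative (\<lambda>h. inner h 0)) (at x)"
    by (rule has_derivative_transform_within_open[of _ _ _ _ "- closure {x. f x \<noteq> 0}"])
      (use x closure_subset[of "{x. f x \<noteq> 0}"] in auto)
  then show ?thesis by (intro grad_eq) (simp add: gderiv_def)
qed

lemma test_function_mono: "test_function \<Omega> \<phi> \<Longrightarrow> \<Omega> \<subseteq> \<Omega>' \<Longrightarrow> test_function \<Omega>' \<phi>"
  by (auto simp: test_function_def)

section \<open>Weak gradients\<close>

lemma

  fixes h :: "real^'n \<Rightarrow> 'b::{banach, second_countable_topology}"
  assumes K: "K \<in> sets lebesgue" "K \<subseteq> \<Omega>" and \<Omega>: "\<Omega> \<in> sets lebesgue" and h0: "\<And>x. x \<notin> K \<Longrightarrow> h x = 0"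
  shows integrable_support: "integrable (lebesgue_on \<Omega>) h \<longleftrightarrow> integrable (lebesgue_on K) h"
    and integral_support: "(LINT x|lebesgue_on \<Omega>. h x) = (LINT x|lebesgue_on K. h x)"
proof -
  have "(\<lambda>x. indicator K x *\<^sub>R h x) = h" using h0 by (auto simp: indicator_def)
  moreover have "(\<lambda>x. indicator \<Omega> x *\<^sub>R h x) = h" using h0 K by (force simp: indicator_def)
  ultimately show "integrable (lebesgue_on \<Omega>) h \<longleftrightarrow> integrable (lebesgue_on K) h"
    "(LINT x|lebesgue_on \<Omega>. h x) = (LINT x|lebesgue_on K. h x)"
    using K \<Omega> by (simp_all add: integrable_restrict_space integral_restrict_space)
qed

lemma integrable_bounded_mult:
  fixes f :: "'a \<Rightarrow> 'b::{banach, second_countable_topology}"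
    and h :: "'a \<Rightarrow> 'c::{banach, second_countable_topology}"
  assumes f: "integrable M f" and h: "h \<in> borel_measurable M"
    and B: "AE x in M. norm (h x) \<le> B * norm (f x)"
  shows "integrable M h"
  by (rule Bochner_Integration.integrable_bound[OF integrable_mult_right[OF integrable_norm[OF f], of B] h])
    (use B in \<open>auto intro: order_trans\<close>)

lemma continuous_measurable_lebesgue_on:
  "continuous_on UNIV f \<Longrightarrow> f \<in> borel_measurable (lebesgue_on S)"
  by (simp add: borel_measurable_continuous_onI measurable_completion measurable_restrict_space1)

lemma test_function_integrable:
  fixes f :: "real^'n \<Rightarrow> 'b::euclidean_space"
  assumes \<phi>: "test_function \<Omega> \<phi>" and \<Omega>: "\<Omega> \<in> sets lebesgue"
    and f: "\<And>K. compact K \<Longrightarrow> K \<subseteq> \<Omega> \<Longrightarrow> integrable (lebesgue_on K) f"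
  shows "integrable (lebesgue_on \<Omega>) (\<lambda>x. \<phi> x *\<^sub>R f x)"
proof -
  define K where "K = closure {x. \<phi> x \<noteq> 0}"
  have K: "compact K" "K \<subseteq> \<Omega>" using \<phi> by (auto simp: test_function_def K_def)
  have c: "continuous_on UNIV \<phi>" using \<phi> by (simp add: test_function_def smooth_continuous)
  obtain B where B: "\<And>x. x \<in> K \<Longrightarrow> norm (\<phi> x) \<le> B"
    using compact_imp_bounded[OF compact_continuous_image[OF continuous_on_subset[OF c] K(1)]]
    by (auto simp: bounded_iff)
  have "integrable (lebesgue_on K) (\<lambda>x. \<phi> x *\<^sub>R f x)"
  proof (rule integrable_bounded_mult[OF f[OF K]])
    show "(\<lambda>x. \<phi> x *\<^sub>R f x) \<in> borel_measurable (lebesgue_on K)"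
      using continuous_measurable_lebesgue_on[OF c] borel_measurable_integrable[OF f[OF K]]
      by (intro borel_measurable_scaleR) auto
    show "AE x in lebesgue_on K. norm (\<phi> x *\<^sub>R f x) \<le> B * norm (f x)"
      using B by (intro AE_I2) (auto intro!: mult_right_mono)
  qed
  then show ?thesis
    using integrable_support[of K \<Omega> "\<lambda>x. \<phi> x *\<^sub>R f x"] K \<Omega> closure_subset
    by (force simp: K_def lmeasurable_compact fmeasurableD)
qed

lemma test_function_grad_integrable:
  fixes u :: "real^'n \<Rightarrow> real"
  assumes \<phi>: "test_function \<Omega> \<phi>" and \<Omega>: "\<Omega> \<in> sets lebesgue"
    and u: "\<And>K. compact K \<Longrightarrow> K \<subseteq> \<Omega> \<Longrightarrow> integrable (lebesgue_on K) u"
  shows "integrable (lebesgue_on \<Omega>) (\<lambda>x. u x *\<^sub>R grad \<phi> x)"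
proof -
  define K where "K = closure {x. \<phi> x \<noteq> 0}"
  have K: "compact K" "K \<subseteq> \<Omega>" using \<phi> by (auto simp: test_function_def K_def)
  have c: "continuous_on UNIV (grad \<phi>)" using \<phi> by (simp add: test_function_def smooth_continuous_grad)
  obtain B where B: "\<And>x. x \<in> K \<Longrightarrow> norm (grad \<phi> x) \<le> B"
    using compact_imp_bounded[OF compact_continuous_image[OF continuous_on_subset[OF c] K(1)]]
    by (auto simp: bounded_iff)
  have "integrable (lebesgue_on K) (\<lambda>x. u x *\<^sub>R grad \<phi> x)"
  proof (rule integrable_bounded_mult[OF u[OF K]])
    show "(\<lambda>x. u x *\<^sub>R grad \<phi> x) \<in> borel_measurable (lebesgue_on K)"
      using continuous_measurable_lebesgue_on[OF c] borel_measurable_integrable[OF u[OF K]]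
      by (intro borel_measurable_scaleR) auto
    show "AE x in lebesgue_on K. norm (u x *\<^sub>R grad \<phi> x) \<le> B * norm (u x)"
      using B by (intro AE_I2) (auto intro!: mult_right_mono simp: mult.commute[of "\<bar>u _\<bar>"])
  qed
  then show ?thesis
    using integrable_support[of K \<Omega> "\<lambda>x. u x *\<^sub>R grad \<phi> x"] K \<Omega> grad_eq_0_outside[of _ \<phi>]
    by (force simp: K_def lmeasurable_compact fmeasurableD)
qed

section \<open>The fundamental lemma of the calculus of variations\<close>

lemma integral_box_zero_imp_AE_zero:
  fixes f :: "real^'n \<Rightarrow> real"
  assumes f: "integrable lborel f" and box: "\<And>a b. (LINT x:box a b|lborel. f x) = 0"
    and total: "(LINT x|lborel. f x) = 0"
  shows "AE x in lborel. f x = 0"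
proof (rule sigma_finite_measure.density_zero[OF lborel.sigma_finite_measure_axioms f])
  fix A :: "(real^'n) set" assume "A \<in> sets lborel"
  then have A: "A \<in> sigma_sets UNIV (range (\<lambda>(a, b). box a b))"
    by (simp add: borel_eq_box)
  have "Int_stable (range (\<lambda>(a, b). box a b :: (real^'n) set))"
    by (auto simp: Int_stable_def box_Int_box)
  \<comment> \<open>Dynkin's argument: boxes are stable under intersection and generate the Borel
    sets; the total integral serves the passage to complements.\<close>
  from this _ A show "(LINT x:A|lborel. f x) = 0"
  proof (rule sigma_sets_induct_disjoint[where P = "\<lambda>A. (LINT x:A|lborel. f x) = 0"], goal_cases sub basic empty compl union)
    case sub
    show ?case by auto
  next
    case (basic A)
    then show ?case using box by auto
  next
    case empty
    show ?case by (simp add: set_lebesgue_integral_def)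
  next
    case (compl A)
    then have "A \<in> sets borel" by (simp add: borel_eq_box)
    then have i: "set_integrable lborel A f"
      unfolding set_integrable_def using f by (intro integrable_mult_indicator) auto
    have "(LINT x:UNIV - A|lborel. f x) = (LINT x|lborel. f x) - (LINT x:A|lborel. f x)"
    proof -
      have "(\<lambda>x. indicator (UNIV - A) x *\<^sub>R f x) = (\<lambda>x. f x - indicator A x *\<^sub>R f x)"
        by (auto simp: indicator_def)
      then show ?thesis
        unfolding set_lebesgue_integral_def
        using Bochner_Integration.integral_diff[OF f i[unfolded set_integrable_def]] by simp
    qed
    then show ?case using compl total by simp
  next
    case (union A)
    then have m: "A i \<in> sets borel" for i
      using borel_eq_box sets_measure_of[of "range (\<lambda>(a, b). box a b)" UNIV] by (metis UNIV_I rangeI range_subsetD subset_UNIV top_greatest Pow_UNIV)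
    have "(LINT x:(\<Union>i. A i)|lborel. f x) = (\<Sum>i. LINT x:A i|lborel. f x)"
    proof (rule lebesgue_integral_countable_add)
      show "set_integrable lborel (\<Union>i. A i) f"
        unfolding set_integrable_def using f m by (intro integrable_mult_indicator) auto
    qed (use m union(1) in \<open>auto simp: disjoint_family_on_def\<close>)
    then show ?case using union by simp
  qed
qed

text \<open>Bumps converge to indicators of boxes, so the integral of f vanishes over every box
  whose closed version lies in \<Omega>. A generator argument makes f vanish on each such box, and
  countably many of them cover \<Omega>. No mollification is involved.\<close>

lemma fundamental_lemma_calculus_of_variations:
  fixes f :: "real^'n \<Rightarrow> real"
  assumes \<Omega>: "open \<Omega>"
    and f: "\<And>K. compact K \<Longrightarrow> K \<subseteq> \<Omega> \<Longrightarrow> integrable (lebesgue_on K) f"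
    and zero: "\<And>\<phi>. test_function \<Omega> \<phi> \<Longrightarrow> (LINT x|lebesgue_on \<Omega>. \<phi> x * f x) = 0"
  shows "AE x in lebesgue_on \<Omega>. f x = 0"
proof -
  have \<Omega>m: "\<Omega> \<in> sets lebesgue" using \<Omega> by simp
  have boxzero: "(LINT x|lebesgue. indicator (box a b) x * f x) = 0" if ab: "cbox a b \<subseteq> \<Omega>" for a b
  proof -
    have i: "integrable lebesgue (\<lambda>x. indicator (cbox a b) x * f x)"
      using f[OF compact_cbox ab] by (simp add: integrable_restrict_space)
    have "(\<lambda>j. LINT x|lebesgue. box_bump j a b x * (indicator (cbox a b) x * f x))
      \<longlonglongrightarrow> (LINT x|lebesgue. indicator (box a b) x * (indicator (cbox a b) x * f x))"
    proof (rule integral_dominated_convergence[where w = "\<lambda>x. \<bar>indicator (cbox a b) x * f x\<bar>"])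
      show "AE x in lebesgue. (\<lambda>j. box_bump j a b x * (indicator (cbox a b) x * f x))
        \<longlonglongrightarrow> indicator (box a b) x * (indicator (cbox a b) x * f x)"
        by (intro AE_I2 tendsto_mult tendsto_const box_bump_tendsto)
      show "(\<lambda>x. box_bump j a b x * (indicator (cbox a b) x * f x)) \<in> borel_measurable lebesgue" for j
        using borel_measurable_integrable[OF i]
          continuous_measurable_lebesgue_on[OF smooth_continuous[OF smooth_box_bump], of j a b UNIV]
        by (intro borel_measurable_times[of "box_bump j a b"]) (auto simp: lebesgue_on_UNIV_eq)
      show "AE x in lebesgue. norm (box_bump j a b x * (indicator (cbox a b) x * f x)) \<le> \<bar>indicator (cbox a b) x * f x\<bar>" for j
        using box_bump_bounds[of j a b]
        by (intro AE_I2) (auto simp: abs_mult intro!: mult_left_le_one_le)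
      show "(\<lambda>x. indicator (box a b) x * (indicator (cbox a b) x * f x)) \<in> borel_measurable lebesgue"
        using borel_measurable_integrable[OF i]
        by (intro borel_measurable_times[of "indicator (box a b)"] borel_measurable_indicator) auto
    qed (use i in auto)
    moreover have "(LINT x|lebesgue. box_bump j a b x * (indicator (cbox a b) x * f x)) = 0" for j
    proof -
      have "(\<lambda>x. box_bump j a b x * (indicator (cbox a b) x * f x)) = (\<lambda>x. indicator \<Omega> x *\<^sub>R (box_bump j a b x * f x))"
        using box_bump_nonzero[of j a b] box_subset_cbox[of a b] ab by (auto simp: indicator_def fun_eq_iff)
      then show ?thesis
        using zero[OF test_function_box_bump[OF ab], of j] \<Omega>m by (simp add: integral_restrict_space)
    qed
    moreover have "(\<lambda>x. indicator (box a b) x * (indicator (cbox a b) x * f x)) = (\<lambda>x. indicator (box a b) x * f x)"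
      using box_subset_cbox[of a b] by (auto simp: indicator_def fun_eq_iff)
    ultimately show ?thesis by (simp add: LIMSEQ_const_iff)
  qed
  have AEbox: "AE x in lebesgue. x \<in> cbox a b \<longrightarrow> f x = 0" if ab: "cbox a b \<subseteq> \<Omega>" for a b
  proof -
    define F where "F x = indicator (box a b) x * f x" for x
    have "integrable lebesgue (\<lambda>x. indicator (box a b) x *\<^sub>R (indicator (cbox a b) x * f x))"
      using f[OF compact_cbox ab] by (intro integrable_mult_indicator) (auto simp: integrable_restrict_space)
    moreover have "(\<lambda>x. indicator (box a b) x *\<^sub>R (indicator (cbox a b) x * f x)) = F"
      using box_subset_cbox[of a b] by (auto simp: F_def indicator_def fun_eq_iff)
    ultimately have F: "integrable lebesgue F" by simp
    \<comment> \<open>The generator argument lives on Borel sets, so the cut-off function is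
      replaced by a Borel representative.\<close>
    obtain G where G: "G \<in> borel_measurable lborel" "AE x in lborel. F x = G x"
      using completion_ex_borel_measurable_real[OF borel_measurable_integrable[OF F]] by blast
    have FG: "AE x in lebesgue. F x = G x" using G(2) by (rule AE_completion)
    have Gm: "G \<in> borel_measurable lebesgue" using G(1) by (rule measurable_completion)
    have "integrable lebesgue G"
      using F integrable_cong_AE[OF borel_measurable_integrable[OF F] Gm FG] by simp
    then have Gi: "integrable lborel G" using G(1) by (simp add: integrable_completion)
    have int: "(LINT x:box c d|lborel. G x) = 0" for c d
    proof -
      \<comment> \<open>A test box meets \<open>box a b\<close> in another box, and explicit corners
        show that its closed version stays in \<open>cbox a b\<close>, so \<open>boxzero\<close>
        applies to it.\<close>
      obtain e g where eg: "box a b \<inter> box c d = box e g" "cbox e g \<subseteq> cbox a b"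
      proof
        let ?e = "\<Sum>i\<in>Basis. max (a \<bullet> i) (c \<bullet> i) *\<^sub>R i" and ?g = "\<Sum>i\<in>Basis. min (b \<bullet> i) (d \<bullet> i) *\<^sub>R i"
        show "box a b \<inter> box c d = box ?e ?g" by (rule box_Int_box)
        show "cbox ?e ?g \<subseteq> cbox a b" by (auto simp: mem_box)
      qed
      have "(LINT x:box c d|lborel. G x) = (LINT x|lebesgue. indicator (box c d) x *\<^sub>R G x)"
        unfolding set_lebesgue_integral_def using G(1) by (subst integral_completion) auto
      also have "\<dots> = (LINT x|lebesgue. indicator (box c d) x *\<^sub>R F x)"
        using FG Gm borel_measurable_integrable[OF F]
        by (intro integral_cong_AE borel_measurable_scaleR borel_measurable_indicator) auto
      also have "\<dots> = (LINT x|lebesgue. indicator (box e g) x * f x)"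
        unfolding F_def eg(1)[symmetric] by (simp add: indicator_inter_arith mult_ac)
      also have "\<dots> = 0" using boxzero[of e g] eg(2) ab by auto
      finally show ?thesis .
    qed
    have "(LINT x|lborel. G x) = (LINT x|lebesgue. F x)"
      using G(1) FG Gm F by (subst integral_completion[symmetric]) (auto intro!: integral_cong_AE)
    also have "\<dots> = 0" unfolding F_def by (rule boxzero[OF ab])
    finally have "AE x in lborel. G x = 0" by (intro integral_box_zero_imp_AE_zero[OF Gi int])
    then have "AE x in lebesgue. G x = 0" by (rule AE_completion)
    \<comment> \<open>The cover below consists of closed boxes; their boundaries are null
      sets.\<close>
    moreover have "AE x in lebesgue. x \<notin> cbox a b - box a b"
    proof -
      have "negligible (cbox a b - box a b)" by (rule negligible_frontier_interval)
      then show ?thesis by (intro AE_not_in) (simp add: negligible_iff_null_sets)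
    qed
    ultimately show ?thesis using FG
      by eventually_elim (auto simp: F_def)
  qed
  obtain \<D> :: "(real^'n) set set" where D: "countable \<D>" "\<D> \<subseteq> Pow \<Omega>" "\<And>X. X \<in> \<D> \<Longrightarrow> \<exists>a b. X = cbox a b" "\<Union>\<D> = \<Omega>"
    using open_countable_Union_open_cbox[OF \<Omega>] by blast
  have "AE x in lebesgue. \<forall>X\<in>\<D>. x \<in> X \<longrightarrow> f x = 0"
  proof (subst AE_ball_countable[OF D(1)], intro ballI)
    fix X assume X: "X \<in> \<D>"
    then obtain a b where "X = cbox a b" using D(3) by blast
    then show "AE x in lebesgue. x \<in> X \<longrightarrow> f x = 0" using AEbox[of a b] X D(2) by auto
  qed
  then have "AE x in lebesgue. x \<in> \<Omega> \<longrightarrow> f x = 0"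
    by eventually_elim (use D(4) in auto)
  then show ?thesis using \<Omega>m by (simp add: AE_restrict_space_iff)
qed

section \<open>Uniqueness, linearity and restriction of weak gradients\<close>

lemma weak_gradient_integrable:
  assumes "weak_gradient \<Omega> u g" "compact K" "K \<subseteq> \<Omega>"
  shows "integrable (lebesgue_on K) u" "integrable (lebesgue_on K) g"
  using assms by (auto simp: weak_gradient_def)

lemma weak_gradient_eq:
  "weak_gradient \<Omega> u g \<Longrightarrow> test_function \<Omega> \<phi> \<Longrightarrow>
     (LINT x|lebesgue_on \<Omega>. u x *\<^sub>R grad \<phi> x) = - (LINT x|lebesgue_on \<Omega>. \<phi> x *\<^sub>R g x)"
  by (simp add: weak_gradient_def)

lemma weak_gradient_unique:
  fixes u :: "real^'n \<Rightarrow> real"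
  assumes \<Omega>: "open \<Omega>" and g: "weak_gradient \<Omega> u g" and g': "weak_gradient \<Omega> u g'"
  shows "AE x in lebesgue_on \<Omega>. g x = g' x"
proof -
  have \<Omega>m: "\<Omega> \<in> sets lebesgue" using \<Omega> by simp
  have "AE x in lebesgue_on \<Omega>. (g x - g' x) $ i = 0" for i
  proof (rule fundamental_lemma_calculus_of_variations[OF \<Omega>])
    fix K assume K: "compact K" "K \<subseteq> \<Omega>"
    show "integrable (lebesgue_on K) (\<lambda>x. (g x - g' x) $ i)"
      by (rule integrable_bounded_linear[OF bounded_linear_vec_nth])
        (use weak_gradient_integrable(2)[OF g K] weak_gradient_integrable(2)[OF g' K] in auto)
  next
    fix \<phi> assume \<phi>: "test_function \<Omega> \<phi>"
    have i: "integrable (lebesgue_on \<Omega>) (\<lambda>x. \<phi> x *\<^sub>R g x)" "integrable (lebesgue_on \<Omega>) (\<lambda>x. \<phi> x *\<^sub>R g' x)"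
      by (rule test_function_integrable[OF \<phi> \<Omega>m weak_gradient_integrable(2)[OF g]]
          test_function_integrable[OF \<phi> \<Omega>m weak_gradient_integrable(2)[OF g']], assumption+)+
    have "(LINT x|lebesgue_on \<Omega>. \<phi> x *\<^sub>R g x - \<phi> x *\<^sub>R g' x) = 0"
      using weak_gradient_eq[OF g \<phi>] weak_gradient_eq[OF g' \<phi>] i by simp
    moreover have "(LINT x|lebesgue_on \<Omega>. (\<phi> x *\<^sub>R g x - \<phi> x *\<^sub>R g' x) $ i)
      = (LINT x|lebesgue_on \<Omega>. \<phi> x *\<^sub>R g x - \<phi> x *\<^sub>R g' x) $ i"
      using i by (intro integral_bounded_linear[OF bounded_linear_vec_nth]) auto
    ultimately show "(LINT x|lebesgue_on \<Omega>. \<phi> x * (g x - g' x) $ i) = 0"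
      by (simp add: algebra_simps)
  qed
  then have "AE x in lebesgue_on \<Omega>. \<forall>i\<in>UNIV. (g x - g' x) $ i = 0"
    by (subst AE_ball_countable) auto
  then show ?thesis by eventually_elim (simp add: vec_eq_iff)
qed

lemma weak_gradient_linear:
  assumes \<Omega>: "\<Omega> \<in> sets lebesgue" and u: "weak_gradient \<Omega> u g" and v: "weak_gradient \<Omega> v h"
  shows "weak_gradient \<Omega> (\<lambda>x. c * u x + d * v x) (\<lambda>x. c *\<^sub>R g x + d *\<^sub>R h x)"
  unfolding weak_gradient_def
proof (intro conjI allI impI)
  fix K assume "compact K \<and> K \<subseteq> \<Omega>"
  then have K: "compact K" "K \<subseteq> \<Omega>" by auto
  show "integrable (lebesgue_on K) (\<lambda>x. c * u x + d * v x)"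
    using weak_gradient_integrable(1)[OF u K] weak_gradient_integrable(1)[OF v K] by auto
  show "integrable (lebesgue_on K) (\<lambda>x. c *\<^sub>R g x + d *\<^sub>R h x)"
    using weak_gradient_integrable(2)[OF u K] weak_gradient_integrable(2)[OF v K] by auto
next
  fix \<phi> assume \<phi>: "test_function \<Omega> \<phi>"
  have i: "integrable (lebesgue_on \<Omega>) (\<lambda>x. \<phi> x *\<^sub>R g x)" "integrable (lebesgue_on \<Omega>) (\<lambda>x. \<phi> x *\<^sub>R h x)"
      "integrable (lebesgue_on \<Omega>) (\<lambda>x. u x *\<^sub>R grad \<phi> x)" "integrable (lebesgue_on \<Omega>) (\<lambda>x. v x *\<^sub>R grad \<phi> x)"
    by (rule test_function_integrable[OF \<phi> \<Omega>] test_function_grad_integrable[OF \<phi> \<Omega>],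
        erule (1) weak_gradient_integrable[OF u] weak_gradient_integrable[OF v])+
  have "(LINT x|lebesgue_on \<Omega>. (c * u x + d * v x) *\<^sub>R grad \<phi> x)
     = (LINT x|lebesgue_on \<Omega>. c *\<^sub>R (u x *\<^sub>R grad \<phi> x) + d *\<^sub>R (v x *\<^sub>R grad \<phi> x))"
    by (simp add: algebra_simps)
  also have "\<dots> = c *\<^sub>R (LINT x|lebesgue_on \<Omega>. u x *\<^sub>R grad \<phi> x) + d *\<^sub>R (LINT x|lebesgue_on \<Omega>. v x *\<^sub>R grad \<phi> x)"
    using i by (subst Bochner_Integration.integral_add) (auto simp del: scaleR_scaleR)
  also have "\<dots> = - (c *\<^sub>R (LINT x|lebesgue_on \<Omega>. \<phi> x *\<^sub>R g x) + d *\<^sub>R (LINT x|lebesgue_on \<Omega>. \<phi> x *\<^sub>R h x))"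
    using weak_gradient_eq[OF u \<phi>] weak_gradient_eq[OF v \<phi>] by simp
  also have "c *\<^sub>R (LINT x|lebesgue_on \<Omega>. \<phi> x *\<^sub>R g x) + d *\<^sub>R (LINT x|lebesgue_on \<Omega>. \<phi> x *\<^sub>R h x)
     = (LINT x|lebesgue_on \<Omega>. c *\<^sub>R (\<phi> x *\<^sub>R g x) + d *\<^sub>R (\<phi> x *\<^sub>R h x))"
    using i by (subst Bochner_Integration.integral_add) (auto simp del: scaleR_scaleR)
  also have "\<dots> = (LINT x|lebesgue_on \<Omega>. \<phi> x *\<^sub>R (c *\<^sub>R g x + d *\<^sub>R h x))"
    by (simp add: algebra_simps)
  finally show "(LINT x|lebesgue_on \<Omega>. (c * u x + d * v x) *\<^sub>R grad \<phi> x)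
     = - (LINT x|lebesgue_on \<Omega>. \<phi> x *\<^sub>R (c *\<^sub>R g x + d *\<^sub>R h x))" .
qed

text \<open>A test function on the smaller set is, as it stands, one on the larger set, because
  functions are total and it vanishes outside its support.\<close>

lemma weak_gradient_restrict:
  assumes "weak_gradient \<Omega>' u g" "\<Omega> \<subseteq> \<Omega>'" "\<Omega> \<in> sets lebesgue" "\<Omega>' \<in> sets lebesgue"
  shows "weak_gradient \<Omega> u g"
  unfolding weak_gradient_def
proof (intro conjI allI impI)
  fix K assume K: "compact K \<and> K \<subseteq> \<Omega>"
  then have "K \<subseteq> \<Omega>'" using assms(2) by auto
  then show "integrable (lebesgue_on K) u" "integrable (lebesgue_on K) g"
    using weak_gradient_integrable[OF assms(1)] K by auto
next
  fix \<phi> assume \<phi>: "test_function \<Omega> \<phi>"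
  have out: "\<phi> x = 0" "grad \<phi> x = 0" if "x \<notin> \<Omega>" for x
    using that \<phi> closure_subset[of "{x. \<phi> x \<noteq> 0}"] grad_eq_0_outside[of x \<phi>]
    unfolding test_function_def by auto
  show "(LINT x|lebesgue_on \<Omega>. u x *\<^sub>R grad \<phi> x) = - (LINT x|lebesgue_on \<Omega>. \<phi> x *\<^sub>R g x)"
    using weak_gradient_eq[OF assms(1) test_function_mono[OF \<phi> assms(2)]]
      integral_support[OF assms(3,2,4), of "\<lambda>x. u x *\<^sub>R grad \<phi> x"]
      integral_support[OF assms(3,2,4), of "\<lambda>x. \<phi> x *\<^sub>R g x"] out
    by simp
qed

section \<open>Modification on Lebesgue null sets\<close>

lemma AE_lebesgue_on_subset:
  assumes "AE x in lebesgue_on \<Omega>. P x" "K \<subseteq> \<Omega>" "K \<in> sets lebesgue" "\<Omega> \<in> sets lebesgue"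
  shows "AE x in lebesgue_on K. P x"
proof -
  have "AE x in lebesgue. x \<in> \<Omega> \<longrightarrow> P x" using assms by (simp add: AE_restrict_space_iff)
  then have "AE x in lebesgue. x \<in> K \<longrightarrow> P x" by eventually_elim (use assms in auto)
  then show ?thesis using assms by (simp add: AE_restrict_space_iff)
qed

text \<open>Completeness of Lebesgue measure: the two preimages of a Borel set differ by a subset of
  a null set. This covers functions known only up to almost everywhere equality, such as
  \<open>wgrad\<close>.\<close>

lemma borel_measurable_cong_AE_lebesgue_on:
  fixes f g :: "real^'n \<Rightarrow> 'b::topological_space"
  assumes ae: "AE x in lebesgue_on \<Omega>. f x = g x" and \<Omega>: "\<Omega> \<in> sets lebesgue"
    and f: "f \<in> borel_measurable (lebesgue_on \<Omega>)"
  shows "g \<in> borel_measurable (lebesgue_on \<Omega>)"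
proof (rule measurableI)
  fix B :: "'b set" assume B: "B \<in> sets borel"
  have "AE x in lebesgue. x \<in> \<Omega> \<longrightarrow> f x = g x" using ae \<Omega> by (simp add: AE_restrict_space_iff)
  then obtain N where N0: "\<And>x. x \<in> space lebesgue - N \<Longrightarrow> x \<in> \<Omega> \<longrightarrow> f x = g x"
    and N: "N \<in> null_sets lebesgue"
    by (rule AE_E3) blast
  have N': "x \<in> N" if "x \<in> \<Omega>" "f x \<noteq> g x" for x using N0[of x] that by auto
  have "f -` B \<inter> \<Omega> \<in> sets lebesgue"
    using measurable_sets[OF f B] \<Omega> by (auto simp: sets_restrict_space_iff)
  moreover have "negligible ((f -` B \<inter> \<Omega> - g -` B \<inter> \<Omega>) \<union> (g -` B \<inter> \<Omega> - f -` B \<inter> \<Omega>))"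
    by (rule negligible_subset[of N]) (use N N' in \<open>auto simp: negligible_iff_null_sets, metis+\<close>)
  ultimately have "g -` B \<inter> \<Omega> \<in> sets lebesgue" by (rule sets_negligible_symdiff)
  then show "g -` B \<inter> space (lebesgue_on \<Omega>) \<in> sets (lebesgue_on \<Omega>)"
    using \<Omega> by (auto simp: sets_restrict_space_iff)
qed simp

text \<open>Completeness gives f and g the same measurability. If neither is measurable, neither is
  integrable and both integrals have the default value 0; hence there is no measurability
  assumption.\<close>

lemma integral_cong_AE_complete:
  fixes f g :: "real^'n \<Rightarrow> 'b::{banach, second_countable_topology}"
  assumes "AE x in lebesgue_on \<Omega>. f x = g x" "\<Omega> \<in> sets lebesgue"
  shows "integrable (lebesgue_on \<Omega>) f \<longleftrightarrow> integrable (lebesgue_on \<Omega>) g"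
    "(LINT x|lebesgue_on \<Omega>. f x) = (LINT x|lebesgue_on \<Omega>. g x)"
proof -
  have m: "f \<in> borel_measurable (lebesgue_on \<Omega>) \<longleftrightarrow> g \<in> borel_measurable (lebesgue_on \<Omega>)"

  proof
    show "f \<in> borel_measurable (lebesgue_on \<Omega>) \<Longrightarrow> g \<in> borel_measurable (lebesgue_on \<Omega>)"
      by (rule borel_measurable_cong_AE_lebesgue_on[OF assms])
    have "AE x in lebesgue_on \<Omega>. g x = f x" using assms(1) by eventually_elim simp
    then show "g \<in> borel_measurable (lebesgue_on \<Omega>) \<Longrightarrow> f \<in> borel_measurable (lebesgue_on \<Omega>)"
      by (rule borel_measurable_cong_AE_lebesgue_on[OF _ assms(2)])
  qed

  show "integrable (lebesgue_on \<Omega>) f \<longleftrightarrow> integrable (lebesgue_on \<Omega>) g"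
  proof (cases "f \<in> borel_measurable (lebesgue_on \<Omega>)")
    case True
    then show ?thesis using m assms by (intro integrable_cong_AE) auto
  next
    case False
    then show ?thesis using m by (auto dest: borel_measurable_integrable)
  qed
  show "(LINT x|lebesgue_on \<Omega>. f x) = (LINT x|lebesgue_on \<Omega>. g x)"
  proof (cases "f \<in> borel_measurable (lebesgue_on \<Omega>)")
    case True
    then show ?thesis using m assms by (intro integral_cong_AE) auto
  next
    case False
    then have "\<not> integrable (lebesgue_on \<Omega>) f" "\<not> integrable (lebesgue_on \<Omega>) g"
      using m by (auto dest: borel_measurable_integrable)
    then show ?thesis by (simp add: not_integrable_integral_eq)
  qed
qed

section \<open>Translates of weakly differentiable functions\<close>

lemma GDERIV_translate:
  assumes "GDERIV f (x + a) :> D"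
  shows "GDERIV (\<lambda>x. f (x + a)) x :> D"
proof -
  have "((\<lambda>x. x + a) has_derivative (\<lambda>h. h)) (at x)" by (auto intro!: derivative_eq_intros)
  then show ?thesis using assms unfolding gderiv_def by (rule has_derivative_compose)
qed

lemma C_k_translate: "C_k k f \<Longrightarrow> C_k k (\<lambda>x. f (x + a))"
proof (induction k arbitrary: f)
  case 0
  then show ?case by (auto intro!: continuous_intros elim: continuous_on_compose2)
next
  case (Suc k)
  show ?case
    by (rule C_k_SucI[OF GDERIV_translate[OF C_k_gderiv[OF Suc.prems]]])
      (rule Suc.IH[OF C_k_grad[OF Suc.prems]])
qed

lemma test_function_translate:
  fixes \<phi> :: "real^'n \<Rightarrow> real"
  assumes \<phi>: "test_function UNIV \<phi>"
  shows "test_function UNIV (\<lambda>x. \<phi> (x + a))" "grad (\<lambda>x. \<phi> (x + a)) x = grad \<phi> (x + a)"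
proof -
  have s: "smooth \<phi>" and K: "compact (closure {x. \<phi> x \<noteq> 0})" using \<phi> by (auto simp: test_function_def)
  have "smooth (\<lambda>x. \<phi> (x + a))" using s C_k_translate unfolding smooth_def by blast
  moreover have "bounded {x. \<phi> (x + a) \<noteq> 0}"
  proof (rule bounded_subset)
    show "bounded ((\<lambda>y. - a + y) ` closure {x. \<phi> x \<noteq> 0})"
      by (rule bounded_translation[OF compact_imp_bounded[OF K]])
    show "{x. \<phi> (x + a) \<noteq> 0} \<subseteq> (\<lambda>y. - a + y) ` closure {x. \<phi> x \<noteq> 0}"
    proof
      fix x assume "x \<in> {x. \<phi> (x + a) \<noteq> 0}"
      then have "x + a \<in> closure {x. \<phi> x \<noteq> 0}" using closure_subset by fastforce
      then show "x \<in> (\<lambda>y. - a + y) ` closure {x. \<phi> x \<noteq> 0}" by (intro image_eqI[of _ _ "x + a"]) auto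
    qed
  qed
  ultimately show "test_function UNIV (\<lambda>x. \<phi> (x + a))"
    by (simp add: test_function_def compact_closure)
  show "grad (\<lambda>x. \<phi> (x + a)) x = grad \<phi> (x + a)"
    by (rule grad_eq[OF GDERIV_translate[OF smooth_GDERIV[OF s]]])
qed

section \<open>Shifts of Lebesgue measure and integration along segments\<close>

lemma nn_integral_lborel_shift:
  fixes f :: "real^'n \<Rightarrow> ennreal"
  assumes [measurable]: "f \<in> borel_measurable borel"
  shows "(\<integral>\<^sup>+x. f (x + a) \<partial>lborel) = (\<integral>\<^sup>+x. f x \<partial>lborel)"
proof -
  have "(\<integral>\<^sup>+x. f x \<partial>lborel) = (\<integral>\<^sup>+x. f x \<partial>distr lborel borel ((+) a))"
    by (simp add: lborel_distr_plus)
  also have "\<dots> = (\<integral>\<^sup>+x. f (x + a) \<partial>lborel)"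
    by (subst nn_integral_distr) (auto simp: add.commute)
  finally show ?thesis by simp
qed

lemma integral_lborel_shift:
  fixes f :: "real^'n \<Rightarrow> real"
  assumes [measurable]: "f \<in> borel_measurable borel"
  shows "(LINT x|lborel. f (x + a)) = (LINT x|lborel. f x)"
    "integrable lborel (\<lambda>x. f (x + a)) \<longleftrightarrow> integrable lborel f"
proof -
  have "(LINT x|lborel. f x) = (LINT x|distr lborel borel ((+) a). f x)"
    by (simp add: lborel_distr_plus)
  also have "\<dots> = (LINT x|lborel. f (x + a))"
    by (subst integral_distr) (auto simp: add.commute)
  finally show "(LINT x|lborel. f (x + a)) = (LINT x|lborel. f x)" by simp
  have "integrable lborel f \<longleftrightarrow> integrable (distr lborel borel ((+) a)) f"
    by (simp add: lborel_distr_plus)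
  also have "\<dots> \<longleftrightarrow> integrable lborel (\<lambda>x. f (x + a))"
    by (subst integrable_distr_eq) (auto simp: add.commute)
  finally show "integrable lborel (\<lambda>x. f (x + a)) \<longleftrightarrow> integrable lborel f" by simp
qed

text \<open>The left end is excluded so that t > 0 throughout: negative powers of t and the
  substitution by the factor t occur later.\<close>

abbreviation I01 :: "real measure" where "I01 \<equiv> restrict_space lborel {0<..1}"

interpretation I01: finite_measure I01
  by (rule finite_measureI) (auto simp: space_restrict_space emeasure_restrict_space)

interpretation lborel_I01: pair_sigma_finite lborel I01 ..

lemma emeasure_I01: "emeasure I01 (space I01) = 1"
  by (auto simp: emeasure_restrict_space)

lemma borel_measurable_I01: "f \<in> borel_measurable borel \<Longrightarrow> f \<in> borel_measurable I01"
  by (rule measurable_restrict_space1) simp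

lemma measurable_id_I01 [measurable]: "(\<lambda>t. t) \<in> borel_measurable I01"
  by (rule borel_measurable_I01) simp

lemma measurable_snd_I01 [measurable]: "snd \<in> borel_measurable (M \<Otimes>\<^sub>M I01)"
  by (rule measurable_compose[OF measurable_snd measurable_id_I01])

lemma cball_in_borel [measurable]: "cball c R \<in> sets borel"
  by simp

lemma integral_I01_FTC:
  fixes F :: "real \<Rightarrow> real"
  assumes F: "\<And>t. (F has_real_derivative f t) (at t)" and f: "continuous_on UNIV f"
  shows "(LINT t|I01. f t) = F 1 - F 0"
proof -
  have [measurable]: "f \<in> borel_measurable borel" using f by (rule borel_measurable_continuous_onI)
  have "(LINT t|I01. f t) = (LINT t|lborel. indicator {0<..1} t *\<^sub>R f t)"
    by (simp add: integral_restrict_space)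
  also have "\<dots> = (LINT t|lborel. indicator {0..1} t *\<^sub>R f t)"
  proof (rule integral_cong_AE)
    show "AE t in lborel. indicator {0<..1} t *\<^sub>R f t = indicator {0..1} t *\<^sub>R f t"
      using AE_lborel_singleton[of 0] by eventually_elim (auto simp: indicator_def)
  qed auto
  also have "\<dots> = F 1 - F 0"
    using F f by (intro integral_FTC_atLeastAtMost)
      (auto simp: has_real_derivative_iff_has_vector_derivative intro: has_vector_derivative_at_within continuous_on_subset)
  finally show ?thesis .
qed

lemma locally_integrable_lborel:
  fixes f :: "real^'n \<Rightarrow> 'b::euclidean_space"
  assumes "f \<in> borel_measurable borel" "\<And>K. compact K \<Longrightarrow> integrable (lebesgue_on K) f"
  shows "integrable lborel (\<lambda>x. indicator (cball 0 R) x *\<^sub>R f x)"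
proof -
  have "integrable lebesgue (\<lambda>x. indicator (cball 0 R) x *\<^sub>R f x)"
    using assms(2)[of "cball 0 R"] by (simp add: integrable_restrict_space)
  moreover have "(\<lambda>x. indicator (cball 0 R) x *\<^sub>R f x) \<in> borel_measurable lborel"
    using assms(1) by (intro borel_measurable_scaleR borel_measurable_indicator) auto
  ultimately show ?thesis by (simp add: integrable_completion)
qed

lemma locally_integrable_lebesgue:
  fixes f :: "real^'n \<Rightarrow> 'b::euclidean_space"
  assumes "\<And>R. integrable lborel (\<lambda>x. indicator (cball 0 R) x *\<^sub>R f x)" and K: "compact K"
  shows "integrable (lebesgue_on K) f"
proof -
  obtain R where R: "K \<subseteq> cball 0 R"
    using compact_imp_bounded[OF K] unfolding bounded_iff by (auto simp: subset_iff)
  have Km: "K \<in> sets lebesgue" using K by (simp add: lmeasurable_compact fmeasurableD)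
  have "integrable lebesgue (\<lambda>x. indicator (cball 0 R) x *\<^sub>R f x)"
    using assms(1)[of R] by (simp add: integrable_completion borel_measurable_integrable)
  then have "integrable lebesgue (\<lambda>x. indicator K x *\<^sub>R (indicator (cball 0 R) x *\<^sub>R f x))"
    using Km by (rule integrable_mult_indicator[rotated])
  moreover have "(\<lambda>x. indicator K x *\<^sub>R (indicator (cball 0 R) x *\<^sub>R f x)) = (\<lambda>x. indicator K x *\<^sub>R f x)"
    using R by (auto simp: indicator_def fun_eq_iff)
  ultimately show ?thesis using Km by (simp add: integrable_restrict_space)
qed

text \<open>For t \<le> 1 the shift stays inside the ball enlarged by \<open>norm h\<close>, which
  gives a bound independent of t.\<close>

lemma nn_integral_shifted_ball_le:
  fixes w :: "real^'n \<Rightarrow> ennreal"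
  assumes [measurable]: "w \<in> borel_measurable borel" and t: "t \<in> {0<..1}"
  shows "(\<integral>\<^sup>+x. indicator (cball c R) x * w (x + t *\<^sub>R h) \<partial>lborel)
    \<le> (\<integral>\<^sup>+x. indicator (cball c (R + norm h)) x * w x \<partial>lborel)"
proof -
  have "norm (t *\<^sub>R h) \<le> norm h" using t by (simp add: mult_left_le_one_le)
  then have "x \<in> cball c R \<Longrightarrow> x + t *\<^sub>R h \<in> cball c (R + norm h)" for x
    using norm_triangle_ineq4[of "c - x" "t *\<^sub>R h"] by (simp add: dist_norm algebra_simps)
  then have "(\<integral>\<^sup>+x. indicator (cball c R) x * w (x + t *\<^sub>R h) \<partial>lborel)
      \<le> (\<integral>\<^sup>+x. indicator (cball c (R + norm h)) (x + t *\<^sub>R h) * w (x + t *\<^sub>R h) \<partial>lborel)"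
    by (intro nn_integral_mono) (auto simp: indicator_def)
  also have "\<dots> = (\<integral>\<^sup>+x. indicator (cball c (R + norm h)) x * w x \<partial>lborel)"
    by (rule nn_integral_lborel_shift[of "\<lambda>x. indicator (cball c (R + norm h)) x * w x"]) measurable
  finally show ?thesis .
qed

lemma nn_integral_I01_const [simp]: "(\<integral>\<^sup>+t. c \<partial>I01) = c"
  using emeasure_I01 by (simp only: nn_integral_const mult_1_right)

text \<open>Behind the estimate is the formula that U(x + h) - U(x) is the integral of
  \<open>G (x + t *\<^sub>R h) \<bullet> h\<close> over t, for almost every x. Its weak form follows
  by shifting the test function instead of U: the fundamental theorem of calculus for \<phi>,
  Fubini, and the definition of the weak gradient for each shifted \<phi>.\<close>

lemma weak_gradient_translation:
  fixes U :: "real^'n \<Rightarrow> real" and G :: "real^'n \<Rightarrow> real^'n"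
  assumes wg: "weak_gradient UNIV U G"
    and U[measurable]: "U \<in> borel_measurable borel" and G[measurable]: "G \<in> borel_measurable borel"
  shows "AE x in lborel. ennreal \<bar>U (x + h) - U x\<bar>
    \<le> ennreal (norm h) * (\<integral>\<^sup>+t. ennreal (norm (G (x + t *\<^sub>R h))) \<partial>I01)"
proof -
  have UG: "integrable lborel (\<lambda>x. indicator (cball 0 R) x *\<^sub>R U x)"
    "integrable lborel (\<lambda>x. indicator (cball 0 R) x *\<^sub>R G x)" for R
    using locally_integrable_lborel[OF U] locally_integrable_lborel[OF G]
      weak_gradient_integrable[OF wg] by blast+
  define V where "V x = (LINT t|I01. G (x + t *\<^sub>R h) \<bullet> h)" for x
  have Vm[measurable]: "V \<in> borel_measurable borel"
    unfolding V_def by measurable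
  \<comment> \<open>The cut-off to a ball makes the integrand integrable on the product space; this
    yields both local integrability of \<open>V\<close> and the later use of Fubini for
    \<open>P\<close>.\<close>
  define q where "q = (\<lambda>R (x, t). indicator (cball 0 R) x * (G (x + t *\<^sub>R h) \<bullet> h))"
  have q: "integrable (lborel \<Otimes>\<^sub>M I01) (q R)" for R
  proof (rule integrableI_bounded)
    show qm: "q R \<in> borel_measurable (lborel \<Otimes>\<^sub>M I01)" unfolding q_def by measurable
    have "(\<integral>\<^sup>+z. ennreal (norm (q R z)) \<partial>(lborel \<Otimes>\<^sub>M I01))
      = (\<integral>\<^sup>+t. \<integral>\<^sup>+x. ennreal (norm (q R (x, t))) \<partial>lborel \<partial>I01)"
      using qm by (subst lborel_I01.nn_integral_snd) auto
    also have "\<dots> \<le> (\<integral>\<^sup>+t. \<integral>\<^sup>+x. indicator (cball 0 R) x * ennreal (norm (G (x + t *\<^sub>R h)) * norm h) \<partial>lborel \<partial>I01)"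
      by (intro nn_integral_mono)
        (auto simp: q_def indicator_def intro!: ennreal_leI Cauchy_Schwarz_ineq2)
    also have "\<dots> \<le> (\<integral>\<^sup>+t. (\<integral>\<^sup>+x. indicator (cball 0 (R + norm h)) x * ennreal (norm (G x) * norm h) \<partial>lborel) \<partial>I01)"
      by (intro nn_integral_mono nn_integral_shifted_ball_le) (auto simp: space_restrict_space)
    also have "\<dots> = (\<integral>\<^sup>+x. ennreal (norm ((indicator (cball 0 (R + norm h)) x *\<^sub>R G x)) * norm h) \<partial>lborel)"
      unfolding nn_integral_I01_const by (auto intro!: nn_integral_cong simp: indicator_def)
    also have "\<dots> < \<infinity>"
      using integrable_mult_left[OF integrable_norm[OF UG(2)[of "R + norm h"]], of "norm h"]
      unfolding integrable_iff_bounded by (simp add: abs_mult)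
    finally show "(\<integral>\<^sup>+z. ennreal (norm (q R z)) \<partial>(lborel \<Otimes>\<^sub>M I01)) < \<infinity>" .
  qed
  have qV: "(LINT t|I01. q R (x, t)) = indicator (cball 0 R) x *\<^sub>R V x" for R x
    by (simp add: q_def V_def)
  define W where "W x = U (x + h) - U x - V x" for x
  have Wm[measurable]: "W \<in> borel_measurable borel" unfolding W_def by measurable
  have Uh: "integrable lborel (\<lambda>x. indicator (cball 0 R) x *\<^sub>R U (x + h))" for R
  proof -
    have "integrable lborel (\<lambda>x. indicator (cball 0 (R + norm h)) (x + h) *\<^sub>R U (x + h))"
      using UG(1)[of "R + norm h"] by (subst integral_lborel_shift(2)) auto
    then have "integrable lborel (\<lambda>x. indicator (cball 0 R) x *\<^sub>R (indicator (cball 0 (R + norm h)) (x + h) *\<^sub>R U (x + h)))"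
      by (rule integrable_mult_indicator[rotated]) simp
    moreover have "x \<in> cball 0 R \<Longrightarrow> x + h \<in> cball 0 (R + norm h)" for x
      using norm_triangle_ineq[of x h] by simp
    then have "(\<lambda>x. indicator (cball 0 R) x *\<^sub>R (indicator (cball 0 (R + norm h)) (x + h) *\<^sub>R U (x + h)))
      = (\<lambda>x. indicator (cball 0 R) x *\<^sub>R U (x + h))"
      by (auto simp: indicator_def fun_eq_iff)
    ultimately show ?thesis by simp
  qed
  have Vi: "integrable lborel (\<lambda>x. indicator (cball 0 R) x *\<^sub>R V x)" for R
    using lborel_I01.integrable_fst[of "\<lambda>x t. q R (x, t)"] q[of R] by (simp add: qV)
  have Wi: "integrable lborel (\<lambda>x. indicator (cball 0 R) x *\<^sub>R W x)" for R
    using Bochner_Integration.integrable_diff[OF Bochner_Integration.integrable_diff[OF Uh[of R] UG(1)[of R]] Vi[of R]]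
    by (simp add: W_def algebra_simps)
  have "AE x in lebesgue_on UNIV. W x = 0"
  proof (rule fundamental_lemma_calculus_of_variations)
    show "integrable (lebesgue_on K) W" if "compact K" for K
      using Wi that by (rule locally_integrable_lebesgue)
  next
    fix \<phi> :: "real^'n \<Rightarrow> real" assume \<phi>: "test_function UNIV \<phi>"
    have sm: "smooth \<phi>" using \<phi> by (simp add: test_function_def)
    have c\<phi>: "continuous_on UNIV \<phi>" and cg: "continuous_on UNIV (grad \<phi>)"
      using sm by (auto intro: smooth_continuous smooth_continuous_grad)
    have [measurable]: "\<phi> \<in> borel_measurable borel" "grad \<phi> \<in> borel_measurable borel"
      using c\<phi> cg by (auto intro: borel_measurable_continuous_onI)
    obtain R0 where R0: "closure {x. \<phi> x \<noteq> 0} \<subseteq> cball 0 R0"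
      using \<phi> compact_imp_bounded[of "closure {x. \<phi> x \<noteq> 0}"]
      unfolding test_function_def bounded_iff by (auto simp: subset_iff)
    have out: "\<phi> x = 0" "grad \<phi> x = 0" if "x \<notin> cball 0 R0" for x
    proof -
      have x: "x \<notin> closure {x. \<phi> x \<noteq> 0}" using that R0 by blast
      then show "grad \<phi> x = 0" by (rule grad_eq_0_outside)
      show "\<phi> x = 0" using x closure_subset[of "{x. \<phi> x \<noteq> 0}"] by auto
    qed
    \<comment> \<open>Shifting by \<open>t *\<^sub>R h\<close> with t \<le> 1 enlarges the support
      by at most \<open>norm h\<close>.\<close>
    define R where "R = R0 + norm h"
    have out': "grad \<phi> (x - t *\<^sub>R h) = 0" "\<phi> (x - t *\<^sub>R h) = 0" if "x \<notin> cball 0 R" "t \<in> {0..1}" for x t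
    proof -
      have "norm (t *\<^sub>R h) \<le> norm h" using that by (simp add: mult_left_le_one_le)
      then have "x - t *\<^sub>R h \<notin> cball 0 R0"
        using that(1) norm_triangle_ineq[of "x - t *\<^sub>R h" "t *\<^sub>R h"] by (simp add: R_def)
      then show "grad \<phi> (x - t *\<^sub>R h) = 0" "\<phi> (x - t *\<^sub>R h) = 0" by (auto intro: out)
    qed
    have bdd: "\<exists>B. \<forall>x. norm (f x) \<le> B" if cf: "continuous_on UNIV f" and f0: "\<And>x. x \<notin> cball 0 R0 \<Longrightarrow> f x = 0"
      for f :: "real^'n \<Rightarrow> 'z::real_normed_vector"
    proof -
      have "bounded (f ` cball 0 R0)"
        by (rule compact_imp_bounded[OF compact_continuous_image[OF continuous_on_subset[OF cf subset_UNIV] compact_cball]])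
      then obtain B where B: "\<forall>y\<in>f ` cball 0 R0. norm y \<le> B"
        unfolding bounded_iff by (rule exE)
      have "norm (f x) \<le> max B 0" for x
      proof (cases "x \<in> cball 0 R0")
        case True
        then have "norm (f x) \<le> B" by (intro B[rule_format] imageI)
        then show ?thesis by (simp add: le_max_iff_disj)
      next
        case False
        then show ?thesis using f0 by simp
      qed
      then show ?thesis by blast
    qed
    obtain B where B: "\<And>x. norm (grad \<phi> x) \<le> B" using bdd[OF cg out(2)] by blast
    obtain B' where B': "\<And>x. norm (\<phi> x) \<le> B'" using bdd[OF c\<phi> out(1)] by blast
    have ind: "\<phi> x = \<phi> x * indicator (cball 0 R0) x" for x using out(1)[of x] by (auto simp: indicator_def)
    have mult_i: "integrable lborel (\<lambda>x. \<phi> x * f x)"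
      if f: "integrable lborel (\<lambda>x. indicator (cball 0 R0) x *\<^sub>R f x)" for f :: "real^'n \<Rightarrow> real"
    proof -
      have "integrable lborel (\<lambda>x. \<phi> x * (indicator (cball 0 R0) x *\<^sub>R f x))"
        using B' borel_measurable_integrable[OF f]
        by (intro integrable_bounded_mult[OF f, where B = B'] borel_measurable_times)
          (auto simp: abs_mult intro!: mult_right_mono AE_I2)
      then show ?thesis using ind by (simp add: mult.assoc[symmetric])
    qed
    have FTC: "\<phi> (x - h) - \<phi> x = - (LINT t|I01. grad \<phi> (x - t *\<^sub>R h) \<bullet> h)" for x
    proof -
      have D: "((\<lambda>t. \<phi> (x - t *\<^sub>R h)) has_real_derivative - (grad \<phi> (x - t *\<^sub>R h) \<bullet> h)) (at t)" for t
      proof -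
        have "((\<lambda>t. x - t *\<^sub>R h) has_derivative (\<lambda>s. - (s *\<^sub>R h))) (at t)"
          by (auto intro!: derivative_eq_intros)
        then have "((\<lambda>t. \<phi> (x - t *\<^sub>R h)) has_derivative (\<lambda>s. (- (s *\<^sub>R h)) \<bullet> grad \<phi> (x - t *\<^sub>R h))) (at t)"
          using smooth_GDERIV[OF sm, of "x - t *\<^sub>R h"] unfolding gderiv_def by (rule has_derivative_compose)
        moreover have "(\<lambda>s. (- (s *\<^sub>R h)) \<bullet> grad \<phi> (x - t *\<^sub>R h)) = (*) (- (grad \<phi> (x - t *\<^sub>R h) \<bullet> h))"
          by (simp add: fun_eq_iff inner_commute[of h])
        ultimately show ?thesis by (simp only: has_field_derivative_def)
      qed
      have c: "continuous_on UNIV (\<lambda>t. - (grad \<phi> (x - t *\<^sub>R h) \<bullet> h))"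
        by (intro continuous_intros continuous_on_compose2[OF cg]) auto
      show ?thesis using integral_I01_FTC[OF D c] by simp
    qed
    define Q where "Q = (\<lambda>(x, t). (grad \<phi> (x - t *\<^sub>R h) \<bullet> h) * U x)"
    have Qi: "integrable (lborel \<Otimes>\<^sub>M I01) Q"
    proof (rule integrableI_bounded)
      show Qm: "Q \<in> borel_measurable (lborel \<Otimes>\<^sub>M I01)" unfolding Q_def by measurable
      have "(\<integral>\<^sup>+z. ennreal (norm (Q z)) \<partial>(lborel \<Otimes>\<^sub>M I01))
        = (\<integral>\<^sup>+t. \<integral>\<^sup>+x. ennreal (norm (Q (x, t))) \<partial>lborel \<partial>I01)"
        using Qm by (subst lborel_I01.nn_integral_snd) auto
      also have "\<dots> \<le> (\<integral>\<^sup>+t. \<integral>\<^sup>+x. ennreal (norm ((B * norm h) * (indicator (cball 0 R) x *\<^sub>R U x))) \<partial>lborel \<partial>I01)"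
      proof (intro nn_integral_mono ennreal_leI)
        fix t x assume "t \<in> space I01"
        then have t: "t \<in> {0..1}" by (auto simp: space_restrict_space)
        have "\<bar>grad \<phi> (x - t *\<^sub>R h) \<bullet> h\<bar> \<le> norm (grad \<phi> (x - t *\<^sub>R h)) * norm h" by (rule Cauchy_Schwarz_ineq2)
        also have "\<dots> \<le> B * norm h" by (intro mult_right_mono B) auto
        finally have "\<bar>grad \<phi> (x - t *\<^sub>R h) \<bullet> h\<bar> \<le> \<bar>B * norm h\<bar>" by linarith
        then show "norm (Q (x, t)) \<le> norm ((B * norm h) * (indicator (cball 0 R) x *\<^sub>R U x))"
          using out'[OF _ t, of x] by (cases "x \<in> cball 0 R") (auto simp: Q_def abs_mult intro!: mult_right_mono)
      qed
      also have "\<dots> = (\<integral>\<^sup>+x. ennreal (norm ((B * norm h) * (indicator (cball 0 R) x *\<^sub>R U x))) \<partial>lborel)" by (rule nn_integral_I01_const)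
      also have "\<dots> < \<infinity>"
        using integrable_mult_right[OF UG(1)[of R], of "B * norm h"] unfolding integrable_iff_bounded by simp
      finally show "(\<integral>\<^sup>+z. ennreal (norm (Q z)) \<partial>(lborel \<Otimes>\<^sub>M I01)) < \<infinity>" .
    qed
    \<comment> \<open>For fixed \<open>t\<close> the weak gradient is tested with \<phi> shifted by
      \<open>- (t *\<^sub>R h)\<close>; then the variable is shifted back.\<close>
    have inner: "(LINT x|lborel. Q (x, t)) = - (LINT x|lborel. \<phi> x * (G (x + t *\<^sub>R h) \<bullet> h))" for t
    proof -
      let ?\<psi> = "\<lambda>x. \<phi> (x + (- (t *\<^sub>R h)))"
      have \<psi>: "test_function UNIV ?\<psi>" and g\<psi>: "grad ?\<psi> x = grad \<phi> (x - t *\<^sub>R h)" for x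
        using test_function_translate[OF \<phi>, of "- (t *\<^sub>R h)"] by auto
      have i: "integrable lebesgue (\<lambda>x. U x *\<^sub>R grad ?\<psi> x)" "integrable lebesgue (\<lambda>x. ?\<psi> x *\<^sub>R G x)"
        using test_function_grad_integrable[OF \<psi>, of U] test_function_integrable[OF \<psi>, of G] wg
        by (auto simp: weak_gradient_def lebesgue_on_UNIV_eq)
      have e: "(LINT x|lebesgue. U x *\<^sub>R grad ?\<psi> x) = - (LINT x|lebesgue. ?\<psi> x *\<^sub>R G x)"
        using weak_gradient_eq[OF wg \<psi>] by (simp add: lebesgue_on_UNIV_eq)
      have "(LINT x|lborel. Q (x, t)) = (LINT x|lebesgue. (U x *\<^sub>R grad ?\<psi> x) \<bullet> h)"
        unfolding g\<psi>
        by (subst integral_completion) (auto simp: Q_def mult.commute intro!: Bochner_Integration.integral_cong)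
      also have "\<dots> = (LINT x|lebesgue. U x *\<^sub>R grad ?\<psi> x) \<bullet> h"
        using i(1) by (rule integral_inner_left)
      also have "\<dots> = - ((LINT x|lebesgue. ?\<psi> x *\<^sub>R G x) \<bullet> h)" using e by simp
      also have "(LINT x|lebesgue. ?\<psi> x *\<^sub>R G x) \<bullet> h = (LINT x|lebesgue. (?\<psi> x *\<^sub>R G x) \<bullet> h)"
        using i(2) by (rule integral_inner_left[symmetric])
      also have "\<dots> = (LINT x|lborel. (?\<psi> x *\<^sub>R G x) \<bullet> h)"
        by (rule integral_completion) simp
      also have "\<dots> = (LINT x|lborel. (?\<psi> (x + t *\<^sub>R h) *\<^sub>R G (x + t *\<^sub>R h)) \<bullet> h)"
        by (rule integral_lborel_shift(1)[symmetric]) simp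
      finally show ?thesis by simp
    qed
    define P where "P = (\<lambda>(x, t). \<phi> x * (G (x + t *\<^sub>R h) \<bullet> h))"
    have Pi: "integrable (lborel \<Otimes>\<^sub>M I01) P"
    proof -
      have "P = (\<lambda>z. \<phi> (fst z) * q R0 z)" using ind by (auto simp: P_def q_def fun_eq_iff mult.assoc[symmetric])
      moreover have "integrable (lborel \<Otimes>\<^sub>M I01) (\<lambda>z. \<phi> (fst z) * q R0 z)"
        using B' borel_measurable_integrable[OF q]
        by (intro integrable_bounded_mult[OF q[of R0], where B = B'] borel_measurable_times)
          (auto simp: abs_mult intro!: mult_right_mono AE_I2)
      ultimately show ?thesis by simp
    qed
    have U1: "integrable lborel (\<lambda>x. \<phi> x * U (x + h))" "integrable lborel (\<lambda>x. \<phi> x * U x)" "integrable lborel (\<lambda>x. \<phi> x * V x)"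
      using mult_i[OF Uh] mult_i[OF UG(1)] mult_i[OF Vi] by auto
    have Uh': "integrable lborel (\<lambda>x. \<phi> (x - h) * U x)"
      using U1(1) integral_lborel_shift(2)[of "\<lambda>x. \<phi> (x - h) * U x" h] by simp
    \<comment> \<open>The increment is moved onto \<phi>, written as an integral over the segment,
      integrated by parts for fixed \<open>t\<close> between two exchanges of integrals, and thus
      becomes the pairing of \<phi> with \<open>V\<close>.\<close>
    have "(LINT x|lborel. \<phi> x * U (x + h)) = (LINT x|lborel. \<phi> (x - h) * U x)"
      using integral_lborel_shift(1)[of "\<lambda>x. \<phi> (x - h) * U x" h] by simp
    then have "(LINT x|lborel. \<phi> x * U (x + h)) - (LINT x|lborel. \<phi> x * U x) = (LINT x|lborel. (\<phi> (x - h) - \<phi> x) * U x)"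
      using U1(2) Uh' by (simp add: left_diff_distrib)
    also have "\<dots> = (LINT x|lborel. - (LINT t|I01. Q (x, t)))"
      unfolding FTC by (simp add: Q_def)
    also have "\<dots> = - (LINT t|I01. LINT x|lborel. Q (x, t))"
      using lborel_I01.Fubini_integral[of "\<lambda>x t. Q (x, t)"] Qi by simp
    also have "\<dots> = (LINT t|I01. LINT x|lborel. P (x, t))"
      unfolding inner by (simp add: P_def)
    also have "\<dots> = (LINT x|lborel. LINT t|I01. P (x, t))"
      using lborel_I01.Fubini_integral[of "\<lambda>x t. P (x, t)"] Pi by simp
    also have "\<dots> = (LINT x|lborel. \<phi> x * V x)" by (simp add: P_def V_def)
    finally have "(LINT x|lborel. \<phi> x * W x) = 0"
      using U1 unfolding W_def by (simp add: right_diff_distrib)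
    then show "(LINT x|lebesgue_on UNIV. \<phi> x * W x) = 0"
      by (simp add: lebesgue_on_UNIV_eq integral_completion)
  qed auto
  then have W0: "AE x in lborel. W x = 0" unfolding lebesgue_on_UNIV_eq AE_completion_iff .
  have V_le: "ennreal \<bar>V x\<bar> \<le> ennreal (norm h) * (\<integral>\<^sup>+t. ennreal (norm (G (x + t *\<^sub>R h))) \<partial>I01)" for x
  proof (cases "integrable I01 (\<lambda>t. G (x + t *\<^sub>R h) \<bullet> h)")
    case True
    have "ennreal \<bar>V x\<bar> \<le> (\<integral>\<^sup>+t. ennreal (norm (G (x + t *\<^sub>R h) \<bullet> h)) \<partial>I01)"
      using integral_norm_bound_ennreal[OF True] by (simp add: V_def)
    also have "\<dots> \<le> (\<integral>\<^sup>+t. ennreal (norm h) * ennreal (norm (G (x + t *\<^sub>R h))) \<partial>I01)"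
    proof (rule nn_integral_mono)
      fix t
      show "ennreal (norm (G (x + t *\<^sub>R h) \<bullet> h)) \<le> ennreal (norm h) * ennreal (norm (G (x + t *\<^sub>R h)))"
        using Cauchy_Schwarz_ineq2[of "G (x + t *\<^sub>R h)" h]
        by (simp only: ennreal_mult[symmetric] norm_ge_zero ennreal_leI real_norm_def mult.commute[of "norm h"])
    qed
    also have "\<dots> = ennreal (norm h) * (\<integral>\<^sup>+t. ennreal (norm (G (x + t *\<^sub>R h))) \<partial>I01)"
      by (intro nn_integral_cmult) measurable
    finally show ?thesis .
  next
    \<comment> \<open>A non-integrable integrand gives \<open>V x\<close> the default value
      0.\<close>
    case False
    then show ?thesis by (simp add: V_def not_integrable_integral_eq)
  qed
  from W0 show ?thesis
  proof eventually_elim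
    case (elim x)
    then have "\<bar>U (x + h) - U x\<bar> = \<bar>V x\<bar>" by (simp add: W_def)
    then show ?case using V_le[of x] by simp
  qed
qed

section \<open>Averages over balls\<close>

abbreviation ballm :: "real \<Rightarrow> (real^'n) measure" where
  "ballm \<epsilon> \<equiv> restrict_space lborel (cball 0 \<epsilon>)"

definition avg :: "real \<Rightarrow> (real^'n \<Rightarrow> real) \<Rightarrow> real^'n \<Rightarrow> real" where
  "avg \<epsilon> U x = (LINT z|ballm \<epsilon>. U (x + z)) / measure lborel (cball (0 :: real^'n) \<epsilon>)"

lemma finite_measure_ballm: "finite_measure (ballm \<epsilon> :: (real^'n) measure)"
  using emeasure_lborel_cball_finite[of "0 :: real^'n" \<epsilon>]
  by (intro finite_measureI) (auto simp: space_restrict_space emeasure_restrict_space)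

lemma emeasure_ballm: "emeasure (ballm \<epsilon> :: (real^'n) measure) (space (ballm \<epsilon>)) = ennreal (measure lborel (cball (0 :: real^'n) \<epsilon>))"
proof -
  have "emeasure (ballm \<epsilon> :: (real^'n) measure) (space (ballm \<epsilon>)) = emeasure lborel (cball (0 :: real^'n) \<epsilon>)"
    by (simp add: space_restrict_space emeasure_restrict_space)
  also have "\<dots> = ennreal (measure lborel (cball (0 :: real^'n) \<epsilon>))"
    using emeasure_lborel_cball_finite[of "0 :: real^'n" \<epsilon>]
    by (intro emeasure_eq_ennreal_measure) (simp add: less_top)
  finally show ?thesis .
qed

lemma nn_integral_ballm_const: "(\<integral>\<^sup>+z. c \<partial>(ballm \<epsilon> :: (real^'n) measure)) = c * ennreal (measure lborel (cball (0 :: real^'n) \<epsilon>))"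
  by (simp only: nn_integral_const emeasure_ballm)

lemma measurable_id_ballm [measurable]: "(\<lambda>t. t) \<in> borel_measurable (ballm \<epsilon>)"
  by (rule measurable_restrict_space1) simp

lemma measurable_fst_ballm [measurable]: "fst \<in> borel_measurable (ballm \<epsilon> \<Otimes>\<^sub>M M)"
  by (rule measurable_compose[OF measurable_fst measurable_id_ballm])

lemma measurable_snd_ballm [measurable]: "snd \<in> borel_measurable (M \<Otimes>\<^sub>M ballm \<epsilon>)"
  by (rule measurable_compose[OF measurable_snd measurable_id_ballm])

lemma integrable_ballm_shift:
  fixes U :: "real^'n \<Rightarrow> real"
  assumes U: "U \<in> borel_measurable borel" "\<And>R. integrable lborel (\<lambda>x. indicator (cball 0 R) x *\<^sub>R U x)"
  shows "integrable (ballm \<epsilon>) (\<lambda>z. U (x + z))"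
    "(LINT z|ballm \<epsilon>. U (x + z)) = (LINT y|lborel. indicator (cball x \<epsilon>) y * U y)"
proof -
  have [measurable]: "U \<in> borel_measurable borel" by fact
  have sub: "cball x \<epsilon> \<subseteq> cball 0 (norm x + \<epsilon>)"
    by (simp add: cball_subset_cball_iff)
  have "integrable lborel (\<lambda>y. indicator (cball x \<epsilon>) y *\<^sub>R (indicator (cball 0 (norm x + \<epsilon>)) y *\<^sub>R U y))"
    using U(2) by (rule integrable_mult_indicator[rotated]) simp
  moreover have "(\<lambda>y. indicator (cball x \<epsilon>) y *\<^sub>R (indicator (cball 0 (norm x + \<epsilon>)) y *\<^sub>R U y))
      = (\<lambda>y. indicator (cball x \<epsilon>) y * U y)"
    using sub by (auto simp: indicator_def fun_eq_iff)
  ultimately have i: "integrable lborel (\<lambda>y. indicator (cball x \<epsilon>) y * U y)" by simp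
  have e: "(\<lambda>z. indicator (cball x \<epsilon>) (z + x) * U (z + x)) = (\<lambda>z. indicator (cball 0 \<epsilon>) z *\<^sub>R U (x + z))"
    by (auto simp: indicator_def fun_eq_iff dist_norm add.commute)
  show "integrable (ballm \<epsilon>) (\<lambda>z. U (x + z))"
    using i integral_lborel_shift(2)[of "\<lambda>y. indicator (cball x \<epsilon>) y * U y" x]
    by (simp add: e integrable_restrict_space)
  show "(LINT z|ballm \<epsilon>. U (x + z)) = (LINT y|lborel. indicator (cball x \<epsilon>) y * U y)"
    using integral_lborel_shift(1)[of "\<lambda>y. indicator (cball x \<epsilon>) y * U y" x]
    by (simp add: e integral_restrict_space)
qed

text \<open>With y = t z this is the convolution of g with a kernel on the ball of radius \<epsilon>
  that, for n \<ge> 2, behaves like |y|^(1-n) at the origin. The double integral avoids polar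
  coordinates, and \<open>ennreal\<close> values postpone the question of finiteness.\<close>

definition ray_average :: "real \<Rightarrow> (real^'n \<Rightarrow> real) \<Rightarrow> real^'n \<Rightarrow> ennreal" where
  "ray_average \<epsilon> g x = (\<integral>\<^sup>+z. \<integral>\<^sup>+t. ennreal (g (x + t *\<^sub>R z)) \<partial>I01 \<partial>ballm \<epsilon>)"

text \<open>The translation estimate with h = z, averaged over the ball;
  \<open>norm z \<le> \<epsilon>\<close> produces the factor \<epsilon>.\<close>

lemma avg_error_le:
  fixes U :: "real^'n \<Rightarrow> real" and G :: "real^'n \<Rightarrow> real^'n"
  assumes wg: "weak_gradient UNIV U G"
    and U[measurable]: "U \<in> borel_measurable borel" and G[measurable]: "G \<in> borel_measurable borel"
    and \<epsilon>: "\<epsilon> > 0"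
  shows "AE x in lborel. ennreal \<bar>U x - avg \<epsilon> U x\<bar>
    \<le> ennreal (\<epsilon> / measure lborel (cball (0 :: real^'n) \<epsilon>)) * ray_average \<epsilon> (\<lambda>x. norm (G x)) x"
proof -
  interpret B: finite_measure "ballm \<epsilon> :: (real^'n) measure" by (rule finite_measure_ballm)
  interpret lborel_B: pair_sigma_finite lborel "ballm \<epsilon> :: (real^'n) measure" ..
  have Ui: "integrable lborel (\<lambda>x. indicator (cball 0 R) x *\<^sub>R U x)" for R
    using locally_integrable_lborel[OF U] weak_gradient_integrable(1)[OF wg] by blast
  define v where "v = measure lborel (cball (0 :: real^'n) \<epsilon>)"
  have v: "v > 0" unfolding v_def using \<epsilon> by (simp add: content_cball_pos)
  let ?P = "\<lambda>x z. ennreal \<bar>U (x + z) - U x\<bar> \<le> ennreal (norm z) * (\<integral>\<^sup>+t. ennreal (norm (G (x + t *\<^sub>R z))) \<partial>I01)"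
  have "AE z in ballm \<epsilon>. AE x in lborel. ?P x z"
    using weak_gradient_translation[OF wg U G] by simp
  \<comment> \<open>The translation estimate has an exceptional null set of \<open>x\<close> for
    each \<open>z\<close>. Measurability on the product is what allows the order to be exchanged:
    for almost every \<open>x\<close> the estimate holds for almost every \<open>z\<close>.\<close>
  moreover have "{w \<in> space (lborel \<Otimes>\<^sub>M ballm \<epsilon>). ?P (fst w) (snd w)} \<in> sets (lborel \<Otimes>\<^sub>M ballm \<epsilon>)"
    by measurable
  ultimately have "AE x in lborel. AE z in ballm \<epsilon>. ?P x z"
    by (subst lborel_B.AE_commute)
  then show ?thesis
  proof eventually_elim
    case (elim x)
    have i: "integrable (ballm \<epsilon>) (\<lambda>z. U (x + z))" by (rule integrable_ballm_shift[OF U Ui])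
    have m: "measure (ballm \<epsilon> :: (real^'n) measure) (space (ballm \<epsilon>)) = v"
      unfolding v_def measure_def[of "ballm \<epsilon>"] emeasure_ballm by simp
    have "(LINT z|ballm \<epsilon>. U (x + z) - U x) = (LINT z|ballm \<epsilon>. U (x + z)) - v * U x"
      using i m by (subst Bochner_Integration.integral_diff) auto
    then have e: "avg \<epsilon> U x - U x = (LINT z|ballm \<epsilon>. U (x + z) - U x) / v"
      using v by (simp add: avg_def v_def[symmetric] field_simps)
    have "ennreal \<bar>LINT z|ballm \<epsilon>. U (x + z) - U x\<bar> \<le> (\<integral>\<^sup>+z. ennreal (norm (U (x + z) - U x)) \<partial>ballm \<epsilon>)"
      using integral_norm_bound_ennreal[of "ballm \<epsilon>" "\<lambda>z. U (x + z) - U x"] i by auto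
    also have "\<dots> \<le> (\<integral>\<^sup>+z. ennreal \<epsilon> * (\<integral>\<^sup>+t. ennreal (norm (G (x + t *\<^sub>R z))) \<partial>I01) \<partial>ballm \<epsilon>)"
    proof (rule nn_integral_mono_AE)
      show "AE z in ballm \<epsilon>. ennreal (norm (U (x + z) - U x)) \<le> ennreal \<epsilon> * (\<integral>\<^sup>+t. ennreal (norm (G (x + t *\<^sub>R z))) \<partial>I01)"
        using elim AE_space
      proof eventually_elim
        case (elim z)
        then have "norm z \<le> \<epsilon>" by (simp add: space_restrict_space)
        then have "ennreal (norm z) * (\<integral>\<^sup>+t. ennreal (norm (G (x + t *\<^sub>R z))) \<partial>I01)
          \<le> ennreal \<epsilon> * (\<integral>\<^sup>+t. ennreal (norm (G (x + t *\<^sub>R z))) \<partial>I01)"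
          by (intro mult_right_mono ennreal_leI) auto
        then show ?case using elim(1) by simp
      qed
    qed
    also have "\<dots> = ennreal \<epsilon> * ray_average \<epsilon> (\<lambda>x. norm (G x)) x"
      unfolding ray_average_def by (intro nn_integral_cmult) measurable
    finally have *: "ennreal \<bar>LINT z|ballm \<epsilon>. U (x + z) - U x\<bar> \<le> ennreal \<epsilon> * ray_average \<epsilon> (\<lambda>x. norm (G x)) x" .
    have "ennreal \<bar>U x - avg \<epsilon> U x\<bar> = ennreal (1 / v) * ennreal \<bar>LINT z|ballm \<epsilon>. U (x + z) - U x\<bar>"
      using e v by (subst abs_minus_commute) (simp add: ennreal_mult[symmetric])
    also have "\<dots> \<le> ennreal (1 / v) * (ennreal \<epsilon> * ray_average \<epsilon> (\<lambda>x. norm (G x)) x)"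
      by (intro mult_left_mono *) auto
    also have "\<dots> = ennreal (\<epsilon> / v) * ray_average \<epsilon> (\<lambda>x. norm (G x)) x"
      using v \<epsilon> by (simp add: mult.assoc[symmetric] ennreal_mult[symmetric])
    finally show ?case by (simp add: v_def)
  qed
qed

section \<open>The potential estimate from \<open>L^\<sigma>\<close> to \<open>L^s\<close>\<close>

lemma am_gm_3:
  fixes a b c w \<beta> :: real
  assumes "a \<ge> 0" "b \<ge> 0" "c \<ge> 0" "w \<ge> 0" "\<beta> \<ge> 0" "w + 2 * \<beta> = 1"
  shows "a powr w * (b powr \<beta> * c powr \<beta>) \<le> w * a + \<beta> * b + \<beta> * c"
proof (cases "a = 0 \<or> b = 0 \<or> c = 0")
  case True
  then show ?thesis using assms by auto
next
  case False
  then have pos: "a > 0" "b > 0" "c > 0" using assms by auto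
  \<comment> \<open>Equal weights on \<open>b\<close> and \<open>c\<close> allow
    \<open>b * c \<le> m ^ 2\<close>, which reduces three factors to two.\<close>
  define m where "m = (b + c) / 2"
  have m: "m > 0" using pos by (simp add: m_def)
  have "b * c \<le> m ^ 2"
    using zero_le_power2[of "b - c"] by (simp add: m_def power2_eq_square field_simps)
  then have "(b * c) powr \<beta> \<le> (m ^ 2) powr \<beta>"
    using pos assms by (intro powr_mono2) auto
  also have "\<dots> = m powr (2 * \<beta>)" using m by (simp add: powr_powr powr_numeral[symmetric] del: powr_numeral)
  finally have "a powr w * (b powr \<beta> * c powr \<beta>) \<le> a powr w * m powr (2 * \<beta>)"
    by (intro mult_left_mono) (auto simp: powr_mult)
  also have "\<dots> \<le> w * a + (2 * \<beta>) * m"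
    using pos m assms by (intro Youngs_inequality_0) auto
  also have "(2 * \<beta>) * m = \<beta> * b + \<beta> * c" by (simp add: m_def distrib_left)
  finally show ?thesis by simp
qed

lemma nn_integral_I01_powr:
  assumes "\<theta> < 1"
  shows "(\<integral>\<^sup>+t. ennreal (t powr (- \<theta>)) \<partial>I01) = ennreal (1 / (1 - \<theta>))"
proof -
  have "((\<lambda>t. t powr (- \<theta>)) has_integral (1 powr (- \<theta> + 1) / (- \<theta> + 1))) {0..1}"
    using assms by (intro has_integral_powr_from_0) auto
  then have "((\<lambda>t. if t \<in> {0..1} then t powr (- \<theta>) else 0) has_integral (1 / (1 - \<theta>))) UNIV"
    by (subst has_integral_restrict_UNIV) simp
  moreover have "(\<lambda>t. if t \<in> {0..1} then t powr (- \<theta>) else 0) = (\<lambda>t. indicator {0<..1} t * t powr (- \<theta>))"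
    by (auto simp: indicator_def fun_eq_iff)
  ultimately have "((\<lambda>t. indicator {0<..1} t * t powr (- \<theta>)) has_integral (1 / (1 - \<theta>))) UNIV" by simp
  then have "(\<integral>\<^sup>+t. ennreal (indicator {0<..1} t * t powr (- \<theta>)) \<partial>lborel) = ennreal (1 / (1 - \<theta>))"
    by (intro nn_integral_has_integral_lborel) (auto simp: indicator_def)
  moreover have "(\<integral>\<^sup>+t. ennreal (t powr (- \<theta>)) \<partial>I01) = (\<integral>\<^sup>+t. ennreal (indicator {0<..1} t * t powr (- \<theta>)) \<partial>lborel)"
    by (subst nn_integral_restrict_space) (auto intro!: nn_integral_cong simp: indicator_def)
  ultimately show ?thesis by simp
qed

text \<open>The Jacobian t^(-n) cancels the t^n in the second factor of the three-fold factorisation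
  below.\<close>

lemma nn_integral_lborel_scale:
  fixes f :: "real^'n \<Rightarrow> ennreal"
  assumes [measurable]: "f \<in> borel_measurable borel" and t: "t > 0"
  shows "(\<integral>\<^sup>+z. f (x + t *\<^sub>R z) \<partial>lborel) = ennreal (t powr - real CARD('n)) * (\<integral>\<^sup>+z. f z \<partial>lborel)"
proof -
  have "(\<integral>\<^sup>+z. f z \<partial>lborel) = (\<integral>\<^sup>+z. f z \<partial>density (distr lborel borel (\<lambda>z. x + t *\<^sub>R z)) (\<lambda>_. \<bar>t\<bar> ^ DIM(real^'n)))"
    using t by (subst lborel_affine[of t x]) auto
  also have "\<dots> = ennreal (t ^ CARD('n)) * (\<integral>\<^sup>+z. f (x + t *\<^sub>R z) \<partial>lborel)"
    using t by (simp add: nn_integral_density nn_integral_distr nn_integral_cmult ennreal_power)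
  finally have "ennreal (t powr - real CARD('n)) * (\<integral>\<^sup>+z. f z \<partial>lborel)
    = ennreal (t powr - real CARD('n)) * ennreal (t ^ CARD('n)) * (\<integral>\<^sup>+z. f (x + t *\<^sub>R z) \<partial>lborel)"
    by (simp add: mult.assoc)
  also have "ennreal (t powr - real CARD('n)) * ennreal (t ^ CARD('n)) = 1"
    using t by (simp add: ennreal_mult[symmetric] powr_minus powr_realpow)
  finally show ?thesis by simp
qed

lemma nn_integral_lincomb3:
  assumes "f \<in> borel_measurable M" "g \<in> borel_measurable M" "h \<in> borel_measurable M"
  shows "(\<integral>\<^sup>+x. a * f x + (b * g x + c * h x) \<partial>M)
    = a * (\<integral>\<^sup>+x. f x \<partial>M) + (b * (\<integral>\<^sup>+x. g x \<partial>M) + c * (\<integral>\<^sup>+x. h x \<partial>M))"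
  using assms by (simp add: nn_integral_add nn_integral_cmult)

text \<open>A three-fold Hoelder inequality with the factorisation
  \<open>g = (g\<^sup>\<sigma> t\<^sup>-\<^sup>\<theta>)\<^sup>w (g\<^sup>\<sigma> t\<^sup>n\<^sup>-\<^sup>\<theta>)\<^sup>\<beta> (t\<^sup>-\<^sup>\<theta>)\<^sup>\<beta>\<close>, arranged so that all three factors are integrable exactly
  when \<open>\<theta> < 1\<close>, that is, \<open>\<sigma> < n / (n - 1)\<close>.\<close>

lemma ray_average_powr_le:
  fixes g :: "real^'n \<Rightarrow> real" and \<sigma> \<epsilon> N :: real
  defines "\<theta> \<equiv> real CARD('n) * (\<sigma> - 1) / \<sigma>" and "\<beta> \<equiv> (\<sigma> - 1) / \<sigma>" and "s \<equiv> \<sigma> / (2 - \<sigma>)"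
    and "v \<equiv> measure lborel (cball (0 :: real^'n) \<epsilon>)"
  assumes g[measurable]: "g \<in> borel_measurable borel" and g0: "\<And>x. g x \<ge> 0"
    and \<sigma>: "1 < \<sigma>" "\<sigma> < 2" and \<theta>: "\<theta> < 1" and \<epsilon>: "\<epsilon> > 0"
    and N: "(\<integral>\<^sup>+x. ennreal (g x powr \<sigma>) \<partial>lborel) \<le> ennreal N" "N \<ge> 0"
  shows "AE x in lborel. ray_average \<epsilon> g x < \<infinity>"
    "(\<integral>\<^sup>+x. ennreal (enn2real (ray_average \<epsilon> g x) powr s) \<partial>lborel)
      \<le> ennreal (((N + 1) / (1 - \<theta>) * (v / (1 - \<theta>))) powr (\<beta> * s) * (N * (v / (1 - \<theta>))))"
proof -
  interpret B: finite_measure "ballm \<epsilon> :: (real^'n) measure" by (rule finite_measure_ballm)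
  interpret BI: pair_sigma_finite "ballm \<epsilon> :: (real^'n) measure" I01 ..
  interpret LB: pair_sigma_finite lborel "ballm \<epsilon> :: (real^'n) measure" ..
  define n where "n = real CARD('n)"
  \<comment> \<open>The Hoelder weights are \<open>w\<close>, \<open>\<beta>\<close>,
    \<open>\<beta>\<close>; since \<open>w = 1 / s\<close>, the s-th power of the resulting bound is
    linear in \<open>X\<close>.\<close>
  define w where "w = 1 / s"
  have v: "v > 0" unfolding v_def using \<epsilon> by (simp add: content_cball_pos)
  have s: "s > 0" using \<sigma> by (simp add: s_def)
  have w: "w > 0" "w + 2 * \<beta> = 1" and \<beta>: "\<beta> > 0"
    using \<sigma> by (auto simp: w_def s_def \<beta>_def field_simps)
  \<comment> \<open>\<open>N + 1\<close> instead of \<open>N\<close> keeps \<open>y\<close>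
    positive, as \<open>y\<close> will be a divisor.\<close>
  define y where "y = (N + 1) / (1 - \<theta>)"
  define z0 where "z0 = v / (1 - \<theta>)"
  have y: "y > 0" and z0: "z0 > 0" using N(2) v \<theta> by (auto simp: y_def z0_def)
  define K where "K = (y * z0) powr \<beta>"
  have K: "K > 0" using y z0 by (simp add: K_def)
  define X where "X x = (\<integral>\<^sup>+z. \<integral>\<^sup>+t. ennreal (g (x + t *\<^sub>R z) powr \<sigma> * t powr (- \<theta>)) \<partial>I01 \<partial>ballm \<epsilon>)" for x
  define Y where "Y x = (\<integral>\<^sup>+z. \<integral>\<^sup>+t. ennreal (g (x + t *\<^sub>R z) powr \<sigma> * t powr (n - \<theta>)) \<partial>I01 \<partial>ballm \<epsilon>)" for x
  define Z where "Z = (\<integral>\<^sup>+z. \<integral>\<^sup>+t. ennreal (t powr (- \<theta>)) \<partial>I01 \<partial>(ballm \<epsilon> :: (real^'n) measure))"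
  have Z: "Z = ennreal z0"
    unfolding Z_def nn_integral_I01_powr[OF \<theta>] nn_integral_ballm_const
    using v \<theta> by (simp add: z0_def v_def[symmetric] ennreal_mult[symmetric] mult.commute)
  have [measurable]: "X \<in> borel_measurable borel" unfolding X_def by measurable
  \<comment> \<open>Uniform in \<open>x\<close>: once the ball is enlarged to the whole space,
    substitution contributes t^(-n) and leaves the integrable power t^(-\<theta>).\<close>
  have Y: "Y x \<le> ennreal y" for x
  proof -
    have "Y x = (\<integral>\<^sup>+t. \<integral>\<^sup>+z. ennreal (g (x + t *\<^sub>R z) powr \<sigma> * t powr (n - \<theta>)) \<partial>ballm \<epsilon> \<partial>I01)"
      unfolding Y_def by (rule BI.Fubini'[symmetric]) measurable
    also have "\<dots> \<le> (\<integral>\<^sup>+t. \<integral>\<^sup>+z. ennreal (g (x + t *\<^sub>R z) powr \<sigma> * t powr (n - \<theta>)) \<partial>lborel \<partial>I01)"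
      by (intro nn_integral_mono) (auto simp: nn_integral_restrict_space indicator_def intro!: nn_integral_mono)
    also have "\<dots> = (\<integral>\<^sup>+t. ennreal (t powr (- \<theta>)) * (\<integral>\<^sup>+z. ennreal (g z powr \<sigma>) \<partial>lborel) \<partial>I01)"
    proof (rule nn_integral_cong)
      fix t assume "t \<in> space I01"
      then have t: "t > 0" by (auto simp: space_restrict_space)
      have "(\<integral>\<^sup>+z. ennreal (g (x + t *\<^sub>R z) powr \<sigma> * t powr (n - \<theta>)) \<partial>lborel)
        = ennreal (t powr (- n)) * (\<integral>\<^sup>+z. ennreal (g z powr \<sigma> * t powr (n - \<theta>)) \<partial>lborel)"
        unfolding n_def by (rule nn_integral_lborel_scale[where f = "\<lambda>z. ennreal (g z powr \<sigma> * t powr (real CARD('n) - \<theta>))"]) (use t in auto)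
      also have "\<dots> = ennreal (t powr (- n)) * (ennreal (t powr (n - \<theta>)) * (\<integral>\<^sup>+z. ennreal (g z powr \<sigma>) \<partial>lborel))"
        by (subst nn_integral_cmult[symmetric]) (auto simp: ennreal_mult[symmetric] mult.commute)
      also have "\<dots> = ennreal (t powr (- \<theta>)) * (\<integral>\<^sup>+z. ennreal (g z powr \<sigma>) \<partial>lborel)"
        by (simp add: mult.assoc[symmetric] ennreal_mult[symmetric] powr_add[symmetric])
      finally show "(\<integral>\<^sup>+z. ennreal (g (x + t *\<^sub>R z) powr \<sigma> * t powr (n - \<theta>)) \<partial>lborel)
        = ennreal (t powr (- \<theta>)) * (\<integral>\<^sup>+z. ennreal (g z powr \<sigma>) \<partial>lborel)" .
    qed
    also have "\<dots> = ennreal (1 / (1 - \<theta>)) * (\<integral>\<^sup>+z. ennreal (g z powr \<sigma>) \<partial>lborel)"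
      by (subst nn_integral_multc) (auto simp: nn_integral_I01_powr[OF \<theta>])
    also have "\<dots> \<le> ennreal (1 / (1 - \<theta>)) * ennreal N" by (intro mult_left_mono N) auto
    also have "\<dots> \<le> ennreal y"
      using N(2) \<theta> by (simp add: y_def ennreal_mult[symmetric] divide_right_mono ennreal_leI)
    finally show ?thesis .
  qed
  \<comment> \<open>The arithmetic-geometric mean inequality for factors normalised by
    \<open>x0\<close>, \<open>y\<close>, \<open>z0\<close>, which bound their integrals. Integrating
    it gives Hoelder's bound, because the weights sum to 1.\<close>
  have ptw: "g (x + t *\<^sub>R z) \<le> K * x0 powr w * (w * (g (x + t *\<^sub>R z) powr \<sigma> * t powr (- \<theta>)) / x0
      + \<beta> * (g (x + t *\<^sub>R z) powr \<sigma> * t powr (n - \<theta>)) / y + \<beta> * t powr (- \<theta>) / z0)"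
    if x0: "x0 > 0" and t: "t > 0" for x0 t x z
  proof -
    define h where "h = g (x + t *\<^sub>R z)"
    have h0: "h \<ge> 0" using g0 by (simp add: h_def)
    have e1: "\<sigma> * w + \<sigma> * \<beta> = 1" using \<sigma> by (simp add: w_def s_def \<beta>_def field_simps)
    \<comment> \<open>All powers of \<open>t\<close> cancel because \<theta> is n times
      \<beta>.\<close>
    have e2: "- \<theta> * w + (n - \<theta>) * \<beta> + - \<theta> * \<beta> = 0"
    proof -
      have "- \<theta> * w + (n - \<theta>) * \<beta> + - \<theta> * \<beta> = n * \<beta> - \<theta> * (w + 2 * \<beta>)" by (simp add: algebra_simps)
      also have "\<dots> = 0" using w(2) by (simp add: \<theta>_def \<beta>_def n_def)
      finally show ?thesis .
    qed
    have "h = (h powr \<sigma> * t powr (- \<theta>)) powr w * ((h powr \<sigma> * t powr (n - \<theta>)) powr \<beta> * (t powr (- \<theta>)) powr \<beta>)"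
    proof -
      have "(h powr \<sigma> * t powr (- \<theta>)) powr w * ((h powr \<sigma> * t powr (n - \<theta>)) powr \<beta> * (t powr (- \<theta>)) powr \<beta>)
        = (h powr (\<sigma> * w) * h powr (\<sigma> * \<beta>)) * (t powr (- \<theta> * w) * t powr ((n - \<theta>) * \<beta>) * t powr (- \<theta> * \<beta>))"
        by (simp add: powr_mult powr_powr mult_ac)
      also have "\<dots> = h powr (\<sigma> * w + \<sigma> * \<beta>) * t powr (- \<theta> * w + (n - \<theta>) * \<beta> + - \<theta> * \<beta>)"
        by (simp only: powr_add)
      finally show ?thesis using h0 t unfolding e1 e2 by simp
    qed
    also have "\<dots> = K * x0 powr w * ((h powr \<sigma> * t powr (- \<theta>) / x0) powr w
        * ((h powr \<sigma> * t powr (n - \<theta>) / y) powr \<beta> * (t powr (- \<theta>) / z0) powr \<beta>))"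
      using x0 y z0 by (simp add: K_def powr_mult powr_divide field_simps)
    also have "\<dots> \<le> K * x0 powr w * (w * (h powr \<sigma> * t powr (- \<theta>) / x0)
        + \<beta> * (h powr \<sigma> * t powr (n - \<theta>) / y) + \<beta> * (t powr (- \<theta>) / z0))"
      using K x0 y z0 w \<beta> by (intro mult_left_mono am_gm_3) auto
    finally show ?thesis by (simp add: h_def)
  qed
  have J: "ray_average \<epsilon> g x \<le> ennreal (K * x0 powr w)" if x0: "x0 > 0" and Xx: "X x \<le> ennreal x0" for x x0
  proof -
    let ?c = "K * x0 powr w"
    have c: "?c > 0" using K x0 by simp
    have F1: "(\<lambda>t. ennreal (g (x + t *\<^sub>R z) powr \<sigma> * t powr (- \<theta>))) \<in> borel_measurable I01"
      and F2: "(\<lambda>t. ennreal (g (x + t *\<^sub>R z) powr \<sigma> * t powr (n - \<theta>))) \<in> borel_measurable I01"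
      and F3: "(\<lambda>t. ennreal (t powr (- \<theta>))) \<in> borel_measurable I01" for z
      by measurable
    have F4: "(\<lambda>z. \<integral>\<^sup>+t. ennreal (g (x + t *\<^sub>R z) powr \<sigma> * t powr (- \<theta>)) \<partial>I01) \<in> borel_measurable (ballm \<epsilon>)"
      and F5: "(\<lambda>z. \<integral>\<^sup>+t. ennreal (g (x + t *\<^sub>R z) powr \<sigma> * t powr (n - \<theta>)) \<partial>I01) \<in> borel_measurable (ballm \<epsilon>)"
      and F6: "(\<lambda>z :: real^'n. \<integral>\<^sup>+t. ennreal (t powr (- \<theta>)) \<partial>I01) \<in> borel_measurable (ballm \<epsilon>)"
      by measurable
    have "ray_average \<epsilon> g x \<le> (\<integral>\<^sup>+z. \<integral>\<^sup>+t. ennreal (?c * w / x0) * ennreal (g (x + t *\<^sub>R z) powr \<sigma> * t powr (- \<theta>))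
      + (ennreal (?c * \<beta> / y) * ennreal (g (x + t *\<^sub>R z) powr \<sigma> * t powr (n - \<theta>)) + ennreal (?c * \<beta> / z0) * ennreal (t powr (- \<theta>))) \<partial>I01 \<partial>ballm \<epsilon>)"
      unfolding ray_average_def
    proof (intro nn_integral_mono)
      fix z :: "real^'n" and t :: real assume "t \<in> space I01"
      then have t: "t > 0" by (auto simp: space_restrict_space)
      have "ennreal (g (x + t *\<^sub>R z)) \<le> ennreal (?c * w / x0 * (g (x + t *\<^sub>R z) powr \<sigma> * t powr (- \<theta>))
        + (?c * \<beta> / y * (g (x + t *\<^sub>R z) powr \<sigma> * t powr (n - \<theta>)) + ?c * \<beta> / z0 * t powr (- \<theta>)))"
        using ptw[OF x0 t, of x z] by (intro ennreal_leI) (simp add: algebra_simps)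
      also have "\<dots> = ennreal (?c * w / x0) * ennreal (g (x + t *\<^sub>R z) powr \<sigma> * t powr (- \<theta>))
        + (ennreal (?c * \<beta> / y) * ennreal (g (x + t *\<^sub>R z) powr \<sigma> * t powr (n - \<theta>)) + ennreal (?c * \<beta> / z0) * ennreal (t powr (- \<theta>)))"
        using c w \<beta> x0 y z0 K by (simp add: ennreal_plus[symmetric] ennreal_mult[symmetric] del: ennreal_plus)
      finally show "ennreal (g (x + t *\<^sub>R z)) \<le> \<dots>" .
    qed
    also have "\<dots> = ennreal (?c * w / x0) * X x + (ennreal (?c * \<beta> / y) * Y x + ennreal (?c * \<beta> / z0) * Z)"
      unfolding X_def Y_def Z_def
      by (simp only: nn_integral_lincomb3[OF F1 F2 F3] nn_integral_lincomb3[OF F4 F5 F6])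
    also have "\<dots> \<le> ennreal (?c * w / x0) * ennreal x0 + (ennreal (?c * \<beta> / y) * ennreal y + ennreal (?c * \<beta> / z0) * ennreal z0)"
      by (intro add_mono mult_left_mono Xx Y) (auto simp: Z)
    also have "\<dots> = ennreal (?c * w + (?c * \<beta> + ?c * \<beta>))"
      using c w \<beta> x0 y z0 K by (simp add: ennreal_plus[symmetric] ennreal_mult[symmetric] del: ennreal_plus)
    also have "?c * w + (?c * \<beta> + ?c * \<beta>) = ?c * (w + 2 * \<beta>)" by (simp add: algebra_simps)
    finally show ?thesis using w(2) by simp
  qed
  have Js: "ennreal (enn2real (ray_average \<epsilon> g x) powr s) \<le> ennreal (K powr s) * X x" for x
  proof (cases "X x = \<infinity>")
    case True
    then show ?thesis using K by (simp add: ennreal_mult_top)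
  next
    case False
    then obtain x1 where x1: "x1 \<ge> 0" "X x = ennreal x1" by (cases "X x") auto
    have "enn2real (ray_average \<epsilon> g x) powr s \<le> K powr s * x1"
    proof (rule field_le_epsilon)
      fix e :: real assume e: "e > 0"
      \<comment> \<open>\<open>X x\<close> may be 0, whereas the divisor \<open>x0\<close> must be
        positive; the increment costs exactly \<open>e\<close> after the s-th power.\<close>
      define x0 where "x0 = x1 + e / K powr s"
      have x0: "x0 > 0" "X x \<le> ennreal x0" using e K x1 by (auto simp: x0_def add_nonneg_pos intro: ennreal_leI)
      have "enn2real (ray_average \<epsilon> g x) \<le> K * x0 powr w"
        using J[OF x0] K x0 by (intro enn2real_leI) auto
      then have "enn2real (ray_average \<epsilon> g x) powr s \<le> (K * x0 powr w) powr s"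
        using s by (intro powr_mono2) auto
      also have "\<dots> = K powr s * x0" using x0 s by (simp add: powr_mult powr_powr w_def)
      also have "\<dots> = K powr s * x1 + e" using K by (simp add: x0_def algebra_simps)
      finally show "enn2real (ray_average \<epsilon> g x) powr s \<le> K powr s * x1 + e" .
    qed
    then show ?thesis using x1 by (simp add: ennreal_mult[symmetric] ennreal_leI)
  qed
  have Xint: "(\<integral>\<^sup>+x. X x \<partial>lborel) \<le> ennreal (N * z0)"
  proof -
    have "(\<integral>\<^sup>+x. X x \<partial>lborel) = (\<integral>\<^sup>+z. \<integral>\<^sup>+x. \<integral>\<^sup>+t. ennreal (g (x + t *\<^sub>R z) powr \<sigma> * t powr (- \<theta>)) \<partial>I01 \<partial>lborel \<partial>ballm \<epsilon>)"
      unfolding X_def by (rule LB.Fubini'[symmetric]) measurable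
    also have "\<dots> = (\<integral>\<^sup>+z. \<integral>\<^sup>+t. \<integral>\<^sup>+x. ennreal (g (x + t *\<^sub>R z) powr \<sigma> * t powr (- \<theta>)) \<partial>lborel \<partial>I01 \<partial>ballm \<epsilon>)"
      by (intro nn_integral_cong lborel_I01.Fubini'[symmetric]) measurable
    also have "\<dots> = (\<integral>\<^sup>+z. \<integral>\<^sup>+t. ennreal (t powr (- \<theta>)) * (\<integral>\<^sup>+x. ennreal (g x powr \<sigma>) \<partial>lborel) \<partial>I01 \<partial>(ballm \<epsilon> :: (real^'n) measure))"
    proof (intro nn_integral_cong)
      fix z :: "real^'n" and t :: real
      have "(\<integral>\<^sup>+x. ennreal (g (x + t *\<^sub>R z) powr \<sigma> * t powr (- \<theta>)) \<partial>lborel)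
        = (\<integral>\<^sup>+x. ennreal (g x powr \<sigma> * t powr (- \<theta>)) \<partial>lborel)"
        by (rule nn_integral_lborel_shift[where f = "\<lambda>x. ennreal (g x powr \<sigma> * t powr (- \<theta>))"]) simp
      also have "\<dots> = ennreal (t powr (- \<theta>)) * (\<integral>\<^sup>+x. ennreal (g x powr \<sigma>) \<partial>lborel)"
        by (subst nn_integral_cmult[symmetric]) (auto simp: ennreal_mult[symmetric] mult.commute)
      finally show "(\<integral>\<^sup>+x. ennreal (g (x + t *\<^sub>R z) powr \<sigma> * t powr (- \<theta>)) \<partial>lborel)
        = ennreal (t powr (- \<theta>)) * (\<integral>\<^sup>+x. ennreal (g x powr \<sigma>) \<partial>lborel)" .
    qed
    also have "\<dots> = Z * (\<integral>\<^sup>+x. ennreal (g x powr \<sigma>) \<partial>lborel)"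
    proof -
      have "(\<integral>\<^sup>+t. ennreal (t powr (- \<theta>)) * (\<integral>\<^sup>+x. ennreal (g x powr \<sigma>) \<partial>lborel) \<partial>I01)
        = (\<integral>\<^sup>+t. ennreal (t powr (- \<theta>)) \<partial>I01) * (\<integral>\<^sup>+x. ennreal (g x powr \<sigma>) \<partial>lborel)"
        by (rule nn_integral_multc) measurable
      then show ?thesis unfolding Z_def by (simp only:) (rule nn_integral_multc, measurable)
    qed
    also have "\<dots> \<le> Z * ennreal N" by (intro mult_left_mono N) auto
    also have "\<dots> = ennreal (N * z0)" using N(2) z0 by (simp add: Z ennreal_mult[symmetric] mult.commute)
    finally show ?thesis .
  qed
  have "AE x in lborel. X x \<noteq> \<infinity>"
    using Xint by (intro nn_integral_PInf_AE) (auto simp: top_unique)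
  then show "AE x in lborel. ray_average \<epsilon> g x < \<infinity>"
  proof eventually_elim
    case (elim x)
    then obtain x1 where "x1 \<ge> 0" "X x = ennreal x1" by (cases "X x") auto
    then have "ray_average \<epsilon> g x \<le> ennreal (K * (x1 + 1) powr w)"
      by (intro J) (auto intro: ennreal_leI)
    then show ?case by (auto intro: le_less_trans)
  qed
  have "(\<integral>\<^sup>+x. ennreal (enn2real (ray_average \<epsilon> g x) powr s) \<partial>lborel) \<le> (\<integral>\<^sup>+x. ennreal (K powr s) * X x \<partial>lborel)"
    by (intro nn_integral_mono Js)
  also have "\<dots> = ennreal (K powr s) * (\<integral>\<^sup>+x. X x \<partial>lborel)" by (intro nn_integral_cmult) simp
  also have "\<dots> \<le> ennreal (K powr s) * ennreal (N * z0)" by (intro mult_left_mono Xint) auto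
  also have "\<dots> = ennreal ((y * z0) powr (\<beta> * s) * (N * z0))"
    using N(2) z0 by (simp add: ennreal_mult[symmetric] K_def powr_powr)
  finally show "(\<integral>\<^sup>+x. ennreal (enn2real (ray_average \<epsilon> g x) powr s) \<partial>lborel)
      \<le> ennreal (((N + 1) / (1 - \<theta>) * (v / (1 - \<theta>))) powr (\<beta> * s) * (N * (v / (1 - \<theta>))))"
    by (simp add: y_def z0_def)
qed

section \<open>Compactness\<close>

text \<open>The rate is a matter of scaling: the ball volume is a multiple of \<epsilon>^n, and the
  powers of \<epsilon> collect to the positive exponent \<open>s * (1 - \<theta>)\<close>. Besides n
  and \<sigma>, \<open>D\<close> depends only on the gradient bound \<open>N\<close>, so averages
  approximate a whole bounded family uniformly.\<close>

lemma avg_error_powr_le: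
  fixes \<sigma> N :: real
  defines "\<theta> \<equiv> real CARD('n::finite) * (\<sigma> - 1) / \<sigma>" and "s \<equiv> \<sigma> / (2 - \<sigma>)"
  assumes \<sigma>: "1 < \<sigma>" "\<sigma> < 2" and \<theta>: "\<theta> < 1" and N: "N \<ge> 0"
  shows "\<exists>D\<ge>0. \<forall>\<epsilon>>0. \<forall>(U :: real^'n \<Rightarrow> real) G. weak_gradient UNIV U G \<longrightarrow>
    U \<in> borel_measurable borel \<longrightarrow> G \<in> borel_measurable borel \<longrightarrow>
    (\<integral>\<^sup>+x. ennreal (norm (G x) powr \<sigma>) \<partial>lborel) \<le> ennreal N \<longrightarrow>
    (\<integral>\<^sup>+x. ennreal (\<bar>U x - avg \<epsilon> U x\<bar> powr s) \<partial>lborel) \<le> ennreal (D * \<epsilon> powr (s * (1 - \<theta>)))"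
proof -
  define n where "n = real CARD('n)"
  define \<beta> where "\<beta> = (\<sigma> - 1) / \<sigma>"
  define c where "c = unit_ball_vol n"
  define y where "y = (N + 1) / (1 - \<theta>)"
  have c: "c > 0" by (simp add: c_def n_def)
  have y: "y > 0" using N \<theta> by (simp add: y_def)
  have s: "s > 0" using \<sigma> by (simp add: s_def)
  define D where "D = c powr (- s) * (y * c / (1 - \<theta>)) powr (\<beta> * s) * (N * c / (1 - \<theta>))"
  have D: "D \<ge> 0" using c y N \<theta> by (simp add: D_def)
  have est: "(\<integral>\<^sup>+x. ennreal (\<bar>U x - avg \<epsilon> U x\<bar> powr s) \<partial>lborel) \<le> ennreal (D * \<epsilon> powr (s * (1 - \<theta>)))"
    if \<epsilon>: "\<epsilon> > 0" and wg: "weak_gradient UNIV U G" and U: "U \<in> borel_measurable borel"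
      and G: "G \<in> borel_measurable borel"
      and GN: "(\<integral>\<^sup>+x. ennreal (norm (G x) powr \<sigma>) \<partial>lborel) \<le> ennreal N"
    for \<epsilon> and U :: "real^'n \<Rightarrow> real" and G
  proof -
    define v where "v = measure lborel (cball (0 :: real^'n) \<epsilon>)"
    have v_eq: "v = c * \<epsilon> powr n"
      using \<epsilon> content_cball[of \<epsilon> "0 :: real^'n"] by (simp add: v_def c_def n_def powr_realpow)
    have v: "v > 0" using c \<epsilon> by (simp add: v_eq)
    let ?g = "\<lambda>x. norm (G x)"
    have gm: "?g \<in> borel_measurable borel" using G by simp
    have J: "AE x in lborel. ray_average \<epsilon> ?g x < \<infinity>"
      "(\<integral>\<^sup>+x. ennreal (enn2real (ray_average \<epsilon> ?g x) powr s) \<partial>lborel)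
         \<le> ennreal ((y * (v / (1 - \<theta>))) powr (\<beta> * s) * (N * (v / (1 - \<theta>))))"
      unfolding v_def y_def \<beta>_def s_def \<theta>_def
      by (rule ray_average_powr_le[OF gm norm_ge_zero \<sigma> \<theta>[unfolded \<theta>_def] \<epsilon> GN N])+
    have rm: "ray_average \<epsilon> ?g \<in> borel_measurable borel"
    proof -
      interpret B: finite_measure "ballm \<epsilon> :: (real^'n) measure" by (rule finite_measure_ballm)
      have [measurable]: "G \<in> borel_measurable borel" by fact
      show ?thesis unfolding ray_average_def[abs_def] by measurable
    qed
    have "(\<integral>\<^sup>+x. ennreal (\<bar>U x - avg \<epsilon> U x\<bar> powr s) \<partial>lborel)
      \<le> (\<integral>\<^sup>+x. ennreal ((\<epsilon> / v) powr s) * ennreal (enn2real (ray_average \<epsilon> ?g x) powr s) \<partial>lborel)"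
    proof (rule nn_integral_mono_AE)
      show "AE x in lborel. ennreal (\<bar>U x - avg \<epsilon> U x\<bar> powr s)
        \<le> ennreal ((\<epsilon> / v) powr s) * ennreal (enn2real (ray_average \<epsilon> ?g x) powr s)"
        using J(1) avg_error_le[OF wg U G \<epsilon>]
      proof eventually_elim
        case (elim x)
        then obtain j where j: "j \<ge> 0" "ray_average \<epsilon> ?g x = ennreal j"
          by (cases "ray_average \<epsilon> ?g x") auto
        have "ennreal \<bar>U x - avg \<epsilon> U x\<bar> \<le> ennreal (\<epsilon> / v * j)"
          using elim(2) j(1) v \<epsilon> unfolding v_def[symmetric] j(2) by (subst ennreal_mult) auto
        then have "\<bar>U x - avg \<epsilon> U x\<bar> \<le> \<epsilon> / v * j"
          using v \<epsilon> j by (subst (asm) ennreal_le_iff) auto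
        then have "\<bar>U x - avg \<epsilon> U x\<bar> powr s \<le> (\<epsilon> / v * j) powr s"
          using s by (intro powr_mono2) auto
        then have "ennreal (\<bar>U x - avg \<epsilon> U x\<bar> powr s) \<le> ennreal ((\<epsilon> / v) powr s * j powr s)"
          unfolding powr_mult by (rule ennreal_leI)
        then show ?case using j by (simp add: ennreal_mult)
      qed
    qed
    also have "\<dots> = ennreal ((\<epsilon> / v) powr s) * (\<integral>\<^sup>+x. ennreal (enn2real (ray_average \<epsilon> ?g x) powr s) \<partial>lborel)"
    proof (rule nn_integral_cmult)
      have "(\<lambda>j. ennreal (enn2real j powr s)) \<in> borel_measurable borel" by measurable
      then have "(\<lambda>x. ennreal (enn2real (ray_average \<epsilon> ?g x) powr s)) \<in> borel_measurable borel"
        by (rule measurable_compose[OF rm])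
      then show "(\<lambda>x. ennreal (enn2real (ray_average \<epsilon> ?g x) powr s)) \<in> borel_measurable lborel" by simp
    qed
    also have "\<dots> \<le> ennreal ((\<epsilon> / v) powr s) * ennreal ((y * (v / (1 - \<theta>))) powr (\<beta> * s) * (N * (v / (1 - \<theta>))))"
      by (intro mult_left_mono J) auto
    also have "\<dots> = ennreal ((\<epsilon> / v) powr s * ((y * (v / (1 - \<theta>))) powr (\<beta> * s) * (N * (v / (1 - \<theta>)))))"
      using N v \<theta> by (intro ennreal_mult[symmetric]) auto
    also have "(\<epsilon> / v) powr s * ((y * (v / (1 - \<theta>))) powr (\<beta> * s) * (N * (v / (1 - \<theta>))))
      = D * (\<epsilon> powr s * \<epsilon> powr (- n * s) * \<epsilon> powr (n * (\<beta> * s)) * \<epsilon> powr n)"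
      using \<epsilon> c unfolding v_eq D_def
      by (simp add: powr_mult powr_divide powr_powr powr_minus field_simps)
    also have "\<epsilon> powr s * \<epsilon> powr (- n * s) * \<epsilon> powr (n * (\<beta> * s)) * \<epsilon> powr n
      = \<epsilon> powr (s + - n * s + n * (\<beta> * s) + n)" by (simp only: powr_add)
    \<comment> \<open>The exponents combine through \<open>s * (1 - 2 * \<beta>) = 1\<close>, which
      is the relation 1/s = 2/\<sigma> - 1.\<close>
    also have "s + - n * s + n * (\<beta> * s) + n = s * (1 - \<theta>)"
    proof -
      have "s * (1 - 2 * \<beta>) = 1" using \<sigma> by (simp add: s_def \<beta>_def field_simps)
      then have "n = n * (s * (1 - 2 * \<beta>))" by simp
      also have "\<dots> = n * s - 2 * (n * (\<beta> * s))" by (simp add: algebra_simps)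
      finally have "n = n * s - 2 * (n * (\<beta> * s))" .
      moreover have "s * (1 - \<theta>) = s - n * (\<beta> * s)" by (simp add: \<theta>_def \<beta>_def n_def algebra_simps)
      ultimately show ?thesis by linarith
    qed
    finally show ?thesis .
  qed
  show ?thesis by (intro exI[of _ D] conjI allI impI D est)
qed

section \<open>Ball averages are bounded and equicontinuous\<close>

lemma nn_integral_cball_le:
  fixes a :: "real^'n \<Rightarrow> real"
  assumes [measurable]: "a \<in> borel_measurable borel" and a: "\<And>x. a x \<ge> 0" and \<sigma>: "\<sigma> \<ge> 1"
    and N: "(\<integral>\<^sup>+x. ennreal (a x powr \<sigma>) \<partial>lborel) \<le> ennreal N" "N \<ge> 0" and sub: "cball c r \<subseteq> cball 0 R"
  shows "(\<integral>\<^sup>+x. indicator (cball c r) x * ennreal (a x) \<partial>lborel) \<le> ennreal (measure lborel (cball (0 :: real^'n) R) + N)"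
proof -
  have le: "t \<le> 1 + t powr \<sigma>" if "t \<ge> 0" for t
  proof (cases "t \<ge> 1")
    case True
    then show ?thesis using powr_mono[OF \<sigma> True] that by simp
  next
    case False
    then show ?thesis using powr_ge_zero[of t \<sigma>] by linarith
  qed
  have "(\<integral>\<^sup>+x. indicator (cball c r) x * ennreal (a x) \<partial>lborel)
    \<le> (\<integral>\<^sup>+x. indicator (cball 0 R) x + ennreal (a x powr \<sigma>) \<partial>lborel)"
  proof (rule nn_integral_mono)
    fix x
    show "indicator (cball c r) x * ennreal (a x) \<le> indicator (cball 0 R) x + ennreal (a x powr \<sigma>)"
    proof (cases "x \<in> cball c r")
      case True
      have "ennreal (a x) \<le> ennreal (1 + a x powr \<sigma>)" using le[OF a] by (rule ennreal_leI)
      also have "\<dots> = 1 + ennreal (a x powr \<sigma>)" by simp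
      finally show ?thesis using True sub by (auto simp: indicator_def subset_iff)
    qed simp
  qed
  also have "\<dots> = emeasure lborel (cball (0 :: real^'n) R) + (\<integral>\<^sup>+x. ennreal (a x powr \<sigma>) \<partial>lborel)"
    by (subst nn_integral_add) auto
  also have "\<dots> \<le> ennreal (measure lborel (cball (0 :: real^'n) R)) + ennreal N"
    using emeasure_lborel_cball_finite[of "0 :: real^'n" R]
    by (intro add_mono N) (simp add: emeasure_eq_ennreal_measure less_top)
  also have "\<dots> = ennreal (measure lborel (cball (0 :: real^'n) R) + N)" using N(2) by simp
  finally show ?thesis .
qed

text \<open>Control in \<open>L^\<sigma>\<close> gives local control in \<open>L^1\<close> by t
  \<le> 1 + t^\<sigma>. The radius 3 R + 1 is shared with the Lipschitz estimate, where a shift of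
  length up to 2 R and a ball of radius at most 1 add to R.\<close>

lemma ball_integral_bound:
  fixes U :: "real^'n \<Rightarrow> real"
  assumes U[measurable]: "U \<in> borel_measurable borel" and \<sigma>: "\<sigma> \<ge> 1"
    and Ui: "\<And>R. integrable lborel (\<lambda>x. indicator (cball 0 R) x *\<^sub>R U x)"
    and N: "(\<integral>\<^sup>+x. ennreal (\<bar>U x\<bar> powr \<sigma>) \<partial>lborel) \<le> ennreal N" "N \<ge> 0"
    and x: "norm x \<le> R" "\<epsilon> \<le> 1"
  shows "\<bar>LINT z|ballm \<epsilon>. U (x + z)\<bar> \<le> measure lborel (cball (0 :: real^'n) (3 * R + 1)) + N"
proof -
  have R: "R \<ge> 0" using x(1) norm_ge_zero[of x] by linarith
  have sub: "cball x \<epsilon> \<subseteq> cball 0 (3 * R + 1)"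
    using x R by (simp add: cball_subset_cball_iff)
  have i: "integrable lborel (\<lambda>y. indicator (cball x \<epsilon>) y * U y)"
  proof -
    have "integrable lborel (\<lambda>y. indicator (cball x \<epsilon>) y *\<^sub>R (indicator (cball 0 (3 * R + 1)) y *\<^sub>R U y))"
      using Ui by (rule integrable_mult_indicator[rotated]) simp
    moreover have "(\<lambda>y. indicator (cball x \<epsilon>) y *\<^sub>R (indicator (cball 0 (3 * R + 1)) y *\<^sub>R U y))
      = (\<lambda>y. indicator (cball x \<epsilon>) y * U y)"
      using sub by (auto simp: indicator_def fun_eq_iff)
    ultimately show ?thesis by simp
  qed
  have "ennreal \<bar>LINT z|ballm \<epsilon>. U (x + z)\<bar> \<le> (\<integral>\<^sup>+y. ennreal (norm (indicator (cball x \<epsilon>) y * U y)) \<partial>lborel)"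
    unfolding integrable_ballm_shift(2)[OF U Ui] using integral_norm_bound_ennreal[OF i] by simp
  also have "\<dots> = (\<integral>\<^sup>+y. indicator (cball x \<epsilon>) y * ennreal \<bar>U y\<bar> \<partial>lborel)"
    by (intro nn_integral_cong) (auto simp: indicator_def)
  also have "\<dots> \<le> ennreal (measure lborel (cball (0 :: real^'n) (3 * R + 1)) + N)"
    by (rule nn_integral_cball_le[OF _ _ \<sigma> N sub]) auto
  finally show ?thesis using N(2) by (subst (asm) ennreal_le_iff) auto
qed

text \<open>The translation estimate integrated over the ball. The constant depends on U only
  through \<open>N\<close>, so ball integrals of one radius are equicontinuous even though the
  functions themselves need not be continuous.\<close>

lemma ball_integral_lipschitz:
  fixes U :: "real^'n \<Rightarrow> real"
  assumes wg: "weak_gradient UNIV U G" and \<sigma>: "\<sigma> \<ge> 1"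
    and U[measurable]: "U \<in> borel_measurable borel" and G[measurable]: "G \<in> borel_measurable borel"
    and N: "(\<integral>\<^sup>+x. ennreal (norm (G x) powr \<sigma>) \<partial>lborel) \<le> ennreal N" "N \<ge> 0"
    and x: "norm x \<le> R" "norm x' \<le> R" "\<epsilon> \<le> 1"
  shows "\<bar>(LINT z|ballm \<epsilon>. U (x' + z)) - (LINT z|ballm \<epsilon>. U (x + z))\<bar>
    \<le> norm (x' - x) * (measure lborel (cball (0 :: real^'n) (3 * R + 1)) + N)"
proof -
  have Ui: "integrable lborel (\<lambda>x. indicator (cball 0 R) x *\<^sub>R U x)" for R
    using locally_integrable_lborel[OF U] weak_gradient_integrable(1)[OF wg] by blast
  define h where "h = x' - x"
  have h: "norm h \<le> 2 * R" using norm_triangle_ineq4[of x' x] x by (simp add: h_def)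
  have sub: "cball x (\<epsilon> + norm h) \<subseteq> cball 0 (3 * R + 1)"
  proof
    fix y assume "y \<in> cball x (\<epsilon> + norm h)"
    then have "norm (y - x) \<le> \<epsilon> + norm h" by (simp add: dist_norm norm_minus_commute)
    then show "y \<in> cball 0 (3 * R + 1)" using norm_triangle_ineq[of "y - x" x] x h by simp
  qed
  have i: "integrable (ballm \<epsilon>) (\<lambda>z. U (x' + z))" "integrable (ballm \<epsilon>) (\<lambda>z. U (x + z))"
    by (rule integrable_ballm_shift(1)[OF U Ui])+
  have "ennreal \<bar>(LINT z|ballm \<epsilon>. U (x' + z)) - (LINT z|ballm \<epsilon>. U (x + z))\<bar>
    = ennreal \<bar>LINT z|ballm \<epsilon>. U (x' + z) - U (x + z)\<bar>" using i by simp
  also have "\<dots> \<le> (\<integral>\<^sup>+z. ennreal \<bar>U (x' + z) - U (x + z)\<bar> \<partial>ballm \<epsilon>)"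
    using integral_norm_bound_ennreal[OF Bochner_Integration.integrable_diff[OF i]] by simp
  also have "\<dots> = (\<integral>\<^sup>+z. indicator (cball x \<epsilon>) (z + x) * ennreal \<bar>U (z + x + h) - U (z + x)\<bar> \<partial>lborel)"
    by (subst nn_integral_restrict_space)
      (auto intro!: nn_integral_cong simp: h_def indicator_def dist_norm algebra_simps)
  also have "\<dots> = (\<integral>\<^sup>+y. indicator (cball x \<epsilon>) y * ennreal \<bar>U (y + h) - U y\<bar> \<partial>lborel)"
    by (rule nn_integral_lborel_shift[where f = "\<lambda>y. indicator (cball x \<epsilon>) y * ennreal \<bar>U (y + h) - U y\<bar>"]) measurable
  also have "\<dots> \<le> (\<integral>\<^sup>+y. indicator (cball x \<epsilon>) y * (ennreal (norm h) * (\<integral>\<^sup>+t. ennreal (norm (G (y + t *\<^sub>R h))) \<partial>I01)) \<partial>lborel)"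
    by (rule nn_integral_mono_AE, rule AE_mp[OF weak_gradient_translation[OF wg U G, of h]])
      (auto intro!: AE_I2 mult_left_mono)
  also have "\<dots> = (\<integral>\<^sup>+y. ennreal (norm h) * (\<integral>\<^sup>+t. indicator (cball x \<epsilon>) y * ennreal (norm (G (y + t *\<^sub>R h))) \<partial>I01) \<partial>lborel)"
  proof (rule nn_integral_cong)
    fix y
    have "(\<integral>\<^sup>+t. indicator (cball x \<epsilon>) y * ennreal (norm (G (y + t *\<^sub>R h))) \<partial>I01)
      = indicator (cball x \<epsilon>) y * (\<integral>\<^sup>+t. ennreal (norm (G (y + t *\<^sub>R h))) \<partial>I01)"
      by (rule nn_integral_cmult) measurable
    then show "indicator (cball x \<epsilon>) y * (ennreal (norm h) * (\<integral>\<^sup>+t. ennreal (norm (G (y + t *\<^sub>R h))) \<partial>I01))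
      = ennreal (norm h) * (\<integral>\<^sup>+t. indicator (cball x \<epsilon>) y * ennreal (norm (G (y + t *\<^sub>R h))) \<partial>I01)"
      by (simp add: mult_ac)
  qed
  also have "\<dots> = ennreal (norm h) * (\<integral>\<^sup>+y. \<integral>\<^sup>+t. indicator (cball x \<epsilon>) y * ennreal (norm (G (y + t *\<^sub>R h))) \<partial>I01 \<partial>lborel)"
    by (rule nn_integral_cmult) measurable
  also have "\<dots> = ennreal (norm h) * (\<integral>\<^sup>+t. \<integral>\<^sup>+y. indicator (cball x \<epsilon>) y * ennreal (norm (G (y + t *\<^sub>R h))) \<partial>lborel \<partial>I01)"
    by (subst lborel_I01.Fubini') measurable
  also have "\<dots> \<le> ennreal (norm h) * (\<integral>\<^sup>+t. (\<integral>\<^sup>+y. indicator (cball x (\<epsilon> + norm h)) y * ennreal (norm (G y)) \<partial>lborel) \<partial>I01)"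
    by (intro mult_left_mono nn_integral_mono nn_integral_shifted_ball_le) (auto simp: space_restrict_space)
  also have "\<dots> = ennreal (norm h) * (\<integral>\<^sup>+y. indicator (cball x (\<epsilon> + norm h)) y * ennreal (norm (G y)) \<partial>lborel)"
    by (simp only: nn_integral_I01_const)
  also have "\<dots> \<le> ennreal (norm h) * ennreal (measure lborel (cball (0 :: real^'n) (3 * R + 1)) + N)"
    by (intro mult_left_mono nn_integral_cball_le[OF _ _ \<sigma> N sub]) auto
  also have "\<dots> = ennreal (norm h * (measure lborel (cball (0 :: real^'n) (3 * R + 1)) + N))"
    using N(2) by (simp add: ennreal_mult[symmetric] del: ennreal_plus)
  finally show ?thesis using N(2) by (subst (asm) ennreal_le_iff) (auto simp: h_def)
qed

section \<open>Rellich compactness on a bounded set\<close>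

lemma in_L_lebesgue_on:
  fixes f :: "real^'n \<Rightarrow> real"
  assumes f: "f \<in> borel_measurable borel" and B: "B \<ge> 0" and \<Omega>: "\<Omega> \<in> sets lebesgue"
    and le: "(\<integral>\<^sup>+x. ennreal (\<bar>f x\<bar> powr s) \<partial>lborel) \<le> ennreal B"
  shows "in_L (lebesgue_on \<Omega>) s f" "Lpow (lebesgue_on \<Omega>) s f \<le> B"
proof -
  have m: "f \<in> borel_measurable (lebesgue_on \<Omega>)"
    using f by (intro measurable_restrict_space1 measurable_completion) simp
  have "(\<integral>\<^sup>+x. ennreal (\<bar>f x\<bar> powr s) \<partial>lebesgue_on \<Omega>) \<le> (\<integral>\<^sup>+x. ennreal (\<bar>f x\<bar> powr s) \<partial>lebesgue)"
    using \<Omega> by (subst nn_integral_restrict_space) (auto intro!: nn_integral_mono simp: indicator_def)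
  also have "\<dots> = (\<integral>\<^sup>+x. ennreal (\<bar>f x\<bar> powr s) \<partial>lborel)"
    by (rule nn_integral_completion)
  finally have *: "(\<integral>\<^sup>+x. ennreal (\<bar>f x\<bar> powr s) \<partial>lebesgue_on \<Omega>) \<le> ennreal B" using le by simp
  then have i: "integrable (lebesgue_on \<Omega>) (\<lambda>x. \<bar>f x\<bar> powr s)"
    using m by (intro integrableI_bounded) (auto intro: le_less_trans)
  then show "in_L (lebesgue_on \<Omega>) s f" using m by (simp add: in_L_def)
  show "Lpow (lebesgue_on \<Omega>) s f \<le> B"
    using * B i unfolding Lpow_def by (subst (asm) nn_integral_eq_integral) auto
qed

text \<open>For each fixed radius the averages are bounded and equi-Lipschitz, so a diagonal
  subsequence converges pointwise on \<Omega>; as the radius shrinks they approximate the functions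
  in \<open>L^s\<close> uniformly in k. Hence the subsequence is Cauchy in \<open>L^s\<close>.
  Membership of \<open>U k\<close> in \<open>L^s\<close> is a by-product of the
  approximation.\<close>

lemma Rellich_borel:
  fixes U :: "nat \<Rightarrow> real^'n \<Rightarrow> real" and G :: "nat \<Rightarrow> real^'n \<Rightarrow> real^'n" and \<sigma> N :: real
  defines "\<theta> \<equiv> real CARD('n) * (\<sigma> - 1) / \<sigma>" and "s \<equiv> \<sigma> / (2 - \<sigma>)"
  assumes \<Omega>: "\<Omega> \<in> sets lebesgue" "bounded \<Omega>"
    and \<sigma>: "1 < \<sigma>" "\<sigma> < 2" and \<theta>: "\<theta> < 1" and N0: "N \<ge> 0"
    and wg: "\<And>k. weak_gradient UNIV (U k) (G k)"
    and U: "\<And>k. U k \<in> borel_measurable borel" and G: "\<And>k. G k \<in> borel_measurable borel"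
    and UN: "\<And>k. (\<integral>\<^sup>+x. ennreal (\<bar>U k x\<bar> powr \<sigma>) \<partial>lborel) \<le> ennreal N"
    and GN: "\<And>k. (\<integral>\<^sup>+x. ennreal (norm (G k x) powr \<sigma>) \<partial>lborel) \<le> ennreal N"
  obtains r u where "\<And>k. in_L (lebesgue_on \<Omega>) s (U k)" "strict_mono (r :: nat \<Rightarrow> nat)"
    "in_L (lebesgue_on \<Omega>) s u" "(\<lambda>k. Lpow (lebesgue_on \<Omega>) s (\<lambda>x. U (r k) x - u x)) \<longlonglongrightarrow> 0"
proof -
  define M where "M = lebesgue_on \<Omega>"
  have s: "s > 0" using \<sigma> by (simp add: s_def)
  have \<sigma>1: "\<sigma> \<ge> 1" using \<sigma> by simp
  have "\<Omega> \<in> lmeasurable" using \<Omega> by (rule bounded_set_imp_lmeasurable[rotated])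
  interpret M: finite_measure M
    unfolding M_def using \<open>\<Omega> \<in> lmeasurable\<close> by (rule finite_measure_lebesgue_on)
  obtain R where R: "\<And>x. x \<in> \<Omega> \<Longrightarrow> norm x \<le> R" using \<Omega>(2) unfolding bounded_iff by blast
  obtain D where D0: "D \<ge> 0" and D: "\<forall>\<epsilon>>0. \<forall>(U :: real^'n \<Rightarrow> real) G. weak_gradient UNIV U G \<longrightarrow>
    U \<in> borel_measurable borel \<longrightarrow> G \<in> borel_measurable borel \<longrightarrow>
    (\<integral>\<^sup>+x. ennreal (norm (G x) powr \<sigma>) \<partial>lborel) \<le> ennreal N \<longrightarrow>
    (\<integral>\<^sup>+x. ennreal (\<bar>U x - avg \<epsilon> U x\<bar> powr s) \<partial>lborel) \<le> ennreal (D * \<epsilon> powr (s * (1 - \<theta>)))"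
    using avg_error_powr_le[where 'n = 'n, OF \<sigma> \<theta>[unfolded \<theta>_def] N0, folded s_def \<theta>_def] by (elim exE conjE)
  define \<epsilon> where "\<epsilon> j = 1 / (real j + 1)" for j :: nat
  have \<epsilon>: "\<epsilon> j > 0" "\<epsilon> j \<le> 1" for j by (auto simp: \<epsilon>_def field_simps)
  define L where "L = measure lborel (cball (0 :: real^'n) (3 * R + 1)) + N"
  have L: "L \<ge> 0" using N0 by (simp add: L_def)
  define I where "I k j x = (LINT z|ballm (\<epsilon> j). U k (x + z))" for k j x
  have Ui: "integrable lborel (\<lambda>x. indicator (cball 0 R) x *\<^sub>R U k x)" for R k
    using locally_integrable_lborel[OF U] weak_gradient_integrable(1)[OF wg] by blast
  have Ib: "\<bar>I k j x\<bar> \<le> L" if "x \<in> \<Omega>" for k j x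
    unfolding I_def L_def by (rule ball_integral_bound[OF U \<sigma>1 Ui UN N0 R[OF that] \<epsilon>(2)])
  have Il: "\<bar>I k j x' - I k j x\<bar> \<le> norm (x' - x) * L" if "x \<in> \<Omega>" "x' \<in> \<Omega>" for k j x x'
    unfolding I_def L_def by (rule ball_integral_lipschitz[OF wg \<sigma>1 U G GN N0 R R \<epsilon>(2)]) fact+
  obtain T where T: "countable T" "T \<subseteq> \<Omega>" "\<Omega> \<subseteq> closure T" by (rule separable)
  \<comment> \<open>Points of \<open>T\<close> are paired with radius indices, so that one
    subsequence serves all \<open>\<epsilon> j\<close> at once.\<close>
  obtain r where r: "strict_mono (r :: nat \<Rightarrow> nat)"
    and rT: "\<And>z. z \<in> T \<times> (UNIV :: nat set) \<Longrightarrow> \<exists>l. (\<lambda>n. I (r n) (snd z) (fst z)) \<longlonglongrightarrow> l"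
    by (rule function_convergent_subsequence[of "T \<times> (UNIV :: nat set)" "\<lambda>n z. I n (snd z) (fst z)" L])
      (use T Ib in auto)
  \<comment> \<open>The common Lipschitz constant carries convergence from the dense set
    \<open>T\<close> to all of \<Omega>.\<close>
  have conv: "convergent (\<lambda>k. I (r k) j x)" if x: "x \<in> \<Omega>" for j x
  proof (rule Cauchy_convergent, rule CauchyI)
    fix e :: real assume e: "e > 0"
    define d where "d = e / (3 * (L + 1))"
    have d: "d > 0" "d * L < e / 3"
    proof -
      show "d > 0" using e L by (simp add: d_def)
      then have "d * L < d * (L + 1)" by simp
      also have "\<dots> = e / 3" using L by (simp add: d_def field_simps)
      finally show "d * L < e / 3" .
    qed
    have "x \<in> closure T" using T(3) x by blast
    then have "\<exists>q\<in>T. dist q x < d" using d(1) by (simp add: closure_approachable)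
    then obtain q where q: "q \<in> T" "dist q x < d" by blast
    have "convergent (\<lambda>n. I (r n) j q)" using rT[of "(q, j)"] q by (simp add: convergent_def)
    then have "Cauchy (\<lambda>n. I (r n) j q)" by (rule convergent_Cauchy)
    then have "\<exists>m. \<forall>k\<ge>m. \<forall>l\<ge>m. norm (I (r k) j q - I (r l) j q) < e / 3"
      by (rule CauchyD) (use e in simp)
    then obtain m where m: "\<And>k l. k \<ge> m \<Longrightarrow> l \<ge> m \<Longrightarrow> norm (I (r k) j q - I (r l) j q) < e / 3"
      by blast
    have xq: "\<bar>I (r k) j x - I (r k) j q\<bar> < e / 3" for k
    proof -
      have "\<bar>I (r k) j x - I (r k) j q\<bar> \<le> norm (x - q) * L" by (rule Il) (use q(1) T(2) x in auto)
      also have "\<dots> \<le> d * L" using q(2) L by (intro mult_right_mono) (auto simp: dist_norm norm_minus_commute)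
      finally show ?thesis using d(2) by simp
    qed
    have "norm (I (r k) j x - I (r l) j x) < e" if "k \<ge> m" "l \<ge> m" for k l
      using m[OF that] xq[of k] xq[of l] unfolding real_norm_def abs_less_iff by linarith
    then show "\<exists>m. \<forall>k\<ge>m. \<forall>l\<ge>m. norm (I (r k) j x - I (r l) j x) < e" by blast
  qed
  define v where "v j = measure lborel (cball (0 :: real^'n) (\<epsilon> j))" for j
  have v: "v j > 0" for j unfolding v_def using \<epsilon>(1) by (simp add: content_cball_pos)
  define A where "A k j = (\<lambda>x. avg (\<epsilon> j) (U k) x)" for k j
  have A: "A k j x = I k j x / v j" for k j x by (simp add: A_def avg_def I_def v_def)
  define B where "B j x = lim (\<lambda>k. A (r k) j x)" for j x
  have Ab: "\<bar>A k j x\<bar> \<le> L / v j" if "x \<in> \<Omega>" for k j x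
    using Ib[OF that] v[of j] by (simp add: A abs_divide divide_right_mono)
  have lim: "(\<lambda>k. A (r k) j x) \<longlonglongrightarrow> B j x" if "x \<in> \<Omega>" for j x
  proof -
    have "convergent (\<lambda>k. A (r k) j x)"
      using conv[OF that, of j] unfolding A divide_inverse by (intro convergent_mult convergent_const)
    then show ?thesis unfolding B_def by (simp add: convergent_LIMSEQ_iff)
  qed
  have Bb: "\<bar>B j x\<bar> \<le> L / v j" if "x \<in> \<Omega>" for j x
    using tendsto_rabs[OF lim[OF that, of j]] Ab[OF that] by (intro LIMSEQ_le_const2) auto
  have Am0: "A k j \<in> borel_measurable borel" for k j
  proof -
    interpret B: finite_measure "ballm (\<epsilon> j) :: (real^'n) measure" by (rule finite_measure_ballm)
    have [measurable]: "U k \<in> borel_measurable borel" by (rule U)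
    show ?thesis unfolding A_def avg_def[abs_def] by measurable
  qed
  have Am[measurable]: "A k j \<in> borel_measurable M" for k j
    unfolding M_def using Am0 by (intro measurable_restrict_space1 measurable_completion) simp
  have spM: "space M = \<Omega>" by (simp add: M_def)
  have Bm[measurable]: "B j \<in> borel_measurable M" for j
    unfolding B_def by measurable
  have bounded_in_L: "in_L M s f" if "f \<in> borel_measurable M" "\<And>x. x \<in> \<Omega> \<Longrightarrow> \<bar>f x\<bar> \<le> c" for f c
    using that s by (intro in_L_bound(1)[of _ _ "\<lambda>_. c powr s"]) (auto simp: spM intro!: AE_I2 powr_mono2)
  have AL: "in_L M s (A k j)" for k j using Am Ab by (rule bounded_in_L)
  have BL: "in_L M s (B j)" for j using Bm Bb by (rule bounded_in_L)
  define \<eta> where "\<eta> j = D * \<epsilon> j powr (s * (1 - \<theta>))" for j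
  have UA: "in_L M s (\<lambda>x. U k x - A k j x)" "Lpow M s (\<lambda>x. U k x - A k j x) \<le> \<eta> j" for k j
    unfolding M_def \<eta>_def A_def
    by (rule in_L_lebesgue_on[OF _ _ \<Omega>(1) D[rule_format, OF \<epsilon>(1) wg U G GN]],
        use U Am0[of k j] D0 in \<open>auto simp: A_def\<close>)+
  have UL: "in_L M s (U k)" for k
    using in_L_add[OF s UA(1)[of k 0] AL[of k 0]] by simp
  have \<eta>0: "\<eta> \<longlonglongrightarrow> 0"
  proof -
    have "\<epsilon> \<longlonglongrightarrow> 0" unfolding \<epsilon>_def
      using LIMSEQ_inverse_real_of_nat by (simp add: inverse_eq_divide add.commute)
    then have "(\<lambda>j. \<epsilon> j powr (s * (1 - \<theta>))) \<longlonglongrightarrow> 0"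
      using s \<theta> less_imp_le[OF \<epsilon>(1)]
      by (intro tendsto_zero_powrI[of _ _ "\<lambda>_. s * (1 - \<theta>)" "s * (1 - \<theta>)"]) auto
    then show ?thesis unfolding \<eta>_def by (rule tendsto_mult_right_zero)
  qed
  have AB: "(\<lambda>k. Lpow M s (\<lambda>x. A (r k) j x - B j x)) \<longlonglongrightarrow> 0" for j
  proof -
    have "(\<lambda>k. LINT x|M. \<bar>A (r k) j x - B j x\<bar> powr s) \<longlonglongrightarrow> (LINT x|M. 0)"
    proof (rule integral_dominated_convergence[where w = "\<lambda>_. (2 * L / v j) powr s"])
      show "AE x in M. (\<lambda>k. \<bar>A (r k) j x - B j x\<bar> powr s) \<longlonglongrightarrow> 0"
      proof (rule AE_I2)
        fix x assume "x \<in> space M"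
        then have "(\<lambda>k. A (r k) j x - B j x) \<longlonglongrightarrow> 0" using lim[of x j] LIM_zero[of _ "B j x"] by (simp add: spM)
        then show "(\<lambda>k. \<bar>A (r k) j x - B j x\<bar> powr s) \<longlonglongrightarrow> 0"
          using s by (intro tendsto_zero_powrI[of _ _ "\<lambda>_. s" s]) (auto intro: tendsto_rabs_zero)
      qed
      show "AE x in M. norm (\<bar>A (r k) j x - B j x\<bar> powr s) \<le> (2 * L / v j) powr s" for k
      proof (rule AE_I2)
        fix x assume "x \<in> space M"
        then have "\<bar>A (r k) j x - B j x\<bar> \<le> 2 * L / v j"
          using Ab[of x "r k" j] Bb[of x j] by (simp add: spM)
        then show "norm (\<bar>A (r k) j x - B j x\<bar> powr s) \<le> (2 * L / v j) powr s"
          using s by (simp add: powr_mono2)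
      qed
    qed auto
    then show ?thesis by (simp add: Lpow_def)
  qed
  obtain C where C: "C \<ge> 0" "\<And>(M :: (real^'n) measure) f g h. in_L M s f \<Longrightarrow> in_L M s g \<Longrightarrow> in_L M s h \<Longrightarrow>
      Lpow M s (\<lambda>x. f x - h x) \<le> (1 + 1) * Lpow M s (\<lambda>x. f x - g x) + C * Lpow M s (\<lambda>x. g x - h x)"
    by (rule Lpow_triangle[OF s zero_less_one, where ?'a = "real^'n"]) blast
  \<comment> \<open>\<open>j\<close> is fixed first, by uniform approximation, and only then
    \<open>k\<close> and \<open>l\<close>. The chain runs through \<open>U (r k)\<close>,
    \<open>A (r k) j\<close>, \<open>B j\<close>, \<open>A (r l) j\<close>, \<open>U (r l)\<close>;
    every further link picks up a factor \<open>C\<close>, whence the powers of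
    \<open>C\<close>.\<close>
  have Cauchy: "\<exists>m. \<forall>k\<ge>m. \<forall>l\<ge>m. Lpow M s (\<lambda>x. U (r k) x - U (r l) x) < e" if e: "e > 0" for e
  proof -
    have "(\<lambda>j. 2 * \<eta> j + C * (C * (C * \<eta> j))) \<longlonglongrightarrow> 2 * 0 + C * (C * (C * 0))"
      by (intro tendsto_add tendsto_mult tendsto_const \<eta>0)
    then have "eventually (\<lambda>j. 2 * \<eta> j + C * (C * (C * \<eta> j)) < e / 2) sequentially"
      by (rule order_tendstoD) (use e in simp)
    then obtain j where j: "2 * \<eta> j + C * (C * (C * \<eta> j)) < e / 2"
      by (auto simp: eventually_sequentially)
    let ?d = "\<lambda>k. Lpow M s (\<lambda>x. A (r k) j x - B j x)"
    have "(\<lambda>k. (C * 2 + C * C * 2) * ?d k) \<longlonglongrightarrow> (C * 2 + C * C * 2) * 0"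
      by (intro tendsto_mult tendsto_const AB)
    then have "eventually (\<lambda>k. (C * 2 + C * C * 2) * ?d k < e / 4) sequentially"
      by (rule order_tendstoD) (use e in simp)
    then obtain m where m: "\<And>k. k \<ge> m \<Longrightarrow> (C * 2 + C * C * 2) * ?d k < e / 4"
      by (auto simp: eventually_sequentially)
    have "Lpow M s (\<lambda>x. U (r k) x - U (r l) x) < e" if kl: "k \<ge> m" "l \<ge> m" for k l
    proof -
      have "Lpow M s (\<lambda>x. U (r k) x - U (r l) x)
        \<le> 2 * Lpow M s (\<lambda>x. U (r k) x - A (r k) j x) + C * Lpow M s (\<lambda>x. A (r k) j x - U (r l) x)"
        using C(2)[OF UL AL UL] by simp
      also have "\<dots> \<le> 2 * \<eta> j + C * (2 * ?d k + C * (2 * ?d l + C * \<eta> j))"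
      proof (intro add_mono mult_left_mono)
        show "Lpow M s (\<lambda>x. U (r k) x - A (r k) j x) \<le> \<eta> j" by (rule UA)
        have "Lpow M s (\<lambda>x. A (r k) j x - U (r l) x) \<le> 2 * ?d k + C * Lpow M s (\<lambda>x. B j x - U (r l) x)"
          using C(2)[OF AL BL UL] by simp
        also have "\<dots> \<le> 2 * ?d k + C * (2 * ?d l + C * \<eta> j)"
        proof (intro add_mono mult_left_mono order_refl)
          have "Lpow M s (\<lambda>x. B j x - U (r l) x)
            \<le> 2 * Lpow M s (\<lambda>x. B j x - A (r l) j x) + C * Lpow M s (\<lambda>x. A (r l) j x - U (r l) x)"
            using C(2)[OF BL AL UL] by simp
          also have "\<dots> \<le> 2 * ?d l + C * \<eta> j"
            using UA(2)[of "r l" j] C(1)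
            by (subst (1 2) Lpow_minus_commute) (intro add_mono mult_left_mono, auto)
          finally show "Lpow M s (\<lambda>x. B j x - U (r l) x) \<le> 2 * ?d l + C * \<eta> j" .
        qed (use C(1) in auto)
        finally show "Lpow M s (\<lambda>x. A (r k) j x - U (r l) x) \<le> 2 * ?d k + C * (2 * ?d l + C * \<eta> j)" .
      qed (use C in auto)
      also have "\<dots> = (2 * \<eta> j + C * (C * (C * \<eta> j))) + (C * 2 * ?d k + C * C * 2 * ?d l)"
        by (simp add: algebra_simps)
      also have "\<dots> \<le> (2 * \<eta> j + C * (C * (C * \<eta> j))) + ((C * 2 + C * C * 2) * ?d k + (C * 2 + C * C * 2) * ?d l)"
        using C(1) by (intro add_left_mono add_mono[OF mult_right_mono mult_right_mono]) auto
      also have "\<dots> < e" using j m[OF kl(1)] m[OF kl(2)] by linarith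
      finally show ?thesis .
    qed
    then show ?thesis by blast
  qed
  obtain u r' where "in_L M s u" "(\<lambda>k. Lpow M s (\<lambda>x. U (r k) x - u x)) \<longlonglongrightarrow> 0"
    by (rule Lpow_complete[where f = "\<lambda>k. U (r k)" and M = M and p = s, OF UL s Cauchy])
  then show ?thesis using that[OF UL[unfolded M_def] r] by (simp add: M_def)
qed

lemma AE_lebesgue_on:
  "AE x in lebesgue. P x \<Longrightarrow> \<Omega> \<in> sets lebesgue \<Longrightarrow> AE x in lebesgue_on \<Omega>. P x"
  by (simp add: AE_restrict_space_iff) (erule AE_mp, simp)

text \<open>Composition with \<open>x + t *\<^sub>R h\<close> and Fubini are carried out for Borel
  functions; a change on null sets alters neither the weak gradient nor the integrals. The vector
  field is treated by components.\<close>

lemma borel_representative: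
  fixes U :: "real^'n \<Rightarrow> real" and G :: "real^'n \<Rightarrow> real^'n"
  assumes U: "U \<in> borel_measurable lebesgue" and G: "G \<in> borel_measurable lebesgue"
    and wg: "weak_gradient UNIV U G"
  obtains U' G' where "U' \<in> borel_measurable borel" "G' \<in> borel_measurable borel"
    "AE x in lebesgue. U x = U' x" "AE x in lebesgue. G x = G' x" "weak_gradient UNIV U' G'"
proof -
  have rep: "\<exists>f'. f' \<in> borel_measurable borel \<and> (AE x in lebesgue. f x = f' x)"
    if f: "f \<in> borel_measurable lebesgue" for f :: "real^'n \<Rightarrow> real"
  proof -
    obtain f' where "f' \<in> borel_measurable lborel" "AE x in lborel. f x = f' x"
      using completion_ex_borel_measurable_real[OF f] by blast
    then show ?thesis by (intro exI[of _ f']) (auto intro: AE_completion)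
  qed
  obtain U' where U': "U' \<in> borel_measurable borel" "AE x in lebesgue. U x = U' x" using rep[OF U] by blast
  have "\<forall>i. \<exists>f'. f' \<in> borel_measurable borel \<and> (AE x in lebesgue. G x $ i = f' x)"
  proof
    fix i
    have "(\<lambda>x. G x \<bullet> axis i 1) \<in> borel_measurable lebesgue" using G by simp
    then have "(\<lambda>x. G x $ i) \<in> borel_measurable lebesgue" by (simp add: inner_axis)
    then show "\<exists>f'. f' \<in> borel_measurable borel \<and> (AE x in lebesgue. G x $ i = f' x)" by (rule rep)
  qed
  then obtain g where g: "\<And>i. g i \<in> borel_measurable borel" "\<And>i. AE x in lebesgue. G x $ i = g i x" by metis
  define G' where "G' x = (\<chi> i. g i x)" for x
  have G'm: "G' \<in> borel_measurable borel"
    using g(1) by (subst borel_measurable_euclidean_space) (auto simp: Basis_vec_def inner_axis G'_def)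
  have "AE x in lebesgue. \<forall>i\<in>UNIV. G x $ i = g i x"
    using g(2) by (subst AE_ball_countable) auto
  then have G'e: "AE x in lebesgue. G x = G' x"
    by eventually_elim (simp add: G'_def vec_eq_iff)
  have "weak_gradient UNIV U' G'"
    unfolding weak_gradient_def
  proof (intro conjI allI impI)
    fix K :: "(real^'n) set" assume "compact K \<and> K \<subseteq> UNIV"
    then have K: "compact K" "K \<in> sets lebesgue" by (auto simp: lmeasurable_compact fmeasurableD)
    have "AE x in lebesgue_on K. U x = U' x" "AE x in lebesgue_on K. G x = G' x"
      using AE_lebesgue_on[OF U'(2) K(2)] AE_lebesgue_on[OF G'e K(2)] by simp_all
    then show "integrable (lebesgue_on K) U'" "integrable (lebesgue_on K) G'"
      using integral_cong_AE_complete(1)[of U U' K] integral_cong_AE_complete(1)[of G G' K]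
        K weak_gradient_integrable[OF wg K(1)] by auto
  next
    fix \<phi> :: "real^'n \<Rightarrow> real" assume \<phi>: "test_function UNIV \<phi>"
    have "AE x in lebesgue_on UNIV. U x *\<^sub>R grad \<phi> x = U' x *\<^sub>R grad \<phi> x"
      "AE x in lebesgue_on UNIV. \<phi> x *\<^sub>R G x = \<phi> x *\<^sub>R G' x"
      unfolding lebesgue_on_UNIV_eq by (use U'(2) in eventually_elim, simp) (use G'e in eventually_elim, simp)
    then show "(LINT x|lebesgue_on UNIV. U' x *\<^sub>R grad \<phi> x) = - (LINT x|lebesgue_on UNIV. \<phi> x *\<^sub>R G' x)"
      using weak_gradient_eq[OF wg \<phi>] integral_cong_AE_complete(2)[of "\<lambda>x. U x *\<^sub>R grad \<phi> x" "\<lambda>x. U' x *\<^sub>R grad \<phi> x" UNIV]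
        integral_cong_AE_complete(2)[of "\<lambda>x. \<phi> x *\<^sub>R G x" "\<lambda>x. \<phi> x *\<^sub>R G' x" UNIV] by simp
  qed
  then show ?thesis by (rule that[OF U'(1) G'm U'(2) G'e])
qed

lemma Rellich:
  fixes U :: "nat \<Rightarrow> real^'n \<Rightarrow> real" and G :: "nat \<Rightarrow> real^'n \<Rightarrow> real^'n" and \<sigma> N :: real
  defines "\<theta> \<equiv> real CARD('n) * (\<sigma> - 1) / \<sigma>" and "s \<equiv> \<sigma> / (2 - \<sigma>)"
  assumes \<Omega>: "\<Omega> \<in> sets lebesgue" "bounded \<Omega>"
    and \<sigma>: "1 < \<sigma>" "\<sigma> < 2" and \<theta>: "\<theta> < 1" and N0: "N \<ge> 0"
    and wg: "\<And>k. weak_gradient UNIV (U k) (G k)"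
    and U: "\<And>k. U k \<in> Lp \<sigma> UNIV" and G: "\<And>k. G k \<in> Lp \<sigma> UNIV"
    and UN: "\<And>k. (LINT x|lebesgue_on UNIV. norm (U k x) powr \<sigma>) \<le> N"
    and GN: "\<And>k. (LINT x|lebesgue_on UNIV. norm (G k x) powr \<sigma>) \<le> N"
  obtains r u where "\<And>k. in_L (lebesgue_on \<Omega>) s (U k)" "strict_mono (r :: nat \<Rightarrow> nat)"
    "in_L (lebesgue_on \<Omega>) s u" "(\<lambda>k. Lpow (lebesgue_on \<Omega>) s (\<lambda>x. U (r k) x - u x)) \<longlonglongrightarrow> 0"
proof -
  have "\<forall>k. \<exists>U' G'. U' \<in> borel_measurable borel \<and> G' \<in> borel_measurable borel \<and>
    (AE x in lebesgue. U k x = U' x) \<and> (AE x in lebesgue. G k x = G' x) \<and> weak_gradient UNIV U' G'"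
  proof
    fix k
    have "U k \<in> borel_measurable lebesgue" "G k \<in> borel_measurable lebesgue"
      using U[of k] G[of k] by (auto simp: Lp_def lebesgue_on_UNIV_eq)
    then show "\<exists>U' G'. U' \<in> borel_measurable borel \<and> G' \<in> borel_measurable borel \<and>
      (AE x in lebesgue. U k x = U' x) \<and> (AE x in lebesgue. G k x = G' x) \<and> weak_gradient UNIV U' G'"
      by (rule borel_representative[OF _ _ wg[of k]]) blast
  qed
  then obtain U' G' where m: "\<And>k. U' k \<in> borel_measurable borel" "\<And>k. G' k \<in> borel_measurable borel"
    and ae: "\<And>k. AE x in lebesgue. U k x = U' k x" "\<And>k. AE x in lebesgue. G k x = G' k x"
    and wg': "\<And>k. weak_gradient UNIV (U' k) (G' k)"
    unfolding choice_iff by blast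
  have nn: "(\<integral>\<^sup>+x. ennreal (norm (f' x) powr \<sigma>) \<partial>lborel) \<le> ennreal N"
    if f: "f \<in> Lp \<sigma> UNIV" "(LINT x|lebesgue_on UNIV. norm (f x) powr \<sigma>) \<le> N"
      and ae: "AE x in lebesgue. f x = f' x"
    for f f' :: "real^'n \<Rightarrow> 'z::euclidean_space"
  proof -
    have "(\<integral>\<^sup>+x. ennreal (norm (f' x) powr \<sigma>) \<partial>lborel) = (\<integral>\<^sup>+x. ennreal (norm (f' x) powr \<sigma>) \<partial>lebesgue)"
      by (rule nn_integral_completion[symmetric])
    also have "\<dots> = (\<integral>\<^sup>+x. ennreal (norm (f x) powr \<sigma>) \<partial>lebesgue)"
      by (rule nn_integral_cong_AE) (use ae in eventually_elim, simp)
    also have "\<dots> = ennreal (LINT x|lebesgue. norm (f x) powr \<sigma>)"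
      using f(1) by (intro nn_integral_eq_integral) (auto simp: Lp_def lebesgue_on_UNIV_eq)
    also have "\<dots> \<le> ennreal N" using f(2) by (intro ennreal_leI) (simp add: lebesgue_on_UNIV_eq)
    finally show ?thesis .
  qed
  have UN': "(\<integral>\<^sup>+x. ennreal (\<bar>U' k x\<bar> powr \<sigma>) \<partial>lborel) \<le> ennreal N" for k
    using nn[OF U UN ae(1), of k] by simp
  have GN': "(\<integral>\<^sup>+x. ennreal (norm (G' k x) powr \<sigma>) \<partial>lborel) \<le> ennreal N" for k
    using nn[OF G GN ae(2), of k] .
  obtain r u where ru: "\<And>k. in_L (lebesgue_on \<Omega>) s (U' k)" "strict_mono (r :: nat \<Rightarrow> nat)"
    "in_L (lebesgue_on \<Omega>) s u" "(\<lambda>k. Lpow (lebesgue_on \<Omega>) s (\<lambda>x. U' (r k) x - u x)) \<longlonglongrightarrow> 0"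
    by (rule Rellich_borel[where U = U' and G = G', OF \<Omega> \<sigma> \<theta>[unfolded \<theta>_def] N0 wg' m UN' GN', folded s_def]) blast
  have ae\<Omega>: "AE x in lebesgue_on \<Omega>. U k x = U' k x" for k
    by (rule AE_lebesgue_on[OF ae(1) \<Omega>(1)])
  have Um: "U k \<in> borel_measurable (lebesgue_on \<Omega>)" for k
    using U[of k] by (auto simp: Lp_def lebesgue_on_UNIV_eq intro: measurable_restrict_space1)
  have UL: "in_L (lebesgue_on \<Omega>) s (U k)" for k
    by (rule in_L_cong_AE[OF _ Um ru(1)]) (use ae\<Omega>[of k] in eventually_elim, simp)
  have "Lpow (lebesgue_on \<Omega>) s (\<lambda>x. U (r k) x - u x) = Lpow (lebesgue_on \<Omega>) s (\<lambda>x. U' (r k) x - u x)" for k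
  proof (rule Lpow_cong_AE)
    show "AE x in lebesgue_on \<Omega>. U (r k) x - u x = U' (r k) x - u x"
      using ae\<Omega>[of "r k"] by eventually_elim simp
  qed (intro borel_measurable_diff Um in_L_measurable[OF ru(1)] in_L_measurable[OF ru(3)])+
  then show ?thesis using that[OF UL ru(2,3)] ru(4) by simp
qed

section \<open>Measures with an integrable density\<close>

text \<open>Signed measures are plain real set functions here, whereas \<open>density\<close> with
  \<open>ennreal\<close> sees only the positive part of f.\<close>

definition density_set_function :: "(real^'n \<Rightarrow> real) \<Rightarrow> (real^'n) set \<Rightarrow> real" where
  "density_set_function f A = (LINT x|lborel. indicator A x * f x)"

lemma
  fixes f :: "real^'n \<Rightarrow> real"
  assumes f: "integrable lborel f"
  shows finite_measure_density_pos: "finite_measure (density lborel (\<lambda>x. ennreal (f x)))"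
    and measure_density_pos: "A \<in> sets borel \<Longrightarrow>
      measure (density lborel (\<lambda>x. ennreal (f x))) A = (LINT x|lborel. indicator A x * max 0 (f x))"
proof -
  have [measurable]: "f \<in> borel_measurable borel" using f by simp
  have e: "(\<lambda>x. ennreal (f x)) = (\<lambda>x. ennreal (max 0 (f x)))"
    by (auto simp: max_def ennreal_neg)
  have i: "integrable lborel (\<lambda>x. max 0 (f x))" using f by (intro integrable_max) auto
  have em: "emeasure (density lborel (\<lambda>x. ennreal (f x))) A = ennreal (LINT x|lborel. indicator A x * max 0 (f x))"
    if A: "A \<in> sets borel" for A
  proof -
    have "integrable lborel (\<lambda>x. indicator A x *\<^sub>R max 0 (f x))"
      using i A by (intro integrable_mult_indicator) auto
    then have "(\<integral>\<^sup>+x. ennreal (indicator A x * max 0 (f x)) \<partial>lborel) = ennreal (LINT x|lborel. indicator A x * max 0 (f x))"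
      by (intro nn_integral_eq_integral) auto
    moreover have "emeasure (density lborel (\<lambda>x. ennreal (f x))) A = (\<integral>\<^sup>+x. ennreal (indicator A x * max 0 (f x)) \<partial>lborel)"
      unfolding e using A by (subst emeasure_density) (auto intro!: nn_integral_cong simp: indicator_def)
    ultimately show ?thesis by simp
  qed
  show "finite_measure (density lborel (\<lambda>x. ennreal (f x)))"
    using em[of UNIV] by (intro finite_measureI) simp
  show "measure (density lborel (\<lambda>x. ennreal (f x))) A = (LINT x|lborel. indicator A x * max 0 (f x))"
    if "A \<in> sets borel"
    unfolding measure_def em[OF that] by (intro enn2real_ennreal integral_nonneg) auto
qed

text \<open>The Jordan decomposition: \<open>ennreal\<close> cuts f and -f down to the positive and
  the negative part. Countable additivity is then inherited from two finite measures.\<close>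

lemma density_set_function_eq:
  fixes f :: "real^'n \<Rightarrow> real"
  assumes f: "integrable lborel f" and A: "A \<in> sets borel"
  shows "density_set_function f A = measure (density lborel (\<lambda>x. ennreal (f x))) A
    - measure (density lborel (\<lambda>x. ennreal (- f x))) A"
proof -
  have i: "integrable lborel (\<lambda>x. indicator A x *\<^sub>R max 0 (f x))" "integrable lborel (\<lambda>x. indicator A x *\<^sub>R max 0 (- f x))"
    using f A by (auto intro!: integrable_mult_indicator integrable_max simp del: real_scaleR_def)
  have "measure (density lborel (\<lambda>x. ennreal (f x))) A - measure (density lborel (\<lambda>x. ennreal (- f x))) A
    = (LINT x|lborel. indicator A x * max 0 (f x)) - (LINT x|lborel. indicator A x * max 0 (- f x))"
    using measure_density_pos[OF f A] measure_density_pos[OF integrable_minus[OF f] A] by simp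
  also have "\<dots> = (LINT x|lborel. indicator A x * max 0 (f x) - indicator A x * max 0 (- f x))"
    using i by (subst Bochner_Integration.integral_diff) auto
  also have "\<dots> = density_set_function f A"
    unfolding density_set_function_def
    by (intro Bochner_Integration.integral_cong refl) (auto simp: max_def indicator_def)
  finally show ?thesis by simp
qed

lemma signed_borel_measure_density:
  fixes f :: "real^'n \<Rightarrow> real"
  assumes f: "integrable lborel f" and K: "closed K"
  shows "signed_borel_measure K (density_set_function f)"
  unfolding signed_borel_measure_def
proof (intro conjI allI impI)
  show "density_set_function f {} = 0" by (simp add: density_set_function_def)
next
  fix A :: "nat \<Rightarrow> (real^'n) set"
  assume A: "range A \<subseteq> sets (restrict_space borel K) \<and> disjoint_family A"
  have Am: "A i \<in> sets borel" for i
  proof -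
    have "A i \<in> sets (restrict_space borel K)" using A by auto
    then show ?thesis using K by (simp add: sets_restrict_space_iff)
  qed
  have sums: "(\<lambda>i. measure (density lborel (\<lambda>x. ennreal (g x))) (A i)) sums measure (density lborel (\<lambda>x. ennreal (g x))) (\<Union>i. A i)"
    if "integrable lborel g" for g :: "real^'n \<Rightarrow> real"
  proof -
    interpret finite_measure "density lborel (\<lambda>x. ennreal (g x))"
      using that by (rule finite_measure_density_pos)
    show ?thesis using Am A by (intro finite_measure_UNION) auto
  qed
  have "(\<lambda>i. measure (density lborel (\<lambda>x. ennreal (f x))) (A i) - measure (density lborel (\<lambda>x. ennreal (- f x))) (A i))
    sums (measure (density lborel (\<lambda>x. ennreal (f x))) (\<Union>i. A i) - measure (density lborel (\<lambda>x. ennreal (- f x))) (\<Union>i. A i))"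
    by (intro sums_diff sums integrable_minus f)
  moreover have "(\<Union>i. A i) \<in> sets borel" using Am by auto
  ultimately show "(\<lambda>i. density_set_function f (A i)) sums density_set_function f (\<Union>i. A i)"
    using Am by (simp add: density_set_function_eq[OF f])
qed

text \<open>The supremum in the positive variation is attained on the positivity set of the density.\<close>

lemma pos_variation_density:
  fixes f :: "real^'n \<Rightarrow> real"
  assumes f: "integrable lborel f" and K: "closed K"
  shows "pos_variation K (density_set_function f) = restrict_space (density lborel (\<lambda>x. ennreal (f x))) K"
proof -
  let ?P = "density lborel (\<lambda>x. ennreal (f x))" and ?N = "density lborel (\<lambda>x. ennreal (- f x))"
  let ?S = "sets (restrict_space borel K)"
  interpret P: finite_measure ?P using f by (rule finite_measure_density_pos)
  have [measurable]: "f \<in> borel_measurable borel" using f by simp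
  have borel: "A \<in> sets borel" if "A \<in> ?S" for A using that K by (auto simp: sets_restrict_space_iff)
  have SUP: "(SUP B\<in>{B \<in> ?S. B \<subseteq> A}. ennreal (density_set_function f B)) = emeasure ?P A" if A: "A \<in> ?S" for A
  proof (rule antisym)
    show "(SUP B\<in>{B \<in> ?S. B \<subseteq> A}. ennreal (density_set_function f B)) \<le> emeasure ?P A"
    proof (rule SUP_least)
      fix B assume B: "B \<in> {B \<in> ?S. B \<subseteq> A}"
      have "density_set_function f B \<le> measure ?P B"
        using density_set_function_eq[OF f borel] B by auto
      then have "ennreal (density_set_function f B) \<le> emeasure ?P B"
        by (simp add: P.emeasure_eq_measure ennreal_leI)
      also have "\<dots> \<le> emeasure ?P A" using B borel[OF A] by (intro emeasure_mono) auto
      finally show "ennreal (density_set_function f B) \<le> emeasure ?P A" .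
    qed
    define B where "B = A \<inter> {x. f x > 0}"
    have fp: "{x. f x > 0} \<in> sets borel" by measurable
    have Bb: "B \<in> sets borel" unfolding B_def using borel[OF A] fp by auto
    have B: "B \<in> ?S" "B \<subseteq> A"
      using A Bb K by (auto simp: sets_restrict_space_iff B_def)
    have "emeasure ?N B = 0"
    proof -
      have "(\<integral>\<^sup>+x. ennreal (- f x) * indicator B x \<partial>lborel) = (\<integral>\<^sup>+x. 0 \<partial>(lborel :: (real^'n) measure))"
        by (intro nn_integral_cong) (auto simp: B_def indicator_def ennreal_neg)
      then show ?thesis using Bb by (subst emeasure_density) auto
    qed
    then have N: "measure ?N B = 0" by (simp add: measure_def)
    have "emeasure ?P A = emeasure ?P B"
      using borel[OF A] Bb
      by (subst (1 2) emeasure_density) (auto intro!: nn_integral_cong simp: B_def indicator_def ennreal_neg not_less)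
    also have "\<dots> = ennreal (density_set_function f B)"
      using density_set_function_eq[OF f Bb] N by (simp add: P.emeasure_eq_measure)
    also have "\<dots> \<le> (SUP B\<in>{B \<in> ?S. B \<subseteq> A}. ennreal (density_set_function f B))"
      using B by (intro SUP_upper) auto
    finally show "emeasure ?P A \<le> (SUP B\<in>{B \<in> ?S. B \<subseteq> A}. ennreal (density_set_function f B))" .
  qed
  have spS: "?S \<subseteq> Pow K" using sets.sets_into_space[of _ "restrict_space borel K"] by (auto simp: space_restrict_space)
  have sig: "sigma_sets K ?S = ?S"
    using sets.sigma_sets_eq[of "restrict_space borel K"] by (simp add: space_restrict_space)
  have "pos_variation K (density_set_function f) = measure_of K ?S (emeasure ?P)"
    unfolding pos_variation_def by (rule measure_of_eq[OF spS]) (simp only: sig SUP)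
  also have "\<dots> = restrict_space ?P K"
    unfolding restrict_space_def[of ?P] by (simp add: sets_restrict_space)
  finally show ?thesis .
qed

text \<open>The two variations have the densities \<open>max 0 (f x)\<close> and
  \<open>max 0 (- f x)\<close>: their difference integrates \<phi> against f, their sum integrates 1
  against |f|. As f vanishes outside \<open>K\<close>, restriction to \<open>K\<close> loses
  nothing.\<close>

lemma
  fixes f :: "real^'n \<Rightarrow> real"
  assumes f: "integrable lborel f" and K: "compact K" and out: "\<And>x. x \<notin> K \<Longrightarrow> f x = 0"
  shows signed_integral_density:
      "continuous_on UNIV \<phi> \<Longrightarrow> signed_integral K (density_set_function f) \<phi> = (LINT x|lborel. f x * \<phi> x)"
    and total_variation_density:
      "total_variation_norm K (density_set_function f) = (LINT x|lborel. \<bar>f x\<bar>)"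
proof -
  have cl: "closed K" using K by (rule compact_imp_closed)
  then have Kb[measurable]: "K \<in> sets borel" by simp
  have neg: "(\<lambda>A. - density_set_function f A) = density_set_function (\<lambda>x. - f x)"
    by (simp add: density_set_function_def fun_eq_iff)
  have f': "integrable lborel (\<lambda>x. - f x)" using f by simp
  have out': "\<And>x. x \<notin> K \<Longrightarrow> - f x = 0" using out by simp
  {
    assume \<phi>: "continuous_on UNIV \<phi>"
    have \<phi>m[measurable]: "\<phi> \<in> borel_measurable borel" using \<phi> by (rule borel_measurable_continuous_onI)
    have "bounded (\<phi> ` K)"
      by (rule compact_imp_bounded[OF compact_continuous_image[OF continuous_on_subset[OF \<phi> subset_UNIV] K]])
    then obtain B where "\<forall>y\<in>\<phi> ` K. norm y \<le> B" unfolding bounded_iff by (rule exE)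
    then have B: "\<And>x. x \<in> K \<Longrightarrow> \<bar>\<phi> x\<bar> \<le> B" by auto
    have pos: "(LINT x|pos_variation K (density_set_function g). \<phi> x) = (LINT x|lborel. max 0 (g x) * \<phi> x)"
      "integrable lborel (\<lambda>x. max 0 (g x) * \<phi> x)"
      if g: "integrable lborel g" and g0: "\<And>x. x \<notin> K \<Longrightarrow> g x = 0" for g
    proof -
      have [measurable]: "g \<in> borel_measurable borel" using g by simp
      have e: "(\<lambda>x. ennreal (g x)) = (\<lambda>x. ennreal (max 0 (g x)))" by (auto simp: max_def ennreal_neg)
      have "(LINT x|pos_variation K (density_set_function g). \<phi> x)
        = (LINT x|density lborel (\<lambda>x. ennreal (max 0 (g x))). indicator K x *\<^sub>R \<phi> x)"
        unfolding pos_variation_density[OF g cl] e by (subst integral_restrict_space) auto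
      also have "\<dots> = (LINT x|lborel. max 0 (g x) *\<^sub>R (indicator K x *\<^sub>R \<phi> x))"
        by (subst integral_density) auto
      also have "\<dots> = (LINT x|lborel. max 0 (g x) * \<phi> x)"
        using g0 by (intro Bochner_Integration.integral_cong refl) (auto simp: indicator_def)
      finally show "(LINT x|pos_variation K (density_set_function g). \<phi> x) = (LINT x|lborel. max 0 (g x) * \<phi> x)" .
      show "integrable lborel (\<lambda>x. max 0 (g x) * \<phi> x)"
      proof (rule integrable_bounded_mult[OF g, where B = B])
        show "AE x in lborel. norm (max 0 (g x) * \<phi> x) \<le> B * norm (g x)"
        proof (rule AE_I2)
          fix x
          show "norm (max 0 (g x) * \<phi> x) \<le> B * norm (g x)"
          proof (cases "x \<in> K")
            case True
            have "\<bar>max 0 (g x)\<bar> * \<bar>\<phi> x\<bar> \<le> \<bar>g x\<bar> * B" by (rule mult_mono) (use B[OF True] in auto)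
            then show ?thesis by (simp add: abs_mult mult.commute)
          qed (use g0 in simp)
        qed
      qed simp
    qed
    have "signed_integral K (density_set_function f) \<phi>
      = (LINT x|lborel. max 0 (f x) * \<phi> x) - (LINT x|lborel. max 0 (- f x) * \<phi> x)"
      using pos(1)[OF f out] pos(1)[OF f' out'] by (simp add: signed_integral_def neg)
    then show "signed_integral K (density_set_function f) \<phi> = (LINT x|lborel. f x * \<phi> x)"
      by (simp only:, subst Bochner_Integration.integral_diff[OF pos(2)[OF f out] pos(2)[OF f' out'], symmetric])
        (auto intro!: Bochner_Integration.integral_cong simp: max_def algebra_simps)
  }
  have m: "measure (pos_variation K (density_set_function g)) K = (LINT x|lborel. max 0 (g x))"
    if g: "integrable lborel g" and g0: "\<And>x. x \<notin> K \<Longrightarrow> g x = 0" for g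
  proof -
    have "measure (pos_variation K (density_set_function g)) K = measure (density lborel (\<lambda>x. ennreal (g x))) K"
      unfolding pos_variation_density[OF g cl] by (rule measure_restrict_space) auto
    also have "\<dots> = (LINT x|lborel. max 0 (g x))"
      unfolding measure_density_pos[OF g Kb]
      using g0 by (intro Bochner_Integration.integral_cong refl) (auto simp: indicator_def)
    finally show ?thesis .
  qed
  have "total_variation_norm K (density_set_function f)
    = (LINT x|lborel. max 0 (f x)) + (LINT x|lborel. max 0 (- f x))"
    using m[OF f out] m[OF f' out'] by (simp add: total_variation_norm_def neg)
  also have "\<dots> = (LINT x|lborel. max 0 (f x) + max 0 (- f x))"
    using f by (intro Bochner_Integration.integral_add[symmetric] integrable_max) auto
  also have "\<dots> = (LINT x|lborel. \<bar>f x\<bar>)"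
    by (intro Bochner_Integration.integral_cong refl) (auto simp: max_def)
  finally show "total_variation_norm K (density_set_function f) = (LINT x|lborel. \<bar>f x\<bar>)" .
qed

text \<open>Turns an \<open>L^1\<close> right-hand side into a datum to which well-posedness
  applies, with total variation equal to its \<open>L^1\<close> norm. The density is a Borel
  representative extended by 0.\<close>

lemma density_measure_exists:
  fixes f :: "real^'n \<Rightarrow> real"
  assumes \<Omega>: "open \<Omega>" "bounded \<Omega>" and f: "integrable (lebesgue_on \<Omega>) f"
  obtains \<nu> where "signed_borel_measure (closure \<Omega>) \<nu>"
    "\<And>\<phi>. continuous_on UNIV \<phi> \<Longrightarrow> signed_integral (closure \<Omega>) \<nu> \<phi> = (LINT x|lebesgue_on \<Omega>. f x * \<phi> x)"
    "total_variation_norm (closure \<Omega>) \<nu> = (LINT x|lebesgue_on \<Omega>. \<bar>f x\<bar>)"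
proof -
  have \<Omega>b: "\<Omega> \<in> sets borel" "\<Omega> \<in> sets lebesgue" using \<Omega> by auto
  have F: "integrable lebesgue (\<lambda>x. indicator \<Omega> x * f x)"
    using f \<Omega>b by (simp add: integrable_restrict_space)
  obtain g0 where g0: "g0 \<in> borel_measurable lborel" "AE x in lborel. indicator \<Omega> x * f x = g0 x"
    using completion_ex_borel_measurable_real[OF borel_measurable_integrable[OF F]] by blast
  define g where "g x = indicator \<Omega> x * g0 x" for x
  have gm: "g \<in> borel_measurable lborel" using g0(1) \<Omega>b unfolding g_def by simp
  have ae: "AE x in lebesgue. indicator \<Omega> x * f x = g x"
    using AE_completion[OF g0(2)] by eventually_elim (auto simp: g_def indicator_def)
  have gm': "g \<in> borel_measurable lebesgue" using gm by (rule measurable_completion)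
  have "integrable lebesgue g"
    using F integrable_cong_AE[OF borel_measurable_integrable[OF F] gm' ae] by simp
  then have g: "integrable lborel g" using gm by (simp add: integrable_completion)
  have out: "g x = 0" if "x \<notin> closure \<Omega>" for x
    using that closure_subset[of \<Omega>] by (auto simp: g_def indicator_def)
  have K: "compact (closure \<Omega>)" using \<Omega>(2) by (simp add: compact_closure)
  \<comment> \<open>Stated for any \<open>h\<close> vanishing at 0, to cover the integral against
    \<phi> and that of the modulus at once.\<close>
  have int: "(LINT x|lborel. h (g x) x) = (LINT x|lebesgue_on \<Omega>. h (f x) x)"
    if h: "(\<lambda>x. h (g x) x) \<in> borel_measurable lborel" "\<And>x. h 0 x = 0" for h :: "real \<Rightarrow> real^'n \<Rightarrow> real"
  proof -
    have "(LINT x|lebesgue_on \<Omega>. h (f x) x) = (LINT x|lebesgue_on \<Omega>. h (g x) x)"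
    proof (rule integral_cong_AE_complete(2)[OF _ \<Omega>b(2)])
      show "AE x in lebesgue_on \<Omega>. h (f x) x = h (g x) x"
        using AE_lebesgue_on[OF ae \<Omega>b(2)] AE_space
        by eventually_elim (auto simp: indicator_def)
    qed
    also have "\<dots> = (LINT x|lebesgue. indicator \<Omega> x *\<^sub>R h (g x) x)"
      using \<Omega>b by (simp add: integral_restrict_space)
    also have "\<dots> = (LINT x|lebesgue. h (g x) x)"
      using h(2) by (intro Bochner_Integration.integral_cong refl) (auto simp: g_def indicator_def)
    also have "\<dots> = (LINT x|lborel. h (g x) x)" using h(1) by (rule integral_completion)
    finally show ?thesis by simp
  qed
  show ?thesis
  proof
    show "signed_borel_measure (closure \<Omega>) (density_set_function g)"
      using g by (rule signed_borel_measure_density) simp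
    show "signed_integral (closure \<Omega>) (density_set_function g) \<phi> = (LINT x|lebesgue_on \<Omega>. f x * \<phi> x)"
      if \<phi>: "continuous_on UNIV \<phi>" for \<phi>
    proof -
      have "(\<lambda>x. g x * \<phi> x) \<in> borel_measurable lborel"
        using gm borel_measurable_continuous_onI[OF \<phi>] by simp
      then show ?thesis
        using signed_integral_density[OF g K out \<phi>] int[of "\<lambda>t x. t * \<phi> x"] by simp
    qed
    have "(\<lambda>x. \<bar>g x\<bar>) \<in> borel_measurable lborel" using gm by simp
    then show "total_variation_norm (closure \<Omega>) (density_set_function g) = (LINT x|lebesgue_on \<Omega>. \<bar>f x\<bar>)"
      using total_variation_density[OF g K out] int[of "\<lambda>t x. \<bar>t\<bar>"] by simp
  qed
qed

section \<open>Sobolev functions on a domain\<close>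

lemma Lp_iff_in_L: "f \<in> Lp p \<Omega> \<longleftrightarrow> in_L (lebesgue_on \<Omega>) p f" for f :: "real^'n \<Rightarrow> real"
  by (simp add: Lp_def in_L_def)

lemma Lp_norm_eq: "Lp_norm p \<Omega> f = Lpow (lebesgue_on \<Omega>) p f powr (1 / p)" for f :: "real^'n \<Rightarrow> real"
  by (simp add: Lp_norm_def Lpow_def)

lemma Lp_1_iff: "f \<in> Lp 1 \<Omega> \<longleftrightarrow> integrable (lebesgue_on \<Omega>) f" for f :: "real^'n \<Rightarrow> 'b::euclidean_space"
  by (auto simp: Lp_def intro: integrable_norm_cancel dest: borel_measurable_integrable)

lemma Lp_lincomb:
  fixes f g :: "real^'n \<Rightarrow> 'b::euclidean_space"
  assumes \<tau>: "\<tau> > 0" and f: "f \<in> Lp \<tau> \<Omega>" and g: "g \<in> Lp \<tau> \<Omega>"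
  shows "(\<lambda>x. c *\<^sub>R f x + d *\<^sub>R g x) \<in> Lp \<tau> \<Omega>"
proof -
  have fg: "in_L (lebesgue_on \<Omega>) \<tau> (\<lambda>x. norm (f x))" "in_L (lebesgue_on \<Omega>) \<tau> (\<lambda>x. norm (g x))"
    using f g by (auto simp: Lp_def in_L_def)
  have "in_L (lebesgue_on \<Omega>) \<tau> (\<lambda>x. \<bar>c\<bar> * norm (f x) + \<bar>d\<bar> * norm (g x))"
    using \<tau> fg by (intro in_L_add in_L_cmult)
  then have i: "integrable (lebesgue_on \<Omega>) (\<lambda>x. \<bar>\<bar>c\<bar> * norm (f x) + \<bar>d\<bar> * norm (g x)\<bar> powr \<tau>)"
    by (rule in_L_integrable)
  have m: "(\<lambda>x. c *\<^sub>R f x + d *\<^sub>R g x) \<in> borel_measurable (lebesgue_on \<Omega>)"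
    using f g by (auto simp: Lp_def)
  have "norm (norm (c *\<^sub>R f x + d *\<^sub>R g x) powr \<tau>) \<le> norm (\<bar>\<bar>c\<bar> * norm (f x) + \<bar>d\<bar> * norm (g x)\<bar> powr \<tau>)" for x
    using norm_triangle_ineq[of "c *\<^sub>R f x" "d *\<^sub>R g x"] \<tau> by (auto intro!: powr_mono2)
  then have "integrable (lebesgue_on \<Omega>) (\<lambda>x. norm (c *\<^sub>R f x + d *\<^sub>R g x) powr \<tau>)"
    using m by (intro Bochner_Integration.integrable_bound[OF i]) auto
  then show ?thesis using m by (simp add: Lp_def)
qed

lemma H1_cases:
  assumes "u \<in> H1 \<tau> \<Omega>"
  obtains U g where "U \<in> Lp \<tau> UNIV" "AE x in lebesgue_on \<Omega>. U x = u x"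
    "g \<in> Lp \<tau> UNIV" "weak_gradient UNIV U g"
proof -
  obtain U where U: "U \<in> H1_extensions \<tau> \<Omega> u" using assms unfolding H1_def by blast
  then have "U \<in> Lp \<tau> UNIV" "AE x in lebesgue_on \<Omega>. U x = u x" "\<exists>g\<in>Lp \<tau> UNIV. weak_gradient UNIV U g"
    unfolding H1_extensions_def H1_whole_def by blast+
  then show ?thesis using that by blast
qed

lemma H1_lincomb:
  fixes u v :: "real^'n \<Rightarrow> real"
  assumes \<tau>: "\<tau> > 0" and u: "u \<in> H1 \<tau> \<Omega>" and v: "v \<in> H1 \<tau> \<Omega>"
  shows "(\<lambda>x. c * u x + d * v x) \<in> H1 \<tau> \<Omega>"
proof -
  obtain U g where U: "U \<in> Lp \<tau> UNIV" "AE x in lebesgue_on \<Omega>. U x = u x"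
    and g: "g \<in> Lp \<tau> UNIV" "weak_gradient UNIV U g"
    using u by (rule H1_cases)
  obtain V h where V: "V \<in> Lp \<tau> UNIV" "AE x in lebesgue_on \<Omega>. V x = v x"
    and h: "h \<in> Lp \<tau> UNIV" "weak_gradient UNIV V h"
    using v by (rule H1_cases)
  have "(\<lambda>x. c * U x + d * V x) \<in> H1_whole \<tau>"
    unfolding H1_whole_def
  proof (intro CollectI conjI bexI)
    show "weak_gradient UNIV (\<lambda>x. c * U x + d * V x) (\<lambda>x. c *\<^sub>R g x + d *\<^sub>R h x)"
      by (rule weak_gradient_linear[OF _ g(2) h(2)]) simp
    show "(\<lambda>x. c * U x + d * V x) \<in> Lp \<tau> UNIV"
      using Lp_lincomb[OF \<tau> U(1) V(1), of c d] by simp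
  qed (rule Lp_lincomb[OF \<tau> g(1) h(1)])
  moreover have "AE x in lebesgue_on \<Omega>. c * U x + d * V x = c * u x + d * v x"
    using U(2) V(2) by eventually_elim simp
  ultimately have "(\<lambda>x. c * U x + d * V x) \<in> H1_extensions \<tau> \<Omega> (\<lambda>x. c * u x + d * v x)"
    unfolding H1_extensions_def by (intro CollectI conjI)
  then show ?thesis unfolding H1_def by blast
qed

lemma weak_gradient_cong_AE:
  fixes u v :: "real^'n \<Rightarrow> real"
  assumes \<Omega>: "\<Omega> \<in> sets lebesgue" and ae: "AE x in lebesgue_on \<Omega>. u x = v x" and u: "weak_gradient \<Omega> u g"
  shows "weak_gradient \<Omega> v g"
  unfolding weak_gradient_def
proof (intro conjI allI impI)
  fix K assume "compact K \<and> K \<subseteq> \<Omega>"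
  then have K: "compact K" "K \<subseteq> \<Omega>" "K \<in> sets lebesgue" by (auto simp: lmeasurable_compact fmeasurableD)
  have "AE x in lebesgue_on K. u x = v x" by (rule AE_lebesgue_on_subset[OF ae K(2,3) \<Omega>])
  then show "integrable (lebesgue_on K) v"
    using integral_cong_AE_complete(1)[of u v K] K weak_gradient_integrable(1)[OF u K(1,2)] by simp
  show "integrable (lebesgue_on K) g" by (rule weak_gradient_integrable(2)[OF u K(1,2)])
next
  fix \<phi> assume \<phi>: "test_function \<Omega> \<phi>"
  have "AE x in lebesgue_on \<Omega>. u x *\<^sub>R grad \<phi> x = v x *\<^sub>R grad \<phi> x" using ae by eventually_elim simp
  then show "(LINT x|lebesgue_on \<Omega>. v x *\<^sub>R grad \<phi> x) = - (LINT x|lebesgue_on \<Omega>. \<phi> x *\<^sub>R g x)"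
    using weak_gradient_eq[OF u \<phi>] integral_cong_AE_complete(2)[of "\<lambda>x. u x *\<^sub>R grad \<phi> x" "\<lambda>x. v x *\<^sub>R grad \<phi> x" \<Omega>] \<Omega>
    by simp
qed

lemma weak_gradient_wgrad: "weak_gradient \<Omega> u g \<Longrightarrow> weak_gradient \<Omega> u (wgrad \<Omega> u)"
  unfolding wgrad_def by (rule someI[where P = "weak_gradient \<Omega> u"])

text \<open>\<open>wgrad\<close> is an arbitrary choice among weak gradients; its integrability is
  imported, through uniqueness, from the gradient of an extension to the whole space.\<close>

lemma H1_wgrad:
  fixes u :: "real^'n \<Rightarrow> real"
  assumes \<Omega>: "open \<Omega>" and u: "u \<in> H1 1 \<Omega>"
  shows "weak_gradient \<Omega> u (wgrad \<Omega> u)" "integrable (lebesgue_on \<Omega>) (wgrad \<Omega> u)"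
proof -
  have \<Omega>m: "\<Omega> \<in> sets lebesgue" using \<Omega> by simp
  obtain U g where U: "U \<in> Lp 1 UNIV" "AE x in lebesgue_on \<Omega>. U x = u x"
    and g: "g \<in> Lp 1 UNIV" "weak_gradient UNIV U g"
    using u by (rule H1_cases)
  have sub: "integrable (lebesgue_on \<Omega>) f" if "f \<in> Lp 1 UNIV" for f :: "real^'n \<Rightarrow> 'z::euclidean_space"
  proof -
    have "integrable lebesgue f" using that by (simp add: Lp_1_iff lebesgue_on_UNIV_eq)
    then show ?thesis using \<Omega>m by (simp add: integrable_restrict_space integrable_mult_indicator)
  qed
  have "weak_gradient \<Omega> U g" by (rule weak_gradient_restrict[OF g(2) _ \<Omega>m]) auto
  then have ug: "weak_gradient \<Omega> u g" by (rule weak_gradient_cong_AE[OF \<Omega>m U(2)])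
  then show w: "weak_gradient \<Omega> u (wgrad \<Omega> u)" by (rule weak_gradient_wgrad)
  have "AE x in lebesgue_on \<Omega>. g x = wgrad \<Omega> u x" by (rule weak_gradient_unique[OF \<Omega> ug w])
  then show "integrable (lebesgue_on \<Omega>) (wgrad \<Omega> u)"
    using integral_cong_AE_complete(1)[OF _ \<Omega>m, of g "wgrad \<Omega> u"] sub[OF g(1)] by simp
qed

lemma H1_norm_nonneg: "u \<in> H1 \<tau> \<Omega> \<Longrightarrow> H1_norm \<tau> \<Omega> u \<ge> 0"
  unfolding H1_norm_def H1_def by (intro cINF_greatest) (auto simp: H1_whole_norm_def)

text \<open>The norm is an infimum over extensions that need not be attained, hence the strict bound
  in the hypothesis. A near-optimal extension inherits it, which replaces an extension
  operator.\<close>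

lemma H1_extension_bound:
  fixes u :: "real^'n \<Rightarrow> real"
  assumes \<tau>: "\<tau> \<ge> 1" and u: "u \<in> H1 \<tau> \<Omega>" and B: "H1_norm \<tau> \<Omega> u < B"
  obtains U g where "U \<in> Lp \<tau> UNIV" "g \<in> Lp \<tau> UNIV" "weak_gradient UNIV U g" "AE x in lebesgue_on \<Omega>. U x = u x"
    "(LINT x|lebesgue_on UNIV. norm (U x) powr \<tau>) \<le> B powr \<tau>"
    "(LINT x|lebesgue_on UNIV. norm (g x) powr \<tau>) \<le> B powr \<tau>"
proof -
  have ne: "H1_extensions \<tau> \<Omega> u \<noteq> {}" using u by (simp add: H1_def)
  have "bdd_below (H1_whole_norm \<tau> ` H1_extensions \<tau> \<Omega> u)"
    by (intro bdd_belowI[of _ 0]) (auto simp: H1_whole_norm_def)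
  then obtain U where U: "U \<in> H1_extensions \<tau> \<Omega> u" "H1_whole_norm \<tau> U < B"
    using B ne unfolding H1_norm_def by (auto simp: cINF_less_iff)
  obtain g0 where g0: "g0 \<in> Lp \<tau> UNIV" "weak_gradient UNIV U g0" and UL: "U \<in> Lp \<tau> UNIV"
    using U(1) by (auto simp: H1_extensions_def H1_whole_def)
  define g where "g = wgrad UNIV U"
  have g: "weak_gradient UNIV U g" unfolding g_def using g0(2) by (rule weak_gradient_wgrad)
  \<comment> \<open>Membership in the space provides \<open>g0\<close>, whereas the norm is computed
    with the chosen gradient \<open>g\<close>; uniqueness identifies them.\<close>
  have ae: "AE x in lebesgue_on UNIV. g0 x = g x" by (rule weak_gradient_unique[OF open_UNIV g0(2) g])
  have gL: "g \<in> Lp \<tau> UNIV"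
  proof -
    have "g \<in> borel_measurable (lebesgue_on UNIV)"
      by (rule borel_measurable_cong_AE_lebesgue_on[OF ae]) (use g0(1) in \<open>auto simp: Lp_def\<close>)
    moreover have "AE x in lebesgue_on UNIV. norm (g0 x) powr \<tau> = norm (g x) powr \<tau>"
      using ae by eventually_elim simp
    then have "integrable (lebesgue_on UNIV) (\<lambda>x. norm (g x) powr \<tau>)"
      using g0(1) integral_cong_AE_complete(1)[of "\<lambda>x. norm (g0 x) powr \<tau>" "\<lambda>x. norm (g x) powr \<tau>" UNIV]
      by (simp add: Lp_def)
    ultimately show ?thesis by (simp add: Lp_def)
  qed
  define A where "A = (LINT x|lebesgue_on UNIV. norm (U x) powr \<tau>)"
  define E where "E = (LINT x|lebesgue_on UNIV. norm (g x) powr \<tau>)"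
  have AE0: "A \<ge> 0" "E \<ge> 0" by (auto simp: A_def E_def)
  have "H1_whole_norm \<tau> U = (A + E) powr (1 / \<tau>)"
    unfolding H1_whole_norm_def Lp_norm_def g_def[symmetric] A_def[symmetric] E_def[symmetric]
    using \<tau> AE0 by (simp add: powr_powr)
  then have "(A + E) powr (1 / \<tau>) \<le> B" using U(2) by simp
  then have "((A + E) powr (1 / \<tau>)) powr \<tau> \<le> B powr \<tau>" using \<tau> by (intro powr_mono2) auto
  then have "A + E \<le> B powr \<tau>" using \<tau> AE0 by (simp add: powr_powr)
  then have "A \<le> B powr \<tau>" "E \<le> B powr \<tau>" using AE0 by linarith+
  then show ?thesis
    using that[OF UL gL g] U(1) by (simp add: A_def E_def H1_extensions_def)
qed

section \<open>Products and midpoint hulls\<close>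

text \<open>Hoelder's inequality in additive form: a factor that is merely bounded takes the small
  weight \<eta>, one that tends to 0 takes \<open>C\<close>. It is applied with p and s in either
  order.\<close>

lemma integrable_mult_in_L:
  fixes p s \<eta> :: real
  assumes p: "p > 1" and s: "s > 1" and ps: "1 / p + 1 / s = 1" and \<eta>: "\<eta> > 0"
  shows "\<exists>C\<ge>0. \<forall>(M :: 'a measure) f g. in_L M p f \<longrightarrow> in_L M s g \<longrightarrow>
    integrable M (\<lambda>x. f x * g x) \<and> (LINT x|M. \<bar>f x * g x\<bar>) \<le> \<eta> * Lpow M p f + C * Lpow M s g"
proof -
  obtain C where C: "C \<ge> 0" "\<And>x y :: real. \<bar>x * y\<bar> \<le> \<eta> * \<bar>x\<bar> powr p + C * \<bar>y\<bar> powr s"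
    using abs_mult_le_powr[OF p s ps \<eta>] by blast
  have "integrable M (\<lambda>x. f x * g x) \<and> (LINT x|M. \<bar>f x * g x\<bar>) \<le> \<eta> * Lpow M p f + C * Lpow M s g"
    if f: "in_L M p f" and g: "in_L M s g" for M :: "'a measure" and f g
  proof -
    have i: "integrable M (\<lambda>x. \<eta> * \<bar>f x\<bar> powr p + C * \<bar>g x\<bar> powr s)"
      using f g by (auto simp: in_L_def)
    have m: "(\<lambda>x. f x * g x) \<in> borel_measurable M" using f g by (auto simp: in_L_def)
    have 1: "integrable M (\<lambda>x. f x * g x)"
      by (rule Bochner_Integration.integrable_bound[OF i m], rule AE_I2)
        (simp only: real_norm_def, rule order_trans[OF C(2) abs_ge_self])
    moreover have "(LINT x|M. \<bar>f x * g x\<bar>) \<le> (LINT x|M. \<eta> * \<bar>f x\<bar> powr p + C * \<bar>g x\<bar> powr s)"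
      using 1 i C(2) by (intro integral_mono) auto
    moreover have "(LINT x|M. \<eta> * \<bar>f x\<bar> powr p + C * \<bar>g x\<bar> powr s) = \<eta> * Lpow M p f + C * Lpow M s g"
      unfolding Lpow_def using f g by (subst Bochner_Integration.integral_add) (auto simp: in_L_def)
    ultimately show ?thesis by simp
  qed
  then show ?thesis using C(1) by blast
qed

text \<open>Midpoints suffice, since the uniform convexity argument asks for nothing else;
  properties of the generators pass to the hull by an induction with weights 1/2.\<close>

inductive_set midpoint_hull :: "('a \<Rightarrow> real) set \<Rightarrow> ('a \<Rightarrow> real) set" for A where
  base: "f \<in> A \<Longrightarrow> f \<in> midpoint_hull A"
| mid: "f \<in> midpoint_hull A \<Longrightarrow> g \<in> midpoint_hull A \<Longrightarrow> (\<lambda>x. (f x + g x) / 2) \<in> midpoint_hull A"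

lemma midpoint_hull_mono: "A \<subseteq> B \<Longrightarrow> midpoint_hull A \<subseteq> midpoint_hull B"
proof
  fix f assume AB: "A \<subseteq> B" and "f \<in> midpoint_hull A"
  from this(2) show "f \<in> midpoint_hull B"
  proof (induction rule: midpoint_hull.induct)
    case (base f)
    then show ?case using AB by (intro midpoint_hull.base) blast
  next
    case (mid f g)
    show ?case by (rule midpoint_hull.mid) fact+
  qed
qed

section \<open>The elliptic problem\<close>

locale elliptic_problem =
  fixes \<Omega> :: "(real^'n) set" and \<kappa> a_star :: "real^'n \<Rightarrow> real" and \<mu> :: "(real^'n) set \<Rightarrow> real"
    and \<iota> :: "(real^'n \<Rightarrow> real) \<Rightarrow> 'y::banach" and c_up p q a_low M \<tau> :: real
  assumes n2: "CARD('n) \<ge> 2" and open_\<Omega>: "open \<Omega>" and bounded_\<Omega>: "bounded \<Omega>"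
    and \<kappa>m: "\<kappa> \<in> borel_measurable (lebesgue_on \<Omega>)"
    and \<kappa>b: "AE x in lebesgue_on \<Omega>. \<bar>\<kappa> x\<bar> \<le> c_up"
    and \<mu>: "signed_borel_measure (closure \<Omega>) \<mu>"
    and p_gt: "p > real CARD('n) / 2" and q_ge: "q \<ge> p" and M_pos: "M > 0"
    and wp: "well_posed \<Omega> \<kappa> (admissible_set \<Omega> q a_low M)"
    and \<tau>: "1 \<le> \<tau>" "\<tau> < crit_exp TYPE('n)" and emb: "H1_embedding \<tau> \<Omega> \<iota>"
    and a_star: "a_star \<in> Lp p \<Omega>"
begin

abbreviation "L \<equiv> lebesgue_on \<Omega>"
abbreviation "D \<equiv> admissible_set \<Omega> q a_low M"
abbreviation "S \<equiv> solution_operator \<Omega> \<kappa> \<mu> \<iota>"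

text \<open>The state before \<iota> is applied: the equation and products with coefficients need a
  function, not an element of the Banach space.\<close>

definition sol :: "(real^'n \<Rightarrow> real) \<Rightarrow> real^'n \<Rightarrow> real" where
  "sol a = (SOME u. regular_weak_solution \<Omega> \<kappa> \<mu> a u)"

definition regular :: "(real^'n \<Rightarrow> real) \<Rightarrow> bool" where
  "regular u \<longleftrightarrow> (\<forall>\<sigma>. 1 \<le> \<sigma> \<and> \<sigma> < crit_exp TYPE('n) \<longrightarrow> u \<in> H1 \<sigma> \<Omega>)"

definition energy :: "(real^'n \<Rightarrow> real) \<Rightarrow> (real^'n \<Rightarrow> real) \<Rightarrow> real" where
  "energy u \<phi> = (LINT x|L. \<kappa> x * (wgrad \<Omega> u x \<bullet> grad \<phi> x))"

text \<open>The equation with the zeroth-order term \<open>a u\<close> replaced by a given function \<open>f\<close>; unlike the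
  original problem it is linear in \<open>(u, f)\<close>, hence stable under midpoints.\<close>

definition solves :: "(real^'n \<Rightarrow> real) \<Rightarrow> (real^'n \<Rightarrow> real) \<Rightarrow> bool" where
  "solves u f \<longleftrightarrow> regular u \<and> integrable L f \<and>
     (\<forall>\<phi>. smooth \<phi> \<longrightarrow> energy u \<phi> + (LINT x|L. f x * \<phi> x) = signed_integral (closure \<Omega>) \<mu> \<phi>)"

section \<open>Linearity of the equation and stability of its solutions\<close>

lemma \<Omega>m: "\<Omega> \<in> sets lebesgue"
  using open_\<Omega> by simp

lemma finite_L: "finite_measure L"
  by (rule finite_measure_lebesgue_on[OF bounded_set_imp_lmeasurable[OF bounded_\<Omega> \<Omega>m]])

lemma p_gt_1: "p > 1"
  using p_gt n2 by simp

lemma regular_H1_1: "regular u \<Longrightarrow> u \<in> H1 1 \<Omega>"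
  unfolding regular_def using \<tau> by auto

lemma regular_H1_\<tau>: "regular u \<Longrightarrow> u \<in> H1 \<tau> \<Omega>"
  unfolding regular_def using \<tau> by auto

lemma regular_lincomb: "regular u \<Longrightarrow> regular v \<Longrightarrow> regular (\<lambda>x. c * u x + d * v x)"
  unfolding regular_def by (auto intro!: H1_lincomb)

lemma bounded_continuous_\<Omega>:
  fixes f :: "real^'n \<Rightarrow> 'z::real_normed_vector"
  assumes "continuous_on UNIV f"
  obtains B where "\<And>x. x \<in> \<Omega> \<Longrightarrow> norm (f x) \<le> B"
proof -
  have K: "compact (closure \<Omega>)" using bounded_\<Omega> by (simp add: compact_closure)
  have "bounded (f ` closure \<Omega>)"
    by (rule compact_imp_bounded[OF compact_continuous_image[OF continuous_on_subset[OF assms subset_UNIV] K]])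
  then obtain B where "\<forall>y\<in>f ` closure \<Omega>. norm y \<le> B" unfolding bounded_iff by (rule exE)
  then show ?thesis using that[of B] closure_subset[of \<Omega>] by auto
qed

lemma integrable_mult_smooth:
  assumes \<phi>: "smooth \<phi>" and f: "integrable L f"
  shows "integrable L (\<lambda>x. f x * \<phi> x)"
proof -
  have c: "continuous_on UNIV \<phi>" using \<phi> by (rule smooth_continuous)
  obtain B where B: "\<And>x. x \<in> \<Omega> \<Longrightarrow> norm (\<phi> x) \<le> B" using bounded_continuous_\<Omega>[OF c] by blast
  show ?thesis
  proof (rule integrable_bounded_mult[OF f, where B = B])
    show "(\<lambda>x. f x * \<phi> x) \<in> borel_measurable L"
      using borel_measurable_integrable[OF f] continuous_measurable_lebesgue_on[OF c]
      by (rule borel_measurable_times)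
    show "AE x in L. norm (f x * \<phi> x) \<le> B * norm (f x)"
      using B by (intro AE_I2) (auto simp: abs_mult mult.commute intro!: mult_right_mono)
  qed
qed

lemma integrable_energy:
  assumes \<phi>: "smooth \<phi>" and g: "integrable L g"
  shows "integrable L (\<lambda>x. \<kappa> x * (g x \<bullet> grad \<phi> x))"
proof -
  have c: "continuous_on UNIV (grad \<phi>)" using \<phi> by (rule smooth_continuous_grad)
  obtain B where B: "\<And>x. x \<in> \<Omega> \<Longrightarrow> norm (grad \<phi> x) \<le> B" using bounded_continuous_\<Omega>[OF c] by blast
  show ?thesis
  proof (rule integrable_bounded_mult[OF g, where B = "\<bar>c_up\<bar> * \<bar>B\<bar>"])
    show "(\<lambda>x. \<kappa> x * (g x \<bullet> grad \<phi> x)) \<in> borel_measurable L"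
      using borel_measurable_integrable[OF g] continuous_measurable_lebesgue_on[OF c] \<kappa>m
      by (intro borel_measurable_times borel_measurable_inner)
    show "AE x in L. norm (\<kappa> x * (g x \<bullet> grad \<phi> x)) \<le> \<bar>c_up\<bar> * \<bar>B\<bar> * norm (g x)"
      using \<kappa>b AE_space
    proof eventually_elim
      case (elim x)
      have "\<bar>g x \<bullet> grad \<phi> x\<bar> \<le> norm (g x) * norm (grad \<phi> x)" by (rule Cauchy_Schwarz_ineq2)
      also have "\<dots> \<le> norm (g x) * \<bar>B\<bar>" using B[of x] elim(2) by (intro mult_left_mono) auto
      finally have "\<bar>\<kappa> x\<bar> * \<bar>g x \<bullet> grad \<phi> x\<bar> \<le> \<bar>c_up\<bar> * (norm (g x) * \<bar>B\<bar>)"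
        using elim(1) by (intro mult_mono) auto
      then show ?case by (simp add: abs_mult mult_ac)
    qed
  qed
qed

text \<open>\<open>wgrad\<close> is chosen separately for each function, so it is linear only almost
  everywhere, by uniqueness of weak gradients.\<close>

lemma energy_lincomb:
  assumes u: "u \<in> H1 1 \<Omega>" and v: "v \<in> H1 1 \<Omega>" and \<phi>: "smooth \<phi>"
  shows "energy (\<lambda>x. c * u x + d * v x) \<phi> = c * energy u \<phi> + d * energy v \<phi>"
proof -
  let ?w = "\<lambda>x. c * u x + d * v x"
  have w: "?w \<in> H1 1 \<Omega>" using u v by (intro H1_lincomb) auto
  have "AE x in L. wgrad \<Omega> ?w x = c *\<^sub>R wgrad \<Omega> u x + d *\<^sub>R wgrad \<Omega> v x"
    by (rule weak_gradient_unique[OF open_\<Omega> H1_wgrad(1)[OF open_\<Omega> w]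
        weak_gradient_linear[OF \<Omega>m H1_wgrad(1)[OF open_\<Omega> u] H1_wgrad(1)[OF open_\<Omega> v]]])
  then have "AE x in L. \<kappa> x * (wgrad \<Omega> ?w x \<bullet> grad \<phi> x)
    = c * (\<kappa> x * (wgrad \<Omega> u x \<bullet> grad \<phi> x)) + d * (\<kappa> x * (wgrad \<Omega> v x \<bullet> grad \<phi> x))"
    by eventually_elim (simp add: inner_add_left algebra_simps)
  then have "energy ?w \<phi> = (LINT x|L. c * (\<kappa> x * (wgrad \<Omega> u x \<bullet> grad \<phi> x)) + d * (\<kappa> x * (wgrad \<Omega> v x \<bullet> grad \<phi> x)))"
    unfolding energy_def by (rule integral_cong_AE_complete(2)[OF _ \<Omega>m])
  also have "\<dots> = c * energy u \<phi> + d * energy v \<phi>"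
    unfolding energy_def
    using integrable_energy[OF \<phi> H1_wgrad(2)[OF open_\<Omega> u]] integrable_energy[OF \<phi> H1_wgrad(2)[OF open_\<Omega> v]]
    by (subst Bochner_Integration.integral_add) auto
  finally show ?thesis .
qed

lemma solves_midpoint:
  assumes u: "solves u f" and v: "solves v g"
  shows "solves (\<lambda>x. (u x + v x) / 2) (\<lambda>x. (f x + g x) / 2)"
proof -
  have uv: "regular u" "regular v" and fg: "integrable L f" "integrable L g" using u v by (auto simp: solves_def)
  have e: "(\<lambda>x. (u x + v x) / 2) = (\<lambda>x. (1/2) * u x + (1/2) * v x)" by (auto simp: field_simps)
  have "energy (\<lambda>x. (u x + v x) / 2) \<phi> + (LINT x|L. (f x + g x) / 2 * \<phi> x) = signed_integral (closure \<Omega>) \<mu> \<phi>"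
    if \<phi>: "smooth \<phi>" for \<phi>
  proof -
    have "(LINT x|L. (f x + g x) / 2 * \<phi> x) = (LINT x|L. (f x * \<phi> x) / 2 + (g x * \<phi> x) / 2)"
      by (simp add: field_simps)
    also have "\<dots> = (LINT x|L. f x * \<phi> x) / 2 + (LINT x|L. g x * \<phi> x) / 2"
      using integrable_mult_smooth[OF \<phi> fg(1)] integrable_mult_smooth[OF \<phi> fg(2)]
      by (subst Bochner_Integration.integral_add) auto
    finally have i: "(LINT x|L. (f x + g x) / 2 * \<phi> x) = (LINT x|L. f x * \<phi> x) / 2 + (LINT x|L. g x * \<phi> x) / 2" .
    have E: "energy (\<lambda>x. (u x + v x) / 2) \<phi> = (1/2) * energy u \<phi> + (1/2) * energy v \<phi>"
      unfolding e by (rule energy_lincomb[OF regular_H1_1[OF uv(1)] regular_H1_1[OF uv(2)] \<phi>])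
    have "energy u \<phi> + (LINT x|L. f x * \<phi> x) = signed_integral (closure \<Omega>) \<mu> \<phi>"
      "energy v \<phi> + (LINT x|L. g x * \<phi> x) = signed_integral (closure \<Omega>) \<mu> \<phi>"
      using u v \<phi> by (auto simp: solves_def)
    then show ?thesis unfolding E i by argo
  qed
  moreover have "regular (\<lambda>x. (u x + v x) / 2)" unfolding e using uv by (rule regular_lincomb)
  ultimately show ?thesis using fg by (simp add: solves_def)
qed

lemma sol_regular_weak:
  assumes "a \<in> D"
  shows "regular_weak_solution \<Omega> \<kappa> \<mu> a (sol a)"
proof -
  have "\<exists>u. regular_weak_solution \<Omega> \<kappa> \<mu> a u" using wp \<mu> assms unfolding well_posed_def by blast
  then show ?thesis unfolding sol_def by (rule someI_ex)
qed

lemma sol_solves: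
  assumes "a \<in> D"
  shows "solves (sol a) (\<lambda>x. a x * sol a x)"
proof -
  have w: "weak_solution \<Omega> \<kappa> \<mu> a (sol a)" and r: "regular (sol a)"
    using sol_regular_weak[OF assms] by (auto simp: regular_weak_solution_def regular_def)
  have i: "integrable L (\<lambda>x. a x * sol a x)" using w by (simp add: weak_solution_def Lp_1_iff)
  have "energy (sol a) \<phi> + (LINT x|L. a x * sol a x * \<phi> x) = signed_integral (closure \<Omega>) \<mu> \<phi>"
    if \<phi>: "smooth \<phi>" for \<phi>
  proof -
    have "(LINT x|L. \<kappa> x * (wgrad \<Omega> (sol a) x \<bullet> grad \<phi> x) + a x * sol a x * \<phi> x)
      = energy (sol a) \<phi> + (LINT x|L. a x * sol a x * \<phi> x)"
      unfolding energy_def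
      by (rule Bochner_Integration.integral_add[OF integrable_energy[OF \<phi> H1_wgrad(2)[OF open_\<Omega> regular_H1_1[OF r]]]
            integrable_mult_smooth[OF \<phi> i]])
    moreover have "(LINT x|L. \<kappa> x * (wgrad \<Omega> (sol a) x \<bullet> grad \<phi> x) + a x * sol a x * \<phi> x)
      = signed_integral (closure \<Omega>) \<mu> \<phi>"
      using w \<phi> unfolding weak_solution_def by blast
    ultimately show ?thesis by simp
  qed
  then show ?thesis using r i by (simp add: solves_def)
qed

lemma \<iota>_add: "u \<in> H1 \<tau> \<Omega> \<Longrightarrow> v \<in> H1 \<tau> \<Omega> \<Longrightarrow> \<iota> (\<lambda>x. u x + v x) = \<iota> u + \<iota> v"
  using emb unfolding H1_embedding_def by simp

lemma \<iota>_lincomb: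
  assumes "u \<in> H1 \<tau> \<Omega>" "v \<in> H1 \<tau> \<Omega>"
  shows "\<iota> (\<lambda>x. c * u x + d * v x) = c *\<^sub>R \<iota> u + d *\<^sub>R \<iota> v"
proof -
  have s: "(\<lambda>x. b * w x) \<in> H1 \<tau> \<Omega>" if "w \<in> H1 \<tau> \<Omega>" for b w
    using H1_lincomb[of \<tau> w \<Omega> w b 0] that \<tau> by simp
  have "\<iota> (\<lambda>x. c * u x + d * v x) = \<iota> (\<lambda>x. c * u x) + \<iota> (\<lambda>x. d * v x)"
    by (rule \<iota>_add[OF s[OF assms(1)] s[OF assms(2)]])
  also have "\<dots> = c *\<^sub>R \<iota> u + d *\<^sub>R \<iota> v" using emb assms unfolding H1_embedding_def by simp
  finally show ?thesis .
qed

text \<open>The difference \<open>w - sol a\<close> is a weak solution for the coefficient \<open>a\<close> whose datum is the measure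
  with density \<open>a w - f\<close>, so the uniform bound of the well-posedness theorem applies.\<close>

lemma stability:
  "\<exists>K\<ge>0. \<forall>a\<in>D. \<forall>w f. solves w f \<longrightarrow> integrable L (\<lambda>x. a x * w x) \<longrightarrow>
     norm (\<iota> w - S a) \<le> K * (LINT x|L. \<bar>a x * w x - f x\<bar>)"
proof -
  obtain C where C: "\<And>\<mu> a u. signed_borel_measure (closure \<Omega>) \<mu> \<and> a \<in> D \<and> regular_weak_solution \<Omega> \<kappa> \<mu> a u \<Longrightarrow>
      H1_norm \<tau> \<Omega> u \<le> C * total_variation_norm (closure \<Omega>) \<mu>"
    using wp \<tau> unfolding well_posed_def by blast
  obtain C' where C': "\<And>u. u \<in> H1 \<tau> \<Omega> \<Longrightarrow> norm (\<iota> u) \<le> C' * H1_norm \<tau> \<Omega> u"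
    using emb unfolding H1_embedding_def by blast
  \<comment> \<open>The constants of the embedding and of the well-posedness bound come without a
    sign, hence the absolute values.\<close>
  have "norm (\<iota> w - S a) \<le> (\<bar>C'\<bar> * \<bar>C\<bar>) * (LINT x|L. \<bar>a x * w x - f x\<bar>)"
    if a: "a \<in> D" and w: "solves w f" and aw: "integrable L (\<lambda>x. a x * w x)" for a w f
  proof -
    define u where "u = sol a"
    have u: "solves u (\<lambda>x. a x * u x)" unfolding u_def using a by (rule sol_solves)
    have r: "regular w" "regular u" and i: "integrable L f" "integrable L (\<lambda>x. a x * u x)"
      using u w by (auto simp: solves_def)
    \<comment> \<open>Written with coefficients 1 and -1 to match the form of
      \<open>regular_lincomb\<close>, \<open>energy_lincomb\<close> and
      \<open>\<iota>_lincomb\<close>.\<close>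
    define v where "v = (\<lambda>x. 1 * w x + (- 1) * u x)"
    have rv: "regular v" unfolding v_def using r by (rule regular_lincomb)
    have av: "integrable L (\<lambda>x. a x * v x)"
      using Bochner_Integration.integrable_diff[OF aw i(2)] by (simp add: v_def algebra_simps)
    define g where "g x = a x * w x - f x" for x
    have g: "integrable L g" unfolding g_def using aw i(1) by auto
    obtain \<nu> where \<nu>: "signed_borel_measure (closure \<Omega>) \<nu>"
      "\<And>\<phi>. continuous_on UNIV \<phi> \<Longrightarrow> signed_integral (closure \<Omega>) \<nu> \<phi> = (LINT x|L. g x * \<phi> x)"
      "total_variation_norm (closure \<Omega>) \<nu> = (LINT x|L. \<bar>g x\<bar>)"
      by (rule density_measure_exists[OF open_\<Omega> bounded_\<Omega> g]) blast
    have "(LINT x|L. \<kappa> x * (wgrad \<Omega> v x \<bullet> grad \<phi> x) + a x * v x * \<phi> x) = signed_integral (closure \<Omega>) \<nu> \<phi>"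
      if \<phi>: "smooth \<phi>" for \<phi>
    proof -
      have "(LINT x|L. \<kappa> x * (wgrad \<Omega> v x \<bullet> grad \<phi> x) + a x * v x * \<phi> x) = energy v \<phi> + (LINT x|L. a x * v x * \<phi> x)"
        unfolding energy_def
        using integrable_energy[OF \<phi> H1_wgrad(2)[OF open_\<Omega> regular_H1_1[OF rv]]] integrable_mult_smooth[OF \<phi> av]
        by (rule Bochner_Integration.integral_add)
      also have "energy v \<phi> = 1 * energy w \<phi> + (- 1) * energy u \<phi>"
        unfolding v_def by (rule energy_lincomb[OF regular_H1_1[OF r(1)] regular_H1_1[OF r(2)] \<phi>])
      \<comment> \<open>The datum \<open>\<mu>\<close> cancels in the difference of the two
        equations.\<close>
      also have "\<dots> = (LINT x|L. a x * u x * \<phi> x) - (LINT x|L. f x * \<phi> x)"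
        using u w \<phi> by (simp add: solves_def algebra_simps)
      also have "(LINT x|L. a x * v x * \<phi> x) = (LINT x|L. a x * w x * \<phi> x - a x * u x * \<phi> x)"
        by (simp add: v_def algebra_simps)
      also have "\<dots> = (LINT x|L. a x * w x * \<phi> x) - (LINT x|L. a x * u x * \<phi> x)"
        using integrable_mult_smooth[OF \<phi> aw] integrable_mult_smooth[OF \<phi> i(2)] by simp
      also have "(LINT x|L. a x * u x * \<phi> x) - (LINT x|L. f x * \<phi> x) + ((LINT x|L. a x * w x * \<phi> x) - (LINT x|L. a x * u x * \<phi> x))
        = (LINT x|L. a x * w x * \<phi> x) - (LINT x|L. f x * \<phi> x)" by simp
      also have "\<dots> = (LINT x|L. g x * \<phi> x)"
        using integrable_mult_smooth[OF \<phi> aw] integrable_mult_smooth[OF \<phi> i(1)]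
        by (simp add: g_def left_diff_distrib)
      also have "\<dots> = signed_integral (closure \<Omega>) \<nu> \<phi>" by (rule \<nu>(2)[OF smooth_continuous[OF \<phi>], symmetric])
      finally show ?thesis .
    qed
    then have "regular_weak_solution \<Omega> \<kappa> \<nu> a v"
      using rv regular_H1_1[OF rv] av
      by (simp add: regular_weak_solution_def weak_solution_def Lp_1_iff regular_def)
    then have "H1_norm \<tau> \<Omega> v \<le> C * (LINT x|L. \<bar>g x\<bar>)"
      using C[of \<nu> a v] \<nu>(1,3) a by simp
    also have "\<dots> \<le> \<bar>C\<bar> * (LINT x|L. \<bar>g x\<bar>)" by (intro mult_right_mono) auto
    finally have Hv: "H1_norm \<tau> \<Omega> v \<le> \<bar>C\<bar> * (LINT x|L. \<bar>g x\<bar>)" .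
    have "\<iota> v = \<iota> w - S a"
      unfolding v_def \<iota>_lincomb[OF regular_H1_\<tau>[OF r(1)] regular_H1_\<tau>[OF r(2)]]
      by (simp add: solution_operator_def u_def sol_def)
    then have "norm (\<iota> w - S a) \<le> C' * H1_norm \<tau> \<Omega> v" using C'[OF regular_H1_\<tau>[OF rv]] by simp
    also have "\<dots> \<le> \<bar>C'\<bar> * H1_norm \<tau> \<Omega> v"
      using H1_norm_nonneg[OF regular_H1_\<tau>[OF rv]] by (intro mult_right_mono) auto
    also have "\<dots> \<le> \<bar>C'\<bar> * (\<bar>C\<bar> * (LINT x|L. \<bar>g x\<bar>))" by (intro mult_left_mono Hv) auto
    finally show ?thesis by (simp add: g_def mult.assoc)
  qed
  then show ?thesis by (intro exI[of _ "\<bar>C'\<bar> * \<bar>C\<bar>"]) auto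
qed

section \<open>The exponents attached to p\<close>

definition s :: real where "s = p / (p - 1)"

lemma s_gt_1: "s > 1" and conjugate: "1 / p + 1 / s = 1" "1 / s + 1 / p = 1"
  using p_gt_1 by (auto simp: s_def field_simps)

text \<open>The exponent \<open>\<sigma> < n / (n - 1)\<close> for which \<open>H1 \<sigma>\<close> embeds compactly into \<open>L\<^sup>s\<close>, where \<open>s\<close> is conjugate
  to \<open>p\<close>; this is where \<open>p > n / 2\<close> enters.\<close>

definition \<sigma> :: real where "\<sigma> = 2 * s / (s + 1)"

lemma \<sigma>: "1 < \<sigma>" "\<sigma> < 2" "\<sigma> / (2 - \<sigma>) = s" "real CARD('n) * (\<sigma> - 1) / \<sigma> < 1" "\<sigma> < crit_exp TYPE('n)"
proof -
  have s: "s > 1" by (rule s_gt_1)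
  show 1: "1 < \<sigma>" "\<sigma> < 2" using s by (auto simp: \<sigma>_def field_simps)
  have "2 - \<sigma> = 2 / (s + 1)" using s by (simp add: \<sigma>_def field_simps)
  then show "\<sigma> / (2 - \<sigma>) = s" using s by (simp add: \<sigma>_def)
  have "\<sigma> - 1 = (s - 1) / (s + 1)" using s by (simp add: \<sigma>_def field_simps)
  then have "(\<sigma> - 1) / \<sigma> = ((s - 1) / (s + 1)) / (2 * s / (s + 1))" by (simp add: \<sigma>_def)
  also have "\<dots> = (s - 1) / (2 * s)" using s by simp
  also have "\<dots> = (1 - 1 / s) / 2" using s by (simp add: field_simps)
  also have "\<dots> = 1 / (2 * p)" using conjugate(1) p_gt_1 by (simp add: field_simps)
  \<comment> \<open>This identity turns the integrability condition \<theta> < 1 of the potential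
    estimate into n / (2 p) < 1.\<close>
  finally have e: "(\<sigma> - 1) / \<sigma> = 1 / (2 * p)" .
  have "real CARD('n) * (\<sigma> - 1) / \<sigma> = real CARD('n) * ((\<sigma> - 1) / \<sigma>)" by simp
  also have "\<dots> < 1" unfolding e using p_gt p_gt_1 by (simp add: field_simps)
  finally show *: "real CARD('n) * (\<sigma> - 1) / \<sigma> < 1" .
  have "real CARD('n) * (\<sigma> - 1) < \<sigma>" using * 1 by (simp add: field_simps)
  then have "\<sigma> * (real CARD('n) - 1) < real CARD('n)" by (simp add: algebra_simps)
  moreover have "real CARD('n) - 1 > 0" using n2 by simp
  ultimately show "\<sigma> < crit_exp TYPE('n)" by (simp add: pos_less_divide_eq)
qed

section \<open>The admissible set\<close>

lemma D_iff: "a \<in> D \<longleftrightarrow> in_L L q a \<and> Lpow L q a \<le> M powr q \<and> (AE x in L. a_low \<le> a x)"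
proof -
  have q: "q > 0" using q_ge p_gt_1 by simp
  have "Lpow L q a powr (1 / q) \<le> M \<longleftrightarrow> Lpow L q a \<le> M powr q"
  proof
    assume "Lpow L q a powr (1 / q) \<le> M"
    then have "(Lpow L q a powr (1 / q)) powr q \<le> M powr q" using q by (intro powr_mono2) auto
    then show "Lpow L q a \<le> M powr q" using q by (simp add: powr_powr)
  next
    assume "Lpow L q a \<le> M powr q"
    then have "Lpow L q a powr (1 / q) \<le> (M powr q) powr (1 / q)" using q by (intro powr_mono2) auto
    then show "Lpow L q a powr (1 / q) \<le> M" using q M_pos by (simp add: powr_powr)
  qed
  then show ?thesis by (simp add: admissible_set_def Lp_iff_in_L Lp_norm_eq)
qed

lemma D_in_Lp:
  assumes "a \<in> D"
  shows "in_L L p a" "Lpow L p a \<le> measure L \<Omega> + M powr q"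
proof -
  interpret finite_measure L by (rule finite_L)
  have a: "in_L L q a" "Lpow L q a \<le> M powr q" using assms by (auto simp: D_iff)
  have le: "\<bar>t\<bar> powr p \<le> 1 + \<bar>t\<bar> powr q" for t :: real
  proof (cases "\<bar>t\<bar> \<ge> 1")
    case True
    then show ?thesis using powr_mono[OF q_ge, of "\<bar>t\<bar>"] by simp
  next
    case False
    then have "\<bar>t\<bar> powr p \<le> 1" using p_gt_1 by (intro powr_le1) auto
    then show ?thesis by (simp add: add_increasing2)
  qed
  have i: "integrable L (\<lambda>x. 1 + \<bar>a x\<bar> powr q)" using a by (auto simp: in_L_def)
  have m: "a \<in> borel_measurable L" using a by (simp add: in_L_def)
  show "in_L L p a" using le by (intro in_L_bound(1)[OF m i] AE_I2)
  have "Lpow L p a \<le> (LINT x|L. 1 + \<bar>a x\<bar> powr q)" using le by (intro in_L_bound(2)[OF m i] AE_I2)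
  also have "\<dots> = measure L \<Omega> + Lpow L q a"
    unfolding Lpow_def using in_L_integrable[OF a(1)] by (subst Bochner_Integration.integral_add) auto
  finally show "Lpow L p a \<le> measure L \<Omega> + M powr q" using a(2) by simp
qed

lemma D_midpoint: "a \<in> D \<Longrightarrow> b \<in> D \<Longrightarrow> (\<lambda>x. (a x + b x) / 2) \<in> D"
proof -
  assume a: "a \<in> D" and b: "b \<in> D"
  have q: "q > 1" using q_ge p_gt_1 by simp
  have "AE x in L. a_low \<le> (a x + b x) / 2"
  proof -
    have "AE x in L. a_low \<le> a x" "AE x in L. a_low \<le> b x" using a b by (auto simp: D_iff)
    then show ?thesis by eventually_elim simp
  qed
  then show ?thesis
    using a b Lpow_midpoint_le[OF q, of L a b] by (auto simp: D_iff)
qed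

text \<open>The norm constraint lives in \<open>L^q\<close>, where q may exceed p and convergence is
  not known. Almost everywhere convergence passes the lower bound pointwise and the norm bound by
  Fatou's lemma.\<close>

lemma D_closed:
  assumes b: "\<And>k :: nat. b k \<in> D" and a: "in_L L p a" and lim: "AE x in L. (\<lambda>k. b k x) \<longlonglongrightarrow> a x"
  shows "a \<in> D"
proof -
  have q: "q > 0" using q_ge p_gt_1 by simp
  have "AE x in L. \<forall>k. a_low \<le> b k x" unfolding AE_all_countable using b by (auto simp: D_iff)
  then have "AE x in L. a_low \<le> a x"
    using lim by eventually_elim (auto intro: LIMSEQ_le_const)
  moreover have "in_L L q a" "Lpow L q a \<le> M powr q"
    using Lpow_Fatou[where f = b and B = "M powr q", OF _ _ in_L_measurable[OF a] lim q] b
    by (simp_all add: D_iff)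
  ultimately show ?thesis by (simp add: D_iff)
qed

lemma a_star_in_L: "in_L L p a_star"
  using a_star by (simp add: Lp_iff_in_L)

lemma D_minus_a_star_bound:
  obtains R where "\<And>a. a \<in> D \<Longrightarrow> Lpow L p (\<lambda>x. a x - a_star x) \<le> R"
proof -
  have p: "p > 0" using p_gt_1 by simp
  obtain C where C: "C \<ge> 0" "\<And>(M :: (real^'n) measure) f g h. in_L M p f \<Longrightarrow> in_L M p g \<Longrightarrow> in_L M p h \<Longrightarrow>
      Lpow M p (\<lambda>x. f x - h x) \<le> (1 + 1) * Lpow M p (\<lambda>x. f x - g x) + C * Lpow M p (\<lambda>x. g x - h x)"
    by (rule Lpow_triangle[OF p zero_less_one, where ?'a = "real^'n"]) blast
  have z: "in_L L p (\<lambda>x. 0)" by (simp add: in_L_def)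
  show ?thesis
  proof
    fix a assume a: "a \<in> D"
    have "Lpow L p (\<lambda>x. a x - a_star x) \<le> (1 + 1) * Lpow L p (\<lambda>x. a x - 0) + C * Lpow L p (\<lambda>x. 0 - a_star x)"
      by (rule C(2)[OF D_in_Lp(1)[OF a] z a_star_in_L])
    also have "\<dots> \<le> (1 + 1) * (measure L \<Omega> + M powr q) + C * Lpow L p (\<lambda>x. 0 - a_star x)"
      using D_in_Lp(2)[OF a] by simp
    finally show "Lpow L p (\<lambda>x. a x - a_star x) \<le> (1 + 1) * (measure L \<Omega> + M powr q) + C * Lpow L p (\<lambda>x. 0 - a_star x)" .
  qed
qed

section \<open>Compactness of states and a substitute for weak limits\<close>

lemma sol_compact:
  assumes a: "\<And>k :: nat. a k \<in> D"
  obtains r u where "strict_mono (r :: nat \<Rightarrow> nat)" "in_L L s u" "\<And>k. in_L L s (sol (a k))"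
    "(\<lambda>k. Lpow L s (\<lambda>x. sol (a (r k)) x - u x)) \<longlonglongrightarrow> 0"
proof -
  have \<sigma>1: "1 \<le> \<sigma>" using \<sigma>(1) by simp
  obtain C where C: "\<And>\<mu> a u. signed_borel_measure (closure \<Omega>) \<mu> \<and> a \<in> D \<and> regular_weak_solution \<Omega> \<kappa> \<mu> a u \<Longrightarrow>
      H1_norm \<sigma> \<Omega> u \<le> C * total_variation_norm (closure \<Omega>) \<mu>"
    using wp \<sigma>1 \<sigma>(5) unfolding well_posed_def by blast
  \<comment> \<open>The added 1 makes the bound strict, as the choice of an extension close to the
    infimum requires.\<close>
  define B where "B = C * total_variation_norm (closure \<Omega>) \<mu> + 1"
  have B: "H1_norm \<sigma> \<Omega> (sol (a k)) < B" for k
    using C[of \<mu> "a k" "sol (a k)"] \<mu> a sol_regular_weak[OF a, of k] unfolding B_def by auto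
  have u: "sol (a k) \<in> H1 \<sigma> \<Omega>" for k
    using sol_regular_weak[OF a, of k] \<sigma>1 \<sigma>(5) by (auto simp: regular_weak_solution_def)
  have "\<forall>k. \<exists>U g. U \<in> Lp \<sigma> UNIV \<and> g \<in> Lp \<sigma> UNIV \<and> weak_gradient UNIV U g \<and> (AE x in L. U x = sol (a k) x) \<and>
    (LINT x|lebesgue_on UNIV. norm (U x) powr \<sigma>) \<le> B powr \<sigma> \<and>
    (LINT x|lebesgue_on UNIV. norm (g x) powr \<sigma>) \<le> B powr \<sigma>"
  proof
    fix k
    show "\<exists>U g. U \<in> Lp \<sigma> UNIV \<and> g \<in> Lp \<sigma> UNIV \<and> weak_gradient UNIV U g \<and> (AE x in L. U x = sol (a k) x) \<and>
      (LINT x|lebesgue_on UNIV. norm (U x) powr \<sigma>) \<le> B powr \<sigma> \<and>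
      (LINT x|lebesgue_on UNIV. norm (g x) powr \<sigma>) \<le> B powr \<sigma>"
      by (rule H1_extension_bound[OF \<sigma>1 u[of k] B[of k]]) blast
  qed
  then obtain U G where UG: "\<And>k. U k \<in> Lp \<sigma> UNIV" "\<And>k. G k \<in> Lp \<sigma> UNIV" "\<And>k. weak_gradient UNIV (U k) (G k)"
    "\<And>k. AE x in L. U k x = sol (a k) x"
    "\<And>k. (LINT x|lebesgue_on UNIV. norm (U k x) powr \<sigma>) \<le> B powr \<sigma>"
    "\<And>k. (LINT x|lebesgue_on UNIV. norm (G k x) powr \<sigma>) \<le> B powr \<sigma>"
    unfolding choice_iff by blast
  obtain r v where r: "\<And>k. in_L L s (U k)" "strict_mono (r :: nat \<Rightarrow> nat)" "in_L L s v"
    "(\<lambda>k. Lpow L s (\<lambda>x. U (r k) x - v x)) \<longlonglongrightarrow> 0"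
    by (rule Rellich[where U = U and G = G and N = "B powr \<sigma>", OF \<Omega>m bounded_\<Omega> \<sigma>(1,2,4) powr_ge_zero UG(3,1,2,5,6), unfolded \<sigma>(3)]) blast
  have m: "sol (a k) \<in> borel_measurable L" for k
    by (rule borel_measurable_cong_AE_lebesgue_on[OF UG(4) \<Omega>m in_L_measurable[OF r(1)]])
  have "Lpow L s (\<lambda>x. sol (a (r k)) x - v x) = Lpow L s (\<lambda>x. U (r k) x - v x)" for k
  proof (rule Lpow_cong_AE)
    show "AE x in L. sol (a (r k)) x - v x = U (r k) x - v x"
      using UG(4)[of "r k"] by eventually_elim simp
  qed (intro borel_measurable_diff m in_L_measurable[OF r(1)] in_L_measurable[OF r(3)])+
  then show ?thesis
    using that[OF r(2,3) in_L_cong_AE[OF UG(4) m r(1)]] r(4) by simp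
qed

lemma integral_abs_midpoint_le:
  assumes f: "integrable N f" and g: "integrable N g"
  shows "(LINT x|N. \<bar>(f x + g x) / 2\<bar>) \<le> ((LINT x|N. \<bar>f x\<bar>) + (LINT x|N. \<bar>g x\<bar>)) / (2 :: real)"
proof -
  have "(LINT x|N. \<bar>(f x + g x) / 2\<bar>) \<le> (LINT x|N. (\<bar>f x\<bar> + \<bar>g x\<bar>) / 2)"
    using f g by (intro integral_mono) auto
  also have "\<dots> = ((LINT x|N. \<bar>f x\<bar>) + (LINT x|N. \<bar>g x\<bar>)) / 2"
    using f g by simp
  finally show ?thesis .
qed

text \<open>The points of the hull of the coefficients \<open>a k\<close> carry along the corresponding points of the hull of the
  states, so that no weak topology is needed to pass to the limit in the equation.\<close>

lemma hull_states:
  assumes A: "A \<subseteq> D" and u: "in_L L s u" and c: "\<And>b. b \<in> A \<Longrightarrow> in_L L s (sol b)"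
    "\<And>b. b \<in> A \<Longrightarrow> Lpow L s (\<lambda>x. sol b x - u x) \<le> \<eta>"
    "\<And>b. b \<in> A \<Longrightarrow> (LINT x|L. \<bar>b x * (sol b x - u x)\<bar>) \<le> e"
    "\<And>b. b \<in> A \<Longrightarrow> norm (S b - y) \<le> c"
    and b: "b \<in> midpoint_hull A"
  shows "b \<in> D \<and> (\<exists>w f. solves w f \<and> in_L L s w \<and> Lpow L s (\<lambda>x. w x - u x) \<le> \<eta> \<and>
    (LINT x|L. \<bar>f x - b x * u x\<bar>) \<le> e \<and> norm (\<iota> w - y) \<le> c)"
  using b
proof (induction rule: midpoint_hull.induct)
  case (base b)
  have "(LINT x|L. \<bar>b x * sol b x - b x * u x\<bar>) \<le> e" using c(3)[OF base] by (simp add: right_diff_distrib)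
  moreover have "norm (\<iota> (sol b) - y) \<le> c" using c(4)[OF base] by (simp add: solution_operator_def sol_def)
  ultimately show ?case using A base c(1,2)[OF base] sol_solves[of b] by blast
next
  case (mid f g)
  obtain w f' where w: "solves w f'" "in_L L s w" "Lpow L s (\<lambda>x. w x - u x) \<le> \<eta>"
    "(LINT x|L. \<bar>f' x - f x * u x\<bar>) \<le> e" "norm (\<iota> w - y) \<le> c" and f: "f \<in> D" using mid.IH(1) by blast
  obtain v g' where v: "solves v g'" "in_L L s v" "Lpow L s (\<lambda>x. v x - u x) \<le> \<eta>"
    "(LINT x|L. \<bar>g' x - g x * u x\<bar>) \<le> e" "norm (\<iota> v - y) \<le> c" and g: "g \<in> D" using mid.IH(2) by blast
  have s0: "s > 0" using s_gt_1 by simp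
  obtain C where "\<forall>(M :: (real^'n) measure) f g. in_L M p f \<longrightarrow> in_L M s g \<longrightarrow>
    integrable M (\<lambda>x. f x * g x) \<and> (LINT x|M. \<bar>f x * g x\<bar>) \<le> 1 * Lpow M p f + C * Lpow M s g"
    using integrable_mult_in_L[OF p_gt_1 s_gt_1 conjugate(1) zero_less_one, where ?'a = "real^'n"] by blast
  then have prod: "integrable L (\<lambda>x. h x * u x)" if "h \<in> D" for h
    using D_in_Lp(1)[OF that] u by blast
  have i: "integrable L (\<lambda>x. f' x - f x * u x)" "integrable L (\<lambda>x. g' x - g x * u x)"
    using w(1) v(1) prod[OF f] prod[OF g] by (auto simp: solves_def)
  have reg: "regular w" "regular v" using w(1) v(1) by (auto simp: solves_def)
  let ?w = "\<lambda>x. (w x + v x) / 2" and ?f = "\<lambda>x. (f' x + g' x) / 2"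
  have "(\<lambda>x. (w x + v x) / 2 - u x) = (\<lambda>x. ((w x - u x) + (v x - u x)) / 2)" by (auto simp: field_simps)
  then have "Lpow L s (\<lambda>x. ?w x - u x) \<le> (Lpow L s (\<lambda>x. w x - u x) + Lpow L s (\<lambda>x. v x - u x)) / 2"
    using Lpow_midpoint_le(2)[OF s_gt_1 in_L_diff[OF s0 w(2) u] in_L_diff[OF s0 v(2) u]] by simp
  then have 1: "Lpow L s (\<lambda>x. ?w x - u x) \<le> \<eta>" using w(3) v(3) by argo
  have "(\<lambda>x. ?f x - (f x + g x) / 2 * u x) = (\<lambda>x. ((f' x - f x * u x) + (g' x - g x * u x)) / 2)"
    by (auto simp: field_simps)
  then have "(LINT x|L. \<bar>?f x - (f x + g x) / 2 * u x\<bar>) = (LINT x|L. \<bar>((f' x - f x * u x) + (g' x - g x * u x)) / 2\<bar>)"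
    by metis
  then have 2: "(LINT x|L. \<bar>?f x - (f x + g x) / 2 * u x\<bar>) \<le> e"
    using integral_abs_midpoint_le[OF i] w(4) v(4) by argo
  have "?w = (\<lambda>x. (1/2) * w x + (1/2) * v x)" by (auto simp: field_simps)
  then have "\<iota> ?w = (1/2) *\<^sub>R \<iota> w + (1/2) *\<^sub>R \<iota> v"
    using \<iota>_lincomb[OF regular_H1_\<tau>[OF reg(1)] regular_H1_\<tau>[OF reg(2)], of "1/2" "1/2"] by simp
  then have "\<iota> ?w - y = (1/2) *\<^sub>R (\<iota> w - y) + (1/2) *\<^sub>R (\<iota> v - y)"
    by (simp add: algebra_simps flip: scaleR_add_left)
  then have "norm (\<iota> ?w - y) \<le> (1/2) * norm (\<iota> w - y) + (1/2) * norm (\<iota> v - y)"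
    using norm_triangle_ineq[of "(1/2) *\<^sub>R (\<iota> w - y)" "(1/2) *\<^sub>R (\<iota> v - y)"] by simp
  then have 3: "norm (\<iota> ?w - y) \<le> c" using w(5) v(5) by argo
  show ?case
    using D_midpoint[OF f g] solves_midpoint[OF w(1) v(1)] Lpow_midpoint_le(1)[OF s_gt_1 w(2) v(2)] 1 2 3 by blast
qed

text \<open>Stands in for weak sequential compactness of \<open>D\<close> together with weak lower
  semicontinuity of misfit and penalty. The state conclusion holds for every y because it serves
  both the noisy datum in the existence proof and the exact datum in the convergence proof. The last
  conclusion is the Radon-Riesz property along the subsequence.\<close>

lemma weak_limit:
  assumes a: "\<And>k :: nat. a k \<in> D"
  obtains r a0 where "strict_mono (r :: nat \<Rightarrow> nat)" "a0 \<in> D"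
    "\<And>y c. eventually (\<lambda>k. norm (S (a (r k)) - y) \<le> c) sequentially \<Longrightarrow> norm (S a0 - y) \<le> c"
    "\<And>c. eventually (\<lambda>k. Lpow L p (\<lambda>x. a (r k) x - a_star x) \<le> c) sequentially \<Longrightarrow> Lpow L p (\<lambda>x. a0 x - a_star x) \<le> c"
    "(\<And>e. e > 0 \<Longrightarrow> eventually (\<lambda>k. Lpow L p (\<lambda>x. a (r k) x - a_star x) \<le> Lpow L p (\<lambda>x. a0 x - a_star x) + e) sequentially)
      \<Longrightarrow> (\<lambda>k. Lpow L p (\<lambda>x. a (r k) x - a0 x)) \<longlonglongrightarrow> 0"
proof -
  obtain r u where r: "strict_mono (r :: nat \<Rightarrow> nat)" and u: "in_L L s u" "\<And>k. in_L L s (sol (a k))"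
    "(\<lambda>k. Lpow L s (\<lambda>x. sol (a (r k)) x - u x)) \<longlonglongrightarrow> 0"
    by (rule sol_compact[where a = a, OF a]) blast
  define A where "A m = (\<lambda>k. a (r k)) ` {m..}" for m
  define H where "H m = midpoint_hull (A m)" for m
  have AD: "A m \<subseteq> D" for m unfolding A_def using a by auto
  have HD: "f \<in> D" if "f \<in> H m" for f m
    using that unfolding H_def
  proof (induction rule: midpoint_hull.induct)
    case (base f)
    then show ?case using AD by blast
  next
    case (mid f g)
    show ?case by (rule D_midpoint) fact+
  qed
  have aH: "a (r k) \<in> H k" for k unfolding H_def A_def by (intro midpoint_hull.base imageI) simp
  obtain R where R: "\<And>a. a \<in> D \<Longrightarrow> Lpow L p (\<lambda>x. a x - a_star x) \<le> R" by (rule D_minus_a_star_bound) blast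
  obtain a0 b r' where a0: "in_L L p a0" and b: "\<And>m. b m \<in> H m" "(\<lambda>m. Lpow L p (\<lambda>x. b m x - a0 x)) \<longlonglongrightarrow> 0"
    and r': "AE x in L. (\<lambda>k. b (r' k) x) \<longlonglongrightarrow> a0 x"
    and lsc: "\<And>g C. (\<And>k. g k \<in> H k) \<Longrightarrow> eventually (\<lambda>k. Lpow L p (\<lambda>x. g k x - a_star x) \<le> C) sequentially
       \<Longrightarrow> Lpow L p (\<lambda>x. a0 x - a_star x) \<le> C"
    and RR: "\<And>g. (\<And>k. g k \<in> H k) \<Longrightarrow>
       (\<And>e. e > 0 \<Longrightarrow> eventually (\<lambda>k. Lpow L p (\<lambda>x. g k x - a_star x) \<le> Lpow L p (\<lambda>x. a0 x - a_star x) + e) sequentially)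
       \<Longrightarrow> (\<lambda>k. Lpow L p (\<lambda>x. g k x - a0 x)) \<longlonglongrightarrow> 0"
  proof (rule midpoint_closed_limit[where H = H and M = L and p = p and c = a_star and R = R])
    show "p > 1" by (rule p_gt_1)
    show "H (Suc m) \<subseteq> H m" for m unfolding H_def A_def by (intro midpoint_hull_mono image_mono) auto
    show "H m \<noteq> {}" for m using aH[of m] by blast
    show "in_L L p f" if "f \<in> H m" for m f by (rule D_in_Lp(1)[OF HD[OF that]])
    show "(\<lambda>x. (f x + g x) / 2) \<in> H m" if "f \<in> H m" "g \<in> H m" for m f g
      using that unfolding H_def by (rule midpoint_hull.mid)
    show "in_L L p a_star" by (rule a_star_in_L)
    show "Lpow L p (\<lambda>x. f x - a_star x) \<le> R" if "f \<in> H 0" for f by (rule R[OF HD[OF that]])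
  qed blast
  have a0D: "a0 \<in> D" by (rule D_closed[OF HD[OF b(1)] a0 r'])
  \<comment> \<open>A point \<open>b m\<close> of the hull of a late tail is close to
    \<open>a0\<close>; its companion \<open>w\<close> nearly solves the problem for
    \<open>a0\<close> and still has misfit at most \<open>c\<close>. Stability then puts
    \<open>S a0\<close> within \<open>e\<close> of \<open>\<iota> w\<close>.\<close>
  have state: "norm (S a0 - y) \<le> c" if ev: "eventually (\<lambda>k. norm (S (a (r k)) - y) \<le> c) sequentially" for y c
  proof (rule field_le_epsilon)
    fix e :: real assume e: "e > 0"
    obtain K where K: "K \<ge> 0" "\<forall>a\<in>D. \<forall>w f. solves w f \<longrightarrow> integrable L (\<lambda>x. a x * w x) \<longrightarrow>
       norm (\<iota> w - S a) \<le> K * (LINT x|L. \<bar>a x * w x - f x\<bar>)"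
      using stability by blast
    \<comment> \<open>The target size of the residual \<open>a0 w - f\<close>, which the stability
      constant turns into \<open>e\<close>; \<open>K + 1\<close> covers
      \<open>K = 0\<close>.\<close>
    define e' where "e' = e / (K + 1)"
    have e': "e' > 0" using e K by (simp add: e'_def)
    define B where "B = measure L \<Omega> + M powr q"
    have B: "B \<ge> 0" by (simp add: B_def)
    \<comment> \<open>The order of choice matters: \<open>\<eta>1\<close> depends only on the common
      bound \<open>B\<close> of the coefficients, it determines \<open>C1\<close>, and only then is
      the admissible state error \<open>\<eta>\<close> chosen.\<close>
    define \<eta>1 where "\<eta>1 = e' / (6 * (B + 1))"
    have \<eta>1: "\<eta>1 > 0" using e' B by (simp add: \<eta>1_def)
    obtain C1 where C1: "C1 \<ge> 0" and mult1: "\<forall>(M :: (real^'n) measure) f g. in_L M p f \<longrightarrow> in_L M s g \<longrightarrow>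
      integrable M (\<lambda>x. f x * g x) \<and> (LINT x|M. \<bar>f x * g x\<bar>) \<le> \<eta>1 * Lpow M p f + C1 * Lpow M s g"
      using integrable_mult_in_L[OF p_gt_1 s_gt_1 conjugate(1) \<eta>1, where ?'a = "real^'n"] by blast
    define \<eta> where "\<eta> = e' / (6 * (C1 + 1))"
    have \<eta>: "\<eta> > 0" using e' C1 by (simp add: \<eta>_def)
    have small: "(LINT x|L. \<bar>f x * g x\<bar>) \<le> e' / 3"
      if f: "f \<in> D" and g: "in_L L s g" "Lpow L s g \<le> \<eta>" for f g
    proof -
      have "(LINT x|L. \<bar>f x * g x\<bar>) \<le> \<eta>1 * Lpow L p f + C1 * Lpow L s g"
        using mult1 D_in_Lp(1)[OF f] g(1) by blast
      also have "\<dots> \<le> \<eta>1 * (B + 1) + (C1 + 1) * \<eta>"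
      proof (intro add_mono mult_mono)
        show "Lpow L p f \<le> B + 1" using D_in_Lp(2)[OF f] by (simp add: B_def)
      qed (use \<eta>1 C1 g \<eta> B in auto)
      also have "\<eta>1 * (B + 1) = e' / 6" using B by (simp add: \<eta>1_def field_simps)
      also have "(C1 + 1) * \<eta> = e' / 6" using C1 by (simp add: \<eta>_def field_simps)
      finally show ?thesis by simp
    qed
    \<comment> \<open>Here the roles are swapped: \<open>u\<close> is fixed, and the factor
      \<open>b m - a0\<close> tends to 0 in \<open>L^p\<close>.\<close>
    define \<eta>2 where "\<eta>2 = e' / (6 * (Lpow L s u + 1))"
    have \<eta>2: "\<eta>2 > 0" using e' by (simp add: \<eta>2_def add_nonneg_pos)
    obtain C2 where C2: "C2 \<ge> 0" and mult2: "\<forall>(M :: (real^'n) measure) f g. in_L M s f \<longrightarrow> in_L M p g \<longrightarrow>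
      integrable M (\<lambda>x. f x * g x) \<and> (LINT x|M. \<bar>f x * g x\<bar>) \<le> \<eta>2 * Lpow M s f + C2 * Lpow M p g"
      using integrable_mult_in_L[OF s_gt_1 p_gt_1 conjugate(2) \<eta>2, where ?'a = "real^'n"] by blast
    have "(\<lambda>m. C2 * Lpow L p (\<lambda>x. b m x - a0 x)) \<longlonglongrightarrow> C2 * 0"
      by (intro tendsto_mult tendsto_const b(2))
    then have ev2: "eventually (\<lambda>m. C2 * Lpow L p (\<lambda>x. b m x - a0 x) < e' / 6) sequentially"
      by (rule order_tendstoD) (use e' in simp)
    have ev3: "eventually (\<lambda>k. Lpow L s (\<lambda>x. sol (a (r k)) x - u x) < \<eta>) sequentially"
      using u(3) \<eta> by (rule order_tendstoD)
    obtain m where m: "\<And>k. k \<ge> m \<Longrightarrow> norm (S (a (r k)) - y) \<le> c"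
      "\<And>k. k \<ge> m \<Longrightarrow> Lpow L s (\<lambda>x. sol (a (r k)) x - u x) < \<eta>"
      "C2 * Lpow L p (\<lambda>x. b m x - a0 x) < e' / 6"
      using eventually_conj[OF ev eventually_conj[OF ev3 ev2]] unfolding eventually_sequentially by blast
    have s0: "s > 0" and p0: "p > 0" using s_gt_1 p_gt_1 by auto
    have "b m \<in> D \<and> (\<exists>w f. solves w f \<and> in_L L s w \<and> Lpow L s (\<lambda>x. w x - u x) \<le> \<eta> \<and>
      (LINT x|L. \<bar>f x - b m x * u x\<bar>) \<le> e' / 3 \<and> norm (\<iota> w - y) \<le> c)"
    proof (rule hull_states[OF AD[of m] u(1)])
      fix f assume "f \<in> A m"
      then obtain k where k: "k \<ge> m" "f = a (r k)" unfolding A_def by auto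
      show 1: "in_L L s (sol f)" unfolding k(2) by (rule u(2))
      show 2: "Lpow L s (\<lambda>x. sol f x - u x) \<le> \<eta>" unfolding k(2) using m(2)[OF k(1)] by simp
      have "f \<in> D" unfolding k(2) by (rule a)
      then show "(LINT x|L. \<bar>f x * (sol f x - u x)\<bar>) \<le> e' / 3"
        by (rule small[OF _ in_L_diff[OF s0 1 u(1)] 2])
      show "norm (S f - y) \<le> c" unfolding k(2) by (rule m(1)[OF k(1)])
    qed (use b(1) in \<open>simp add: H_def\<close>)
    then obtain w f where w: "solves w f" "in_L L s w" "Lpow L s (\<lambda>x. w x - u x) \<le> \<eta>"
      "(LINT x|L. \<bar>f x - b m x * u x\<bar>) \<le> e' / 3" "norm (\<iota> w - y) \<le> c" and bD: "b m \<in> D" by blast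
    have i0: "integrable L (\<lambda>x. h x * g x)" if "h \<in> D" "in_L L s g" for h g
      using mult1 D_in_Lp(1)[OF that(1)] that(2) by blast
    have iw: "integrable L (\<lambda>x. a0 x * w x)" by (rule i0[OF a0D w(2)])
    have i1: "integrable L (\<lambda>x. a0 x * (w x - u x))" by (rule i0[OF a0D in_L_diff[OF s0 w(2) u(1)]])
    have d: "in_L L p (\<lambda>x. b m x - a0 x)" by (rule in_L_diff[OF p0 D_in_Lp(1)[OF bD] a0])
    have i2: "integrable L (\<lambda>x. u x * (b m x - a0 x))"
      and le2: "(LINT x|L. \<bar>u x * (b m x - a0 x)\<bar>) \<le> \<eta>2 * Lpow L s u + C2 * Lpow L p (\<lambda>x. b m x - a0 x)"
      using mult2 u(1) d by blast+
    have "\<eta>2 * Lpow L s u \<le> \<eta>2 * (Lpow L s u + 1)" using \<eta>2 by (intro mult_left_mono) auto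
    also have "\<dots> = e' / 6"
    proof -
      have "Lpow L s u + 1 > 0" by (simp add: add_nonneg_pos)
      then show ?thesis by (simp add: \<eta>2_def field_simps)
    qed
    finally have le2': "(LINT x|L. \<bar>u x * (b m x - a0 x)\<bar>) \<le> e' / 3" using le2 m(3) by linarith
    have i3: "integrable L (\<lambda>x. f x - b m x * u x)"
      using i0[OF bD u(1)] w(1) by (auto simp: solves_def)
    have fi: "integrable L f" using w(1) by (simp add: solves_def)
    \<comment> \<open>The residual is split as a0 (w - u) - u (b m - a0) - (f - b m u): state error,
      coefficient error and defect of the hull point, each at most \<open>e' / 3\<close>.\<close>
    have "(LINT x|L. \<bar>a0 x * w x - f x\<bar>)
      \<le> (LINT x|L. \<bar>a0 x * (w x - u x)\<bar> + (\<bar>u x * (b m x - a0 x)\<bar> + \<bar>f x - b m x * u x\<bar>))"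
    proof (rule integral_mono)
      show "\<bar>a0 x * w x - f x\<bar> \<le> \<bar>a0 x * (w x - u x)\<bar> + (\<bar>u x * (b m x - a0 x)\<bar> + \<bar>f x - b m x * u x\<bar>)" for x
      proof -
        have "a0 x * w x - f x = a0 x * (w x - u x) + (- (u x * (b m x - a0 x)) + - (f x - b m x * u x))"
          by (simp add: algebra_simps)
        then show ?thesis
          using abs_triangle_ineq[of "a0 x * (w x - u x)" "- (u x * (b m x - a0 x)) + - (f x - b m x * u x)"]
            abs_triangle_ineq[of "- (u x * (b m x - a0 x))" "- (f x - b m x * u x)"]
          unfolding abs_minus_cancel by linarith
      qed
    qed (use iw fi i1 i2 i3 in auto)
    also have "\<dots> = (LINT x|L. \<bar>a0 x * (w x - u x)\<bar>) + ((LINT x|L. \<bar>u x * (b m x - a0 x)\<bar>) + (LINT x|L. \<bar>f x - b m x * u x\<bar>))"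
      using integrable_abs[OF i1] integrable_abs[OF i2] integrable_abs[OF i3]
      by (simp only: Bochner_Integration.integral_add Bochner_Integration.integrable_add)
    also have "\<dots> \<le> e' / 3 + (e' / 3 + e' / 3)"
      by (intro add_mono small[OF a0D in_L_diff[OF s0 w(2) u(1)] w(3)] le2' w(4))
    finally have int: "(LINT x|L. \<bar>a0 x * w x - f x\<bar>) \<le> e'" by simp
    have "norm (\<iota> w - S a0) \<le> K * (LINT x|L. \<bar>a0 x * w x - f x\<bar>)" using K(2) a0D w(1) iw by blast
    also have "\<dots> \<le> (K + 1) * e'" using K(1) int e' by (intro mult_mono) auto
    also have "\<dots> = e" using K(1) by (simp add: e'_def)
    finally have "norm (\<iota> w - S a0) \<le> e" .
    moreover have "S a0 - y = (\<iota> w - y) - (\<iota> w - S a0)" by simp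
    ultimately show "norm (S a0 - y) \<le> c + e"
      using norm_triangle_ineq4[of "\<iota> w - y" "\<iota> w - S a0"] w(5) by simp
  qed
  show ?thesis
    by (rule that[OF r a0D state lsc[OF aH] RR[OF aH]])
qed

section \<open>Tikhonov regularization\<close>

text \<open>Lower semicontinuity is available for misfit and penalty separately, so the minimising
  sequence is thinned until both converge; the objective is continuous and increasing in each of
  them.\<close>

lemma tikhonov_minimizer:
  assumes ne: "D \<noteq> {}" and \<alpha>: "\<alpha> > 0" and l: "l > 1"
  shows "\<exists>a. is_arg_min (tikhonov S \<Omega> p l a_star \<alpha> y) (\<lambda>a. a \<in> D) a"
proof -
  define P where "P = max p 2"
  have P: "P > 0" by (simp add: P_def)
  have p0: "p > 0" using p_gt_1 by simp
  define T where "T = tikhonov S \<Omega> p l a_star \<alpha> y"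
  define \<Phi> where "\<Phi> x z = 1 / l * x powr l + \<alpha> / P * ((z powr (1 / p)) powr P)" for x z :: real
  define X where "X a = norm (S a - y)" for a
  define Z where "Z a = Lpow L p (\<lambda>x. a x - a_star x)" for a
  have X0: "X a \<ge> 0" and Z0: "Z a \<ge> 0" for a by (auto simp: X_def Z_def)
  have T: "T a = \<Phi> (X a) (Z a)" for a
    by (simp add: T_def tikhonov_def \<Phi>_def X_def Z_def P_def Lp_norm_eq)
  have T0: "T a \<ge> 0" for a using l \<alpha> P by (simp add: T \<Phi>_def)
  have mono: "\<Phi> x z \<le> \<Phi> x' z'" if "0 \<le> x" "x \<le> x'" "0 \<le> z" "z \<le> z'" for x x' z z'
    unfolding \<Phi>_def using that l \<alpha> P p0 by (intro add_mono mult_left_mono powr_mono2) auto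
  define m where "m = (INF a\<in>D. T a)"
  have bdd: "bdd_below (T ` D)" using T0 by (intro bdd_belowI[of _ 0]) auto
  have m_le: "m \<le> T a" if "a \<in> D" for a unfolding m_def using bdd that by (rule cINF_lower)
  have "\<exists>a\<in>D. T a < m + 1 / (real k + 1)" for k
  proof -
    have "(INF a\<in>D. T a) < m + 1 / (real k + 1)" by (simp add: m_def)
    then show ?thesis using ne bdd by (simp add: cINF_less_iff)
  qed
  then obtain a where a: "\<And>k. a k \<in> D" "\<And>k. T (a k) < m + 1 / (real k + 1)" by metis
  obtain R where R: "\<And>a. a \<in> D \<Longrightarrow> Z a \<le> R" unfolding Z_def by (rule D_minus_a_star_bound) blast
  have Xb: "X (a k) \<le> (l * (m + 1)) powr (1 / l)" for k
  proof -
    have "1 / (real k + 1) \<le> 1" by simp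
    then have "T (a k) \<le> m + 1" using a(2)[of k] by linarith
    moreover have "1 / l * X (a k) powr l \<le> T (a k)" using \<alpha> P by (simp add: T \<Phi>_def)
    ultimately have "1 / l * X (a k) powr l \<le> m + 1" by linarith
    then have "X (a k) powr l \<le> l * (m + 1)" using l by (simp add: field_simps)
    then have "(X (a k) powr l) powr (1 / l) \<le> (l * (m + 1)) powr (1 / l)" using l by (intro powr_mono2) auto
    then show ?thesis using l X0[of "a k"] by (simp add: powr_powr)
  qed
  \<comment> \<open>The misfit is bounded through the objective, the penalty through the norm bound
    built into \<open>D\<close>.\<close>
  have "bounded (range (\<lambda>k. (X (a k), Z (a k))))"
  proof (rule bounded_subset)
    show "bounded ({0..(l * (m + 1)) powr (1 / l)} \<times> {0..R})" by (intro bounded_Times bounded_closed_interval)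
    show "range (\<lambda>k. (X (a k), Z (a k))) \<subseteq> {0..(l * (m + 1)) powr (1 / l)} \<times> {0..R}"
      using X0 Z0 Xb R a(1) by auto
  qed
  then obtain xz t where t: "strict_mono (t :: nat \<Rightarrow> nat)"
    and lim: "((\<lambda>k. (X (a k), Z (a k))) \<circ> t) \<longlonglongrightarrow> xz"
    using bounded_imp_convergent_subsequence by blast
  define x where "x = fst xz"
  define z where "z = snd xz"
  have xlim: "(\<lambda>k. X (a (t k))) \<longlonglongrightarrow> x" and zlim: "(\<lambda>k. Z (a (t k))) \<longlonglongrightarrow> z"
    using tendsto_fst[OF lim] tendsto_snd[OF lim] by (auto simp: x_def z_def o_def)
  have x0: "x \<ge> 0" and z0: "z \<ge> 0"
    using xlim zlim X0 Z0 by (auto intro: LIMSEQ_le_const)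
  obtain r a0 where r: "strict_mono (r :: nat \<Rightarrow> nat)" and a0: "a0 \<in> D"
    and A: "\<And>y c. eventually (\<lambda>k. norm (S (a (t (r k))) - y) \<le> c) sequentially \<Longrightarrow> norm (S a0 - y) \<le> c"
    and B: "\<And>c. eventually (\<lambda>k. Lpow L p (\<lambda>x. a (t (r k)) x - a_star x) \<le> c) sequentially \<Longrightarrow> Lpow L p (\<lambda>x. a0 x - a_star x) \<le> c"
    by (rule weak_limit[where a = "\<lambda>k. a (t k)", OF a(1)]) blast
  \<comment> \<open>The lower semicontinuity statements take eventual upper bounds, so the limit
    \<open>x\<close> enters through \<open>x + e\<close>.\<close>
  have "X a0 \<le> x"
  proof (rule field_le_epsilon)
    fix e :: real assume "e > 0"
    then have "eventually (\<lambda>k. X (a (t (r k))) < x + e) sequentially"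
      using LIMSEQ_subseq_LIMSEQ[OF xlim r] by (intro order_tendstoD(2)[of _ x]) (auto simp: o_def)
    then have "eventually (\<lambda>k. norm (S (a (t (r k))) - y) \<le> x + e) sequentially"
      by eventually_elim (simp add: X_def)
    then show "X a0 \<le> x + e" unfolding X_def by (rule A)
  qed
  moreover have "Z a0 \<le> z"
  proof (rule field_le_epsilon)
    fix e :: real assume "e > 0"
    then have "eventually (\<lambda>k. Z (a (t (r k))) < z + e) sequentially"
      using LIMSEQ_subseq_LIMSEQ[OF zlim r] by (intro order_tendstoD(2)[of _ z]) (auto simp: o_def)
    then have "eventually (\<lambda>k. Lpow L p (\<lambda>x. a (t (r k)) x - a_star x) \<le> z + e) sequentially"
      by eventually_elim (simp add: Z_def)
    then show "Z a0 \<le> z + e" unfolding Z_def by (rule B)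
  qed
  ultimately have "T a0 \<le> \<Phi> x z" unfolding T using X0 Z0 by (intro mono)
  also have "\<Phi> x z \<le> m"
  proof (rule LIMSEQ_le)
    show "(\<lambda>k. \<Phi> (X (a (t k))) (Z (a (t k)))) \<longlonglongrightarrow> \<Phi> x z"
      unfolding \<Phi>_def using l P p0 X0 Z0
      by (intro tendsto_add tendsto_mult tendsto_const tendsto_powr' xlim zlim) auto
    have "(\<lambda>k. m + 1 / (real k + 1)) \<longlonglongrightarrow> m + 0"
      using LIMSEQ_inverse_real_of_nat
      by (intro tendsto_add tendsto_const) (simp add: inverse_eq_divide add.commute)
    then show "(\<lambda>k. m + 1 / (real (t k) + 1)) \<longlonglongrightarrow> m"
      using LIMSEQ_subseq_LIMSEQ[OF _ t] by (fastforce simp: o_def)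
    show "\<exists>N. \<forall>k\<ge>N. \<Phi> (X (a (t k))) (Z (a (t k))) \<le> m + 1 / (real (t k) + 1)"
      using a(2) unfolding T by (meson less_imp_le)
  qed
  finally have "T a0 \<le> T a" if "a \<in> D" for a using m_le[OF that] by linarith
  then show ?thesis
    using a0 unfolding T_def by (intro exI[of _ a0]) (simp add: is_arg_min_linorder)
qed

text \<open>Injectivity of \<iota> makes the two states agree almost everywhere. The midpoint of the
  zeroth-order terms is then the midpoint coefficient times the common state, so the residual in
  \<open>stability\<close> vanishes.\<close>

lemma solution_operator_midpoint:
  assumes a: "a \<in> D" and b: "b \<in> D" and eq: "S a = S b"
  shows "S (\<lambda>x. (a x + b x) / 2) = S a"
proof -
  let ?m = "\<lambda>x. (a x + b x) / 2"
  let ?w = "\<lambda>x. (sol a x + sol b x) / 2" and ?f = "\<lambda>x. (a x * sol a x + b x * sol b x) / 2"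
  have sa: "solves (sol a) (\<lambda>x. a x * sol a x)" and sb: "solves (sol b) (\<lambda>x. b x * sol b x)"
    using a b by (auto intro: sol_solves)
  have reg: "regular (sol a)" "regular (sol b)" using sa sb by (auto simp: solves_def)
  have \<iota>eq: "\<iota> (sol a) = \<iota> (sol b)" using eq by (simp add: solution_operator_def sol_def)
  have "AE x in L. sol a x = sol b x"
    using emb regular_H1_\<tau>[OF reg(1)] regular_H1_\<tau>[OF reg(2)] \<iota>eq unfolding H1_embedding_def by blast
  then have ae: "AE x in L. ?f x = ?m x * ?w x" by eventually_elim (simp add: field_simps)
  have w: "solves ?w ?f" by (rule solves_midpoint[OF sa sb])
  have i: "integrable L (\<lambda>x. ?m x * ?w x)"
    using integral_cong_AE_complete(1)[OF ae \<Omega>m] w by (simp add: solves_def)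
  obtain K where K: "\<forall>a\<in>D. \<forall>w f. solves w f \<longrightarrow> integrable L (\<lambda>x. a x * w x) \<longrightarrow>
       norm (\<iota> w - S a) \<le> K * (LINT x|L. \<bar>a x * w x - f x\<bar>)"
    using stability by blast
  have "(LINT x|L. \<bar>?m x * ?w x - ?f x\<bar>) = (LINT x|L. 0)"
    by (rule integral_cong_AE_complete(2)[OF _ \<Omega>m]) (use ae in eventually_elim, simp)
  moreover have "norm (\<iota> ?w - S ?m) \<le> K * (LINT x|L. \<bar>?m x * ?w x - ?f x\<bar>)"
    using K[rule_format, OF D_midpoint[OF a b] w i] .
  ultimately have "\<iota> ?w = S ?m" by simp
  moreover have "\<iota> ?w = S a"
  proof -
    have "?w = (\<lambda>x. (1/2) * sol a x + (1/2) * sol b x)" by (auto simp: field_simps)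
    then have "\<iota> ?w = (1/2) *\<^sub>R \<iota> (sol a) + (1/2) *\<^sub>R \<iota> (sol b)"
      using \<iota>_lincomb[OF regular_H1_\<tau>[OF reg(1)] regular_H1_\<tau>[OF reg(2)], of "1/2" "1/2"] by simp
    also have "\<dots> = \<iota> (sol a)" unfolding \<iota>eq by (simp flip: scaleR_add_left)
    finally show ?thesis by (simp add: solution_operator_def sol_def)
  qed
  ultimately show ?thesis by simp
qed

text \<open>The midpoint has the same state, so it is no closer to \<open>a_star\<close> than
  \<open>a\<close> is. The convexity defect is therefore at most 0, and uniform convexity leaves
  only an arbitrarily small distance. Equality is expressed through \<open>Lpow\<close> because
  elements are functions modulo null sets.\<close>

lemma minimum_norm_solution_unique:
  assumes a: "a \<in> D" and b: "b \<in> D" and eq: "S a = S b"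
    and min: "\<And>c. c \<in> D \<Longrightarrow> S c = S a \<Longrightarrow> Lpow L p (\<lambda>x. a x - a_star x) \<le> Lpow L p (\<lambda>x. c x - a_star x)"
    and le: "Lpow L p (\<lambda>x. b x - a_star x) \<le> Lpow L p (\<lambda>x. a x - a_star x)"
  shows "Lpow L p (\<lambda>x. b x - a x) = 0"
proof -
  define \<Lambda> where "\<Lambda> = Lpow L p (\<lambda>x. a x - a_star x)"
  have \<Lambda>0: "\<Lambda> \<ge> 0" by (simp add: \<Lambda>_def)
  have p0: "p > 0" using p_gt_1 by simp
  have i: "in_L L p (\<lambda>x. a x - a_star x)" "in_L L p (\<lambda>x. b x - a_star x)"
    by (rule in_L_diff[OF p0 D_in_Lp(1)[OF a] a_star_in_L], rule in_L_diff[OF p0 D_in_Lp(1)[OF b] a_star_in_L])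
  let ?m = "\<lambda>x. (b x + a x) / 2"
  have "\<Lambda> \<le> Lpow L p (\<lambda>x. ?m x - a_star x)"
    unfolding \<Lambda>_def using solution_operator_midpoint[OF b a eq[symmetric]] eq
    by (intro min D_midpoint[OF b a]) simp
  moreover have "(\<lambda>x. ((b x - a_star x) + (a x - a_star x)) / 2) = (\<lambda>x. ?m x - a_star x)"
    by (auto simp: field_simps)
  ultimately have mid: "Lpow L p (\<lambda>x. ((b x - a_star x) + (a x - a_star x)) / 2) \<ge> \<Lambda>" by simp
  have small: "Lpow L p (\<lambda>x. b x - a x) \<le> 0 + e" if e: "e > 0" for e
  proof -
    \<comment> \<open>Compensates the factor \<open>2 * \<Lambda> + 1\<close>, in which the 1 covers
      \<open>\<Lambda> = 0\<close>.\<close>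
    define \<epsilon> where "\<epsilon> = e / (2 * \<Lambda> + 1)"
    have \<epsilon>: "\<epsilon> > 0" using e \<Lambda>0 by (simp add: \<epsilon>_def)
    obtain C where C: "C \<ge> 0" "\<And>(M :: (real^'n) measure) f g. in_L M p f \<Longrightarrow> in_L M p g \<Longrightarrow>
      Lpow M p (\<lambda>x. f x - g x) \<le> \<epsilon> * (Lpow M p f + Lpow M p g)
        + C * ((Lpow M p f + Lpow M p g) / 2 - Lpow M p (\<lambda>x. (f x + g x) / 2))"
      by (rule Lpow_uniformly_convex[OF p_gt_1 \<epsilon>, where ?'a = "real^'n"]) blast
    have "Lpow L p (\<lambda>x. (b x - a_star x) - (a x - a_star x))
      \<le> \<epsilon> * (Lpow L p (\<lambda>x. b x - a_star x) + \<Lambda>)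
        + C * ((Lpow L p (\<lambda>x. b x - a_star x) + \<Lambda>) / 2 - Lpow L p (\<lambda>x. ((b x - a_star x) + (a x - a_star x)) / 2))"
      unfolding \<Lambda>_def by (rule C(2)[OF i(2,1)])
    also have "\<dots> \<le> \<epsilon> * (2 * \<Lambda> + 1) + C * 0"
    proof (rule add_mono[OF mult_left_mono mult_left_mono])
      show "Lpow L p (\<lambda>x. b x - a_star x) + \<Lambda> \<le> 2 * \<Lambda> + 1" using le by (simp add: \<Lambda>_def)
      show "(Lpow L p (\<lambda>x. b x - a_star x) + \<Lambda>) / 2 - Lpow L p (\<lambda>x. ((b x - a_star x) + (a x - a_star x)) / 2) \<le> 0"
        using le mid unfolding \<Lambda>_def by argo
    qed (use \<epsilon> C(1) in auto)
    also have "\<dots> = e" using \<Lambda>0 by (simp add: \<epsilon>_def)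
    finally show ?thesis by simp
  qed
  have "Lpow L p (\<lambda>x. b x - a x) \<le> 0" by (rule field_le_epsilon) (rule small)
  then show ?thesis by (simp add: antisym)
qed

text \<open>Comparison with \<open>a_dag\<close> controls the misfit because \<alpha> and \<delta>
  tend to 0, and the penalty because their quotient \<delta>^l / \<alpha> does. Any subsequence then
  has a further one converging strongly to a coefficient with datum \<open>u_dag\<close> and no
  larger penalty, which is \<open>a_dag\<close> up to a null set.\<close>

lemma tikhonov_convergence:
  fixes \<delta> \<alpha> :: "nat \<Rightarrow> real" and y :: "nat \<Rightarrow> 'y" and a :: "nat \<Rightarrow> real^'n \<Rightarrow> real"
  assumes l: "l > 1" and a_dag: "a_dag \<in> D" "S a_dag = u_dag"
    and min: "\<And>c. c \<in> D \<Longrightarrow> S c = u_dag \<Longrightarrow> Lp_norm p \<Omega> (\<lambda>x. a_dag x - a_star x) \<le> Lp_norm p \<Omega> (\<lambda>x. c x - a_star x)"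
    and \<delta>: "\<And>k. \<delta> k > 0" "\<delta> \<longlonglongrightarrow> 0" and y: "\<And>k. norm (y k - u_dag) \<le> \<delta> k"
    and \<alpha>: "\<And>k. \<alpha> k > 0" "\<alpha> \<longlonglongrightarrow> 0" and ratio: "(\<lambda>k. \<delta> k powr l / \<alpha> k) \<longlonglongrightarrow> 0"
    and a: "\<And>k. is_arg_min (tikhonov S \<Omega> p l a_star (\<alpha> k) (y k)) (\<lambda>a. a \<in> D) (a k)"
  shows "(\<lambda>k. Lp_norm p \<Omega> (\<lambda>x. a k x - a_dag x)) \<longlonglongrightarrow> 0"
proof -
  define P where "P = max p 2"
  have P: "P > 0" by (simp add: P_def)
  have p0: "p > 0" using p_gt_1 by simp
  define Z where "Z c = Lpow L p (\<lambda>x. c x - a_star x)" for c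
  have Z0: "Z c \<ge> 0" for c by (simp add: Z_def)
  have norm_Z: "Lp_norm p \<Omega> (\<lambda>x. c x - a_star x) = Z c powr (1 / p)" for c
    by (simp add: Lp_norm_eq Z_def)
  have minZ: "Z a_dag \<le> Z c" if "c \<in> D" "S c = u_dag" for c
  proof -
    have "(Z a_dag powr (1 / p)) powr p \<le> (Z c powr (1 / p)) powr p"
      by (rule powr_mono2) (use min[OF that] p0 in \<open>auto simp: norm_Z\<close>)
    then show ?thesis using p0 Z0[of a_dag] Z0[of c] by (simp add: powr_powr)
  qed
  have aD: "a k \<in> D" for k using a[of k] by (simp add: is_arg_min_linorder)
  \<comment> \<open>The functional contains the norm to the power \<open>max p 2\<close>, the
    convexity arguments its p-th power; \<open>Z_\<rho>\<close> translates back.\<close>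
  define \<rho> where "\<rho> c = (Z c powr (1 / p)) powr P" for c
  have \<rho>0: "\<rho> c \<ge> 0" for c by (simp add: \<rho>_def)
  have Z_\<rho>: "Z c = \<rho> c powr (p / P)" for c
    using p0 P Z0[of c] by (simp add: \<rho>_def powr_powr)
  have key: "1 / l * norm (S (a k) - y k) powr l + \<alpha> k / P * \<rho> (a k) \<le> 1 / l * \<delta> k powr l + \<alpha> k / P * \<rho> a_dag" for k
  proof -
    have "tikhonov S \<Omega> p l a_star (\<alpha> k) (y k) (a k) \<le> tikhonov S \<Omega> p l a_star (\<alpha> k) (y k) a_dag"
      using a[of k] a_dag(1) by (simp add: is_arg_min_linorder)
    then have "1 / l * norm (S (a k) - y k) powr l + \<alpha> k / P * \<rho> (a k)
      \<le> 1 / l * norm (u_dag - y k) powr l + \<alpha> k / P * \<rho> a_dag"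
      unfolding tikhonov_def norm_Z a_dag(2) \<rho>_def P_def .
    also have "1 / l * norm (u_dag - y k) powr l \<le> 1 / l * \<delta> k powr l"
      using y[of k] l by (intro mult_left_mono powr_mono2) (auto simp: norm_minus_commute)
    finally show ?thesis by simp
  qed
  have S_lim: "(\<lambda>k. norm (S (a k) - u_dag)) \<longlonglongrightarrow> 0"
  proof -
    have le: "norm (S (a k) - u_dag) \<le> (\<delta> k powr l + l * (\<alpha> k / P * \<rho> a_dag)) powr (1 / l) + \<delta> k" for k
    proof -
      have "1 / l * norm (S (a k) - y k) powr l \<le> 1 / l * \<delta> k powr l + \<alpha> k / P * \<rho> a_dag"
      proof -
        have "0 \<le> \<alpha> k / P * \<rho> (a k)" using \<rho>0[of "a k"] \<alpha>(1)[of k] P by simp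
        then show ?thesis using key[of k] by linarith
      qed
      then have "norm (S (a k) - y k) powr l \<le> \<delta> k powr l + l * (\<alpha> k / P * \<rho> a_dag)"
        using l by (simp add: field_simps)
      then have "(norm (S (a k) - y k) powr l) powr (1 / l) \<le> (\<delta> k powr l + l * (\<alpha> k / P * \<rho> a_dag)) powr (1 / l)"
        using l by (intro powr_mono2) auto
      then have "norm (S (a k) - y k) \<le> (\<delta> k powr l + l * (\<alpha> k / P * \<rho> a_dag)) powr (1 / l)"
        using l by (simp add: powr_powr)
      then show ?thesis
        using norm_triangle_ineq[of "S (a k) - y k" "y k - u_dag"] y[of k] by simp
    qed
    have \<delta>l: "(\<lambda>k. \<delta> k powr l) \<longlonglongrightarrow> 0"
      using \<delta> l less_imp_le[OF \<delta>(1)] by (intro tendsto_zero_powrI[of _ _ "\<lambda>_. l" l]) auto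
    have "(\<lambda>k. \<delta> k powr l + l * (\<alpha> k / P * \<rho> a_dag)) \<longlonglongrightarrow> 0 + l * (0 / P * \<rho> a_dag)"
      using P by (intro tendsto_add tendsto_mult tendsto_divide tendsto_const \<delta>l \<alpha>(2)) simp
    then have "(\<lambda>k. (\<delta> k powr l + l * (\<alpha> k / P * \<rho> a_dag)) powr (1 / l)) \<longlonglongrightarrow> 0"
      using l \<rho>0 P less_imp_le[OF \<alpha>(1)]
      by (intro tendsto_zero_powrI[of _ _ "\<lambda>_. 1 / l" "1 / l"]) (auto intro!: always_eventually add_nonneg_nonneg mult_nonneg_nonneg divide_nonneg_pos)
    then have "(\<lambda>k. (\<delta> k powr l + l * (\<alpha> k / P * \<rho> a_dag)) powr (1 / l) + \<delta> k) \<longlonglongrightarrow> 0 + 0"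
      using \<delta>(2) by (rule tendsto_add)
    then have "(\<lambda>k. (\<delta> k powr l + l * (\<alpha> k / P * \<rho> a_dag)) powr (1 / l) + \<delta> k) \<longlonglongrightarrow> 0" by simp
    from real_tendsto_sandwich[OF _ _ tendsto_const this]
    show ?thesis using le by auto
  qed
  have Z_limsup: "eventually (\<lambda>k. Z (a k) \<le> Z a_dag + e) sequentially" if e: "e > 0" for e
  proof -
    \<comment> \<open>The comparison \<open>key\<close> without its misfit term, divided by
      \<open>\<alpha> k / P\<close>.\<close>
    have le: "\<rho> (a k) \<le> \<rho> a_dag + P / l * (\<delta> k powr l / \<alpha> k)" for k
    proof -
      have "0 \<le> 1 / l * norm (S (a k) - y k) powr l" using l by simp
      then have "\<alpha> k / P * \<rho> (a k) \<le> 1 / l * \<delta> k powr l + \<alpha> k / P * \<rho> a_dag" using key[of k] by linarith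
      then have "P / \<alpha> k * (\<alpha> k / P * \<rho> (a k)) \<le> P / \<alpha> k * (1 / l * \<delta> k powr l + \<alpha> k / P * \<rho> a_dag)"
        using P \<alpha>(1)[of k] by (intro mult_left_mono) auto
      moreover have "P / \<alpha> k * (\<alpha> k / P * \<rho> (a k)) = \<rho> (a k)" using P \<alpha>(1)[of k] by simp
      moreover have "P / \<alpha> k * (1 / l * \<delta> k powr l + \<alpha> k / P * \<rho> a_dag) = \<rho> a_dag + P / l * (\<delta> k powr l / \<alpha> k)"
        using P \<alpha>(1)[of k] by (simp add: distrib_left)
      ultimately show ?thesis by simp
    qed
    have "(\<lambda>k. \<rho> a_dag + P / l * (\<delta> k powr l / \<alpha> k)) \<longlonglongrightarrow> \<rho> a_dag + P / l * 0"
      by (intro tendsto_add tendsto_mult tendsto_const ratio)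
    then have "(\<lambda>k. (\<rho> a_dag + P / l * (\<delta> k powr l / \<alpha> k)) powr (p / P)) \<longlonglongrightarrow> (\<rho> a_dag + P / l * 0) powr (p / P)"
      using p0 P l \<rho>0 less_imp_le[OF \<alpha>(1)]
      by (intro tendsto_powr' tendsto_const) (auto intro!: always_eventually add_nonneg_nonneg mult_nonneg_nonneg divide_nonneg_nonneg)
    then have "(\<lambda>k. (\<rho> a_dag + P / l * (\<delta> k powr l / \<alpha> k)) powr (p / P)) \<longlonglongrightarrow> Z a_dag"
      by (simp add: Z_\<rho>[of a_dag])
    then have "eventually (\<lambda>k. (\<rho> a_dag + P / l * (\<delta> k powr l / \<alpha> k)) powr (p / P) < Z a_dag + e) sequentially"
      by (rule order_tendstoD) (use e in simp)
    then show ?thesis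
    proof eventually_elim
      case (elim k)
      have "\<rho> (a k) powr (p / P) \<le> (\<rho> a_dag + P / l * (\<delta> k powr l / \<alpha> k)) powr (p / P)"
        using p0 P le[of k] \<rho>0 by (intro powr_mono2) auto
      then show ?case using elim by (simp add: Z_\<rho>[of "a k"])
    qed
  qed
  have "(\<lambda>k. Lpow L p (\<lambda>x. a k x - a_dag x)) \<longlonglongrightarrow> 0"
  proof (rule ccontr)
    assume "\<not> ?thesis"
    then obtain e where e: "e > 0" and ne: "\<forall>N. \<exists>k\<ge>N. \<not> norm (Lpow L p (\<lambda>x. a k x - a_dag x) - 0) < e"
      unfolding LIMSEQ_iff by blast
    have "\<forall>N. \<exists>k>N. k \<in> {k. e \<le> Lpow L p (\<lambda>x. a k x - a_dag x)}"
    proof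
      fix N
      obtain k where "k \<ge> Suc N" "\<not> norm (Lpow L p (\<lambda>x. a k x - a_dag x) - 0) < e" using ne by blast
      then show "\<exists>k>N. k \<in> {k. e \<le> Lpow L p (\<lambda>x. a k x - a_dag x)}" by (intro exI[of _ k]) simp
    qed
    then have inf: "infinite {k. e \<le> Lpow L p (\<lambda>x. a k x - a_dag x)}"
      unfolding infinite_nat_iff_unbounded .
    obtain t :: "nat \<Rightarrow> nat" where t: "strict_mono t" "\<And>k. t k \<in> {k. e \<le> Lpow L p (\<lambda>x. a k x - a_dag x)}"
      using infinite_enumerate[OF inf] by blast
    obtain r a0 where r: "strict_mono (r :: nat \<Rightarrow> nat)" and a0: "a0 \<in> D"
      and A: "\<And>y c. eventually (\<lambda>k. norm (S (a (t (r k))) - y) \<le> c) sequentially \<Longrightarrow> norm (S a0 - y) \<le> c"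
      and B: "\<And>c. eventually (\<lambda>k. Lpow L p (\<lambda>x. a (t (r k)) x - a_star x) \<le> c) sequentially \<Longrightarrow> Lpow L p (\<lambda>x. a0 x - a_star x) \<le> c"
      and C: "(\<And>e. e > 0 \<Longrightarrow> eventually (\<lambda>k. Lpow L p (\<lambda>x. a (t (r k)) x - a_star x) \<le> Lpow L p (\<lambda>x. a0 x - a_star x) + e) sequentially)
        \<Longrightarrow> (\<lambda>k. Lpow L p (\<lambda>x. a (t (r k)) x - a0 x)) \<longlonglongrightarrow> 0"
      by (rule weak_limit[where a = "\<lambda>k. a (t k)", OF aD]) blast
    have sub: "eventually (\<lambda>k. Q (t (r k))) sequentially" if "eventually Q sequentially" for Q
      using eventually_subseq[OF strict_mono_o[OF t(1) r] that] by (simp add: o_def)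
    have small: "norm (S a0 - u_dag) \<le> 0 + c" if c: "c > 0" for c
    proof -
      have "eventually (\<lambda>k. norm (S (a k) - u_dag) < c) sequentially" using S_lim c by (rule order_tendstoD)
      then have "eventually (\<lambda>k. norm (S (a k) - u_dag) \<le> c) sequentially" by eventually_elim simp
      then show ?thesis using A[OF sub] by simp
    qed
    have "norm (S a0 - u_dag) \<le> 0" by (rule field_le_epsilon) (rule small)
    then have Sa0: "S a0 = u_dag" by simp
    have ge: "Z a_dag \<le> Z a0" by (rule minZ[OF a0 Sa0])
    have Z_le: "Z a0 \<le> Z a_dag + c" if c: "c > 0" for c
      unfolding Z_def[of a0] by (rule B) (use sub[OF Z_limsup[OF c]] in \<open>simp add: Z_def\<close>)
    have le: "Z a0 \<le> Z a_dag" by (rule field_le_epsilon) (rule Z_le)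
    \<comment> \<open>Since \<open>Z a_dag \<le> Z a0\<close>, the upper bound on the penalties
      along the sequence is the hypothesis of the Radon-Riesz conclusion.\<close>
    have conv: "(\<lambda>k. Lpow L p (\<lambda>x. a (t (r k)) x - a0 x)) \<longlonglongrightarrow> 0"
    proof (rule C)
      fix c :: real assume c: "c > 0"
      have "eventually (\<lambda>k. Z (a (t (r k))) \<le> Z a0 + c) sequentially"
        using sub[OF Z_limsup[OF c]] by eventually_elim (use ge in simp)
      then show "eventually (\<lambda>k. Lpow L p (\<lambda>x. a (t (r k)) x - a_star x) \<le> Lpow L p (\<lambda>x. a0 x - a_star x) + c) sequentially"
        by (simp add: Z_def)
    qed
    have zero: "Lpow L p (\<lambda>x. a0 x - a_dag x) = 0"
      by (rule minimum_norm_solution_unique[OF a_dag(1) a0])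
        (use a_dag(2) Sa0 minZ le in \<open>auto simp: Z_def\<close>)
    obtain K where K: "K \<ge> 0" "\<And>(M :: (real^'n) measure) f g h. in_L M p f \<Longrightarrow> in_L M p g \<Longrightarrow> in_L M p h \<Longrightarrow>
      Lpow M p (\<lambda>x. f x - h x) \<le> (1 + 1) * Lpow M p (\<lambda>x. f x - g x) + K * Lpow M p (\<lambda>x. g x - h x)"
      by (rule Lpow_triangle[OF p0 zero_less_one, where ?'a = "real^'n"]) blast
    have bound: "e \<le> (1 + 1) * Lpow L p (\<lambda>x. a (t (r k)) x - a0 x)" for k
    proof -
      have "e \<le> Lpow L p (\<lambda>x. a (t (r k)) x - a_dag x)" using t(2)[of "r k"] by simp
      also have "\<dots> \<le> (1 + 1) * Lpow L p (\<lambda>x. a (t (r k)) x - a0 x) + K * Lpow L p (\<lambda>x. a0 x - a_dag x)"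
        by (rule K(2)[OF D_in_Lp(1)[OF aD] D_in_Lp(1)[OF a0] D_in_Lp(1)[OF a_dag(1)]])
      finally show ?thesis using zero by simp
    qed
    have "(\<lambda>k. (1 + 1) * Lpow L p (\<lambda>x. a (t (r k)) x - a0 x)) \<longlonglongrightarrow> (1 + 1) * 0"
      by (intro tendsto_mult tendsto_const conv)
    then have "e \<le> (1 + 1) * 0" by (rule LIMSEQ_le_const) (use bound in blast)
    then show False using e by simp
  qed
  then have "(\<lambda>k. Lpow L p (\<lambda>x. a k x - a_dag x) powr (1 / p)) \<longlonglongrightarrow> 0"
    using p0 by (intro tendsto_zero_powrI[of _ _ "\<lambda>_. 1 / p" "1 / p"]) auto
  then show ?thesis by (simp add: Lp_norm_eq)
qed

end

theorem theorem4p5: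
  fixes \<Omega> :: "(real^'n) set"
    and \<kappa> a_star a_dag :: "(real^'n) \<Rightarrow> real"
    and \<mu> :: "(real^'n) set \<Rightarrow> real"
    and \<iota> :: "((real^'n) \<Rightarrow> real) \<Rightarrow> 'y::banach"
    and u_dag :: 'y
    and c_low c_up p q a_low M \<tau> l :: real
  defines "D \<equiv> admissible_set \<Omega> q a_low M"
    and "S \<equiv> solution_operator \<Omega> \<kappa> \<mu> \<iota>"
  assumes "CARD('n) \<ge> 2"
    and "bounded_C11_domain \<Omega>"
    and "\<kappa> \<in> borel_measurable (lebesgue_on \<Omega>)"
    and "0 < c_low" and "c_low < c_up"
    and "AE x in lebesgue_on \<Omega>. c_low \<le> \<kappa> x \<and> \<kappa> x \<le> c_up"
    and "signed_borel_measure (closure \<Omega>) \<mu>"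
    and "p > real CARD('n) / 2" and "q \<ge> p" and "a_low > 0" and "M > 0"
    and "well_posed \<Omega> \<kappa> D"
    and "1 \<le> \<tau>" and "\<tau> < crit_exp TYPE('n)" and "H1_embedding \<tau> \<Omega> \<iota>"
    and "l > 1"
    and "a_star \<in> Lp p \<Omega>"
    and "u_dag \<in> S ` D"
    and "is_arg_min (\<lambda>a. Lp_norm p \<Omega> (\<lambda>x. a x - a_star x)) (\<lambda>a. a \<in> D \<and> S a = u_dag) a_dag"
  shows "(\<forall>\<alpha>>0. \<forall>y. \<exists>a. is_arg_min (tikhonov S \<Omega> p l a_star \<alpha> y) (\<lambda>a. a \<in> D) a) \<and>
    (\<forall>(\<delta> :: nat \<Rightarrow> real) (\<alpha> :: nat \<Rightarrow> real) (y :: nat \<Rightarrow> 'y) (a :: nat \<Rightarrow> (real^'n) \<Rightarrow> real).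
       (\<forall>k. \<delta> k > 0) \<and> \<delta> \<longlonglongrightarrow> 0 \<and>
       (\<forall>k. norm (y k - u_dag) \<le> \<delta> k) \<and>
       (\<forall>k. \<alpha> k > 0) \<and> \<alpha> \<longlonglongrightarrow> 0 \<and> (\<lambda>k. \<delta> k powr l / \<alpha> k) \<longlonglongrightarrow> 0 \<and>
       (\<forall>k. is_arg_min (tikhonov S \<Omega> p l a_star (\<alpha> k) (y k)) (\<lambda>a. a \<in> D) (a k))
       \<longrightarrow> (\<lambda>k. Lp_norm p \<Omega> (\<lambda>x. a k x - a_dag x)) \<longlonglongrightarrow> 0)"
proof -
  have \<Omega>: "open \<Omega>" "bounded \<Omega>" using assms(4) by (auto simp: bounded_C11_domain_def)
  have \<kappa>: "AE x in lebesgue_on \<Omega>. \<bar>\<kappa> x\<bar> \<le> c_up"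
    using assms(8) by eventually_elim (use assms(6) in auto)
  interpret elliptic_problem \<Omega> \<kappa> a_star \<mu> \<iota> c_up p q a_low M \<tau>
    using assms(3,5,9-17,19) \<Omega> \<kappa> by unfold_locales (auto simp: D_def)
  have a_dag: "a_dag \<in> D" "S a_dag = u_dag"
    and min: "\<And>c. c \<in> D \<Longrightarrow> S c = u_dag \<Longrightarrow>
      Lp_norm p \<Omega> (\<lambda>x. a_dag x - a_star x) \<le> Lp_norm p \<Omega> (\<lambda>x. c x - a_star x)"
    using assms(21) by (auto simp: is_arg_min_linorder)
  \<comment> \<open>The exact datum belongs to a coefficient in \<open>D\<close>; existence of
    minimisers rests on \<open>D\<close> being nonempty.\<close>
  have ne: "admissible_set \<Omega> q a_low M \<noteq> {}" using a_dag(1) by (auto simp: D_def)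
  show ?thesis
  proof (intro conjI allI impI)
    fix \<alpha> :: real and y :: 'y
    assume "\<alpha> > 0"
    then show "\<exists>a. is_arg_min (tikhonov S \<Omega> p l a_star \<alpha> y) (\<lambda>a. a \<in> D) a"
      unfolding D_def S_def by (rule tikhonov_minimizer[OF ne _ assms(18)])
  next
    fix \<delta> \<alpha> :: "nat \<Rightarrow> real" and y :: "nat \<Rightarrow> 'y" and a :: "nat \<Rightarrow> (real^'n) \<Rightarrow> real"
    assume H: "(\<forall>k. \<delta> k > 0) \<and> \<delta> \<longlonglongrightarrow> 0 \<and> (\<forall>k. norm (y k - u_dag) \<le> \<delta> k) \<and>
       (\<forall>k. \<alpha> k > 0) \<and> \<alpha> \<longlonglongrightarrow> 0 \<and> (\<lambda>k. \<delta> k powr l / \<alpha> k) \<longlonglongrightarrow> 0 \<and>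
       (\<forall>k. is_arg_min (tikhonov S \<Omega> p l a_star (\<alpha> k) (y k)) (\<lambda>a. a \<in> D) (a k))"
    show "(\<lambda>k. Lp_norm p \<Omega> (\<lambda>x. a k x - a_dag x)) \<longlonglongrightarrow> 0"
      by (rule tikhonov_convergence[where u_dag = u_dag and \<delta> = \<delta> and \<alpha> = \<alpha> and y = y and l = l])
        (use H a_dag min assms(18) in \<open>auto simp: D_def S_def\<close>)
  qed
qed

end
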